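(* Let $l=2h+1\ge3$ be odd and $q$ a primitive $l$-th root of unity. Then $\mathcal{P}_{h+1}=\mathrm{Hig}(U_qsl(2))$, where $\mathcal{P}_{h+1}:=\mathcal{D}_l\cap\mathcal{R}_l$.
   Context: Put $[n]=\frac{q^n-q^{-n}}{q-q^{-1}}$. $H=U_qsl(2)$ is the $l^3$-dimensional complex Hopf algebra generated by $E,F,K$ with $E^l=F^l=0$, $K^l=1$, $KE=q^2EK$, $KF=q^{-2}FK$, $[E,F]=\frac{K-K^{-1}}{q-q^{-1}}$, $\Delta(E)=1\otimes E+E\otimes K$, $\Delta(F)=K^{-1}\otimes F+F\otimes 1$, $\Delta(K)=K\otimes K$, $\epsilon(E)=\epsilon(F)=0$, $\epsilon(K)=1$, $S(E)=-EK^{-1}$, $S(F)=-KF$, $S(K)=K^{-1}$. Its $R$-matrix is $R=\frac{1}{l}\sum_{0\leq m,i,j\leq l-1}\frac{(q-q^{-1})^m}{[m]!}q^{\frac{m(m-1)}{2}+2m(i-j)-2ij}E^mK^i\otimes F^mK^j$, and its integral is $\Lambda=\zeta F^{l-1}E^{l-1}\sum_{j=0}^{l-1}K^j$ with $\zeta=\frac{\sqrt l}{([l-1]!)^2}$. For $r=1,\dots,l$, $V_r$ is the irreducible module with basis $v_0,\dots,v_{r-1}$ and $Kv_n=q^{r-1-2n}v_n$, $Ev_n=[n][r-n]v_{n-1}$, $Fv_n=v_{n+1}$ (with $v_{-1}=v_r=0$). The q-character of a module $V$ is $\mathrm{qCh}_V=\mathrm{Tr}_V(K^{-1}\,\cdot\,)\in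 H^*$. The Drinfeld map is $\chi(\beta)=(\beta\otimes\mathrm{id})(R_{21}R)$ and the Radford map is $\phi(\beta)=(\beta\otimes\mathrm{id})\Delta(\Lambda)$. $\mathcal{D}_l$ and $\mathcal{R}_l$ denote the linear spans of $\{\chi(\mathrm{qCh}_{V_r})\}_{r=1}^l$ and $\{\phi(\mathrm{qCh}_{V_r})\}_{r=1}^l$ respectively; both are contained in the center. The Higman ideal $\mathrm{Hig}(H)$ is the image of $\tau:H\to H$, $\tau(x)=\sum S(\Lambda_{(2)})\,x\,\Lambda_{(1)}G^{-1}$, with balancing element $G=K$. *)

theory Defs
  imports
    Complex_Main
    "HOL-Library.Poly_Mapping"
    "HOL-Library.Product_Plus"
    "HOL-Algebra.QuotRing"
    "Jordan_Normal_Form.Matrix"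
begin

section \<open>Free algebras and their tensor squares\<close>

text \<open>
  Words form a monoid under concatenation, written additively because this is what the convolution
  product of \<^theory>\<open>HOL-Library.Poly_Mapping\<close> expects.  Finitely supported functions on
  words are then the free complex algebra, and finitely supported functions on pairs of
  words (with componentwise concatenation) are its tensor square, with the product
  (a (x) b)(c (x) d) = ac (x) bd.
\<close>

instantiation list :: (type) monoid_add
begin

definition zero_list :: "'a list" where "zero_list = []"

definition plus_list :: "'a list \<Rightarrow> 'a list \<Rightarrow> 'a list" where "plus_list = append"

instance by standard (simp_all add: zero_list_def plus_list_def)

end

datatype generator = gE | gF | gK

type_synonym falg = "generator list \<Rightarrow>\<^sub>0 complex"
type_synonym falg2 = "(generator list \<times> generator list) \<Rightarrow>\<^sub>0 complex"

definition scal :: "complex \<Rightarrow> ('a::monoid_add \<Rightarrow>\<^sub>0 complex)" where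
  "scal c = Poly_Mapping.single 0 c"

definition gen :: "generator \<Rightarrow> falg" where
  "gen g = Poly_Mapping.single [g] 1"

abbreviation fE :: falg where "fE \<equiv> gen gE"
abbreviation fF :: falg where "fF \<equiv> gen gF"
abbreviation fK :: falg where "fK \<equiv> gen gK"

definition pure_tensor :: "falg \<Rightarrow> falg \<Rightarrow> falg2" (infixl \<open>\<otimes>\<^sub>f\<close> 72) where
  "x \<otimes>\<^sub>f y = (\<Sum>u\<in>Poly_Mapping.keys x. \<Sum>v\<in>Poly_Mapping.keys y.
     Poly_Mapping.single (u, v) (Poly_Mapping.lookup x u * Poly_Mapping.lookup y v))"

definition alg_lift ::
    "(generator \<Rightarrow> ('a::monoid_add \<Rightarrow>\<^sub>0 complex)) \<Rightarrow> falg \<Rightarrow> ('a \<Rightarrow>\<^sub>0 complex)" where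
  "alg_lift f x = (\<Sum>w\<in>Poly_Mapping.keys x.
     scal (Poly_Mapping.lookup x w) * prod_list (map f w))"

definition antialg_lift ::
    "(generator \<Rightarrow> ('a::monoid_add \<Rightarrow>\<^sub>0 complex)) \<Rightarrow> falg \<Rightarrow> ('a \<Rightarrow>\<^sub>0 complex)" where
  "antialg_lift f x = (\<Sum>w\<in>Poly_Mapping.keys x.
     scal (Poly_Mapping.lookup x w) * prod_list (map f (rev w)))"

definition type_ring :: "'a::ring_1 ring" where
  "type_ring = \<lparr>carrier = UNIV, monoid.mult = (*), one = 1, zero = 0, add = (+)\<rparr>"


section \<open>Quantum integers and roots of unity\<close>

definition primitive_root :: "nat \<Rightarrow> complex \<Rightarrow> bool" where
  "primitive_root l q \<longleftrightarrow> 0 < l \<and> q ^ l = 1 \<and> (\<forall>k. 0 < k \<and> k < l \<longrightarrow> q ^ k \<noteq> 1)"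

definition qint :: "complex \<Rightarrow> nat \<Rightarrow> complex" where
  "qint q n = (q powi int n - q powi (- int n)) / (q - inverse q)"

definition qfact :: "complex \<Rightarrow> nat \<Rightarrow> complex" where
  "qfact q n = (\<Prod>k=1..n. qint q k)"


section \<open>The algebra \<open>U\<^sub>q sl(2)\<close> and its tensor square\<close>

text \<open>
  In the presented algebra the inverse of K is \<open>K ^ (l - 1)\<close>, since \<open>K ^ l = 1\<close>.
\<close>

definition relations :: "nat \<Rightarrow> complex \<Rightarrow> falg set" where
  "relations l q =
     { fE ^ l,
       fF ^ l,
       fK ^ l - 1,
       fK * fE - scal (q powi 2) * fE * fK,
       fK * fF - scal (q powi (-2)) * fF * fK,
       fE * fF - fF * fE - scal (1 / (q - inverse q)) * (fK - fK ^ (l - 1)) }"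

definition rel_ideal :: "nat \<Rightarrow> complex \<Rightarrow> falg set" where
  "rel_ideal l q = genideal type_ring (relations l q)"

definition Uqsl2 :: "nat \<Rightarrow> complex \<Rightarrow> falg set ring" where
  "Uqsl2 l q = type_ring Quot rel_ideal l q"

definition cls :: "nat \<Rightarrow> complex \<Rightarrow> falg \<Rightarrow> falg set" where
  "cls l q x = rel_ideal l q +>\<^bsub>type_ring\<^esub> x"

definition scale :: "nat \<Rightarrow> complex \<Rightarrow> complex \<Rightarrow> falg set \<Rightarrow> falg set" where
  "scale l q c X = cls l q (scal c) \<otimes>\<^bsub>Uqsl2 l q\<^esub> X"

text \<open>
  With A the free algebra and I the ideal of relations, (A/I) (x) (A/I) is the quotient
  of A (x) A by I (x) A + A (x) I, the ideal generated by I (x) 1 and 1 (x) I.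
\<close>

definition rel_ideal2 :: "nat \<Rightarrow> complex \<Rightarrow> falg2 set" where
  "rel_ideal2 l q = genideal type_ring
     ((\<lambda>x. x \<otimes>\<^sub>f 1) ` rel_ideal l q \<union> (\<lambda>x. 1 \<otimes>\<^sub>f x) ` rel_ideal l q)"

definition Uqsl2_tensor :: "nat \<Rightarrow> complex \<Rightarrow> falg2 set ring" where
  "Uqsl2_tensor l q = type_ring Quot rel_ideal2 l q"

definition cls2 :: "nat \<Rightarrow> complex \<Rightarrow> falg2 \<Rightarrow> falg2 set" where
  "cls2 l q t = rel_ideal2 l q +>\<^bsub>type_ring\<^esub> t"

text \<open>
  From here on, a map out of a quotient is the one induced by a map \<open>f\<close> of representatives,
  \<open>\<lambda>X. the_elem (f ` X)\<close>, as in the first isomorphism theorem of HOL-Algebra; this is the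
  intended map whenever \<open>f\<close> is constant on cosets.
\<close>


section \<open>Hopf algebra structure\<close>

primrec coproduct_gen :: "nat \<Rightarrow> generator \<Rightarrow> falg2" where
  "coproduct_gen l gE = 1 \<otimes>\<^sub>f fE + fE \<otimes>\<^sub>f fK"
| "coproduct_gen l gF = fK ^ (l - 1) \<otimes>\<^sub>f fF + fF \<otimes>\<^sub>f 1"
| "coproduct_gen l gK = fK \<otimes>\<^sub>f fK"

primrec counit_gen :: "generator \<Rightarrow> complex" where
  "counit_gen gE = 0"
| "counit_gen gF = 0"
| "counit_gen gK = 1"

primrec antipode_gen :: "nat \<Rightarrow> generator \<Rightarrow> falg" where
  "antipode_gen l gE = - (fE * fK ^ (l - 1))"
| "antipode_gen l gF = - (fK * fF)"
| "antipode_gen l gK = fK ^ (l - 1)"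

definition coproduct :: "nat \<Rightarrow> complex \<Rightarrow> falg set \<Rightarrow> falg2 set" where
  "coproduct l q X = the_elem ((\<lambda>x. cls2 l q (alg_lift (coproduct_gen l) x)) ` X)"

definition counit :: "falg set \<Rightarrow> complex" where
  "counit X = the_elem ((\<lambda>x. \<Sum>w\<in>Poly_Mapping.keys x.
     Poly_Mapping.lookup x w * prod_list (map counit_gen w)) ` X)"

definition antipode :: "nat \<Rightarrow> complex \<Rightarrow> falg set \<Rightarrow> falg set" where
  "antipode l q X = the_elem ((\<lambda>x. cls l q (antialg_lift (antipode_gen l) x)) ` X)"

definition flip :: "nat \<Rightarrow> complex \<Rightarrow> falg2 set \<Rightarrow> falg2 set" where
  "flip l q T = the_elem ((\<lambda>t. cls2 l q (Poly_Mapping.map_key prod.swap t)) ` T)"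

text \<open>
  The linear map \<open>a (x) b \<mapsto> f a b\<close> on the tensor square determined by a bilinear map \<open>f\<close>;
  in Sweedler notation, \<open>bilin_ext l q f (coproduct l q x)\<close> is the sum of
  the \<open>f x\<^sub>(\<^sub>1\<^sub>) x\<^sub>(\<^sub>2\<^sub>)\<close>.
\<close>

definition bilin_ext ::
    "nat \<Rightarrow> complex \<Rightarrow> (falg set \<Rightarrow> falg set \<Rightarrow> falg set) \<Rightarrow> falg2 set \<Rightarrow> falg set" where
  "bilin_ext l q f T = the_elem ((\<lambda>t.
     \<Oplus>\<^bsub>Uqsl2 l q\<^esub>p\<in>Poly_Mapping.keys t. scale l q (Poly_Mapping.lookup t p)
       (f (cls l q (Poly_Mapping.single (fst p) 1)) (cls l q (Poly_Mapping.single (snd p) 1)))) ` T)"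

definition apply_left :: "nat \<Rightarrow> complex \<Rightarrow> (falg set \<Rightarrow> complex) \<Rightarrow> falg2 set \<Rightarrow> falg set" where
  "apply_left l q \<beta> T = bilin_ext l q (\<lambda>a b. scale l q (\<beta> a) b) T"

definition R_matrix :: "nat \<Rightarrow> complex \<Rightarrow> falg2 set" where
  "R_matrix l q = cls2 l q (scal (1 / of_nat l) * (\<Sum>m<l. \<Sum>i<l. \<Sum>j<l.
     scal ((q - inverse q) ^ m / qfact q m
       * q powi (int (m * (m - 1) div 2) + 2 * int m * (int i - int j) - 2 * int i * int j))
     * ((fE ^ m * fK ^ i) \<otimes>\<^sub>f (fF ^ m * fK ^ j))))"

definition Lambda :: "nat \<Rightarrow> complex \<Rightarrow> falg set" where
  "Lambda l q = cls l q (scal (of_real (sqrt (real l)) / (qfact q (l - 1))\<^sup>2)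
     * fF ^ (l - 1) * fE ^ (l - 1) * (\<Sum>j<l. fK ^ j))"

definition balancing :: "nat \<Rightarrow> complex \<Rightarrow> falg set" where
  "balancing l q = cls l q fK"


section \<open>The irreducible modules \<open>V\<^sub>r\<close> and their q-characters\<close>

text \<open>Matrices with respect to \<open>v\<^sub>0, \<dots>, v\<^bsub>r-1\<^esub>\<close>; columns are the images of basis vectors.\<close>

primrec V_gen :: "complex \<Rightarrow> nat \<Rightarrow> generator \<Rightarrow> complex mat" where
  "V_gen q r gE = mat r r (\<lambda>(i, n). if n = i + 1 then qint q n * qint q (r - n) else 0)"
| "V_gen q r gF = mat r r (\<lambda>(i, n). if i = n + 1 then 1 else 0)"
| "V_gen q r gK = mat r r (\<lambda>(i, n). if i = n then q powi (int r - 1 - 2 * int n) else 0)"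

definition V_word :: "complex \<Rightarrow> nat \<Rightarrow> generator list \<Rightarrow> complex mat" where
  "V_word q r w = foldr (\<lambda>g M. V_gen q r g * M) w (1\<^sub>m r)"

definition V_free :: "complex \<Rightarrow> nat \<Rightarrow> falg \<Rightarrow> complex mat" where
  "V_free q r x = mat r r (\<lambda>ij. \<Sum>w\<in>Poly_Mapping.keys x.
     Poly_Mapping.lookup x w * (V_word q r w $$ ij))"

definition V_rep :: "complex \<Rightarrow> nat \<Rightarrow> falg set \<Rightarrow> complex mat" where
  "V_rep q r X = the_elem (V_free q r ` X)"

definition mat_trace :: "complex mat \<Rightarrow> complex" where
  "mat_trace M = (\<Sum>i<dim_row M. M $$ (i, i))"

definition qCh :: "nat \<Rightarrow> complex \<Rightarrow> nat \<Rightarrow> falg set \<Rightarrow> complex" where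
  "qCh l q r X = mat_trace
     (V_rep q r (inv\<^bsub>Uqsl2 l q\<^esub> (cls l q fK) \<otimes>\<^bsub>Uqsl2 l q\<^esub> X))"


section \<open>Drinfeld map, Radford map and Higman ideal\<close>

definition drinfeld_map :: "nat \<Rightarrow> complex \<Rightarrow> (falg set \<Rightarrow> complex) \<Rightarrow> falg set" where
  "drinfeld_map l q \<beta> =
     apply_left l q \<beta> (flip l q (R_matrix l q) \<otimes>\<^bsub>Uqsl2_tensor l q\<^esub> R_matrix l q)"

definition radford_map :: "nat \<Rightarrow> complex \<Rightarrow> (falg set \<Rightarrow> complex) \<Rightarrow> falg set" where
  "radford_map l q \<beta> = apply_left l q \<beta> (coproduct l q (Lambda l q))"

definition lin_span :: "nat \<Rightarrow> complex \<Rightarrow> (nat \<Rightarrow> falg set) \<Rightarrow> nat set \<Rightarrow> falg set set" where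
  "lin_span l q z J = {\<Oplus>\<^bsub>Uqsl2 l q\<^esub>r\<in>J. scale l q (c r) (z r) | c. True}"

definition drinfeld_span :: "nat \<Rightarrow> complex \<Rightarrow> falg set set" where
  "drinfeld_span l q = lin_span l q (\<lambda>r. drinfeld_map l q (qCh l q r)) {1..l}"

definition radford_span :: "nat \<Rightarrow> complex \<Rightarrow> falg set set" where
  "radford_span l q = lin_span l q (\<lambda>r. radford_map l q (qCh l q r)) {1..l}"

definition P_span :: "nat \<Rightarrow> complex \<Rightarrow> falg set set" where
  "P_span l q = drinfeld_span l q \<inter> radford_span l q"

definition higman_map :: "nat \<Rightarrow> complex \<Rightarrow> falg set \<Rightarrow> falg set" where
  "higman_map l q x = bilin_ext l q
     (\<lambda>a b. antipode l q b \<otimes>\<^bsub>Uqsl2 l q\<^esub> x \<otimes>\<^bsub>Uqsl2 l q\<^esub> a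
       \<otimes>\<^bsub>Uqsl2 l q\<^esub> inv\<^bsub>Uqsl2 l q\<^esub> balancing l q)
     (coproduct l q (Lambda l q))"

definition higman_ideal :: "nat \<Rightarrow> complex \<Rightarrow> falg set set" where
  "higman_ideal l q = higman_map l q ` carrier (Uqsl2 l q)"

end

theory Submission
  imports Defs "HOL-Computational_Algebra.Polynomial"
begin

text \<open>
  Put \<open>d = (q - q\<^sup>-\<^sup>1)\<^sup>2\<close>, \<open>c\<^sub>n = q\<^sup>n + q\<^sup>-\<^sup>n\<close>, let \<open>C = d E F + q\<^sup>-\<^sup>1 K + q K\<^sup>-\<^sup>1\<close> be the Casimir element and
  \<open>\<Psi>(y) = \<Prod>\<^sub>i (y - c\<^sub>i)\<close>, \<open>i < l\<close>, so that \<open>\<Psi>(C) = 0\<close>; put \<open>\<Psi>\<^sub>s = \<Psi> / (y - c\<^sub>s)\<close>.  The Drinfeld images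
  satisfy the Chebyshev recursion \<open>C D\<^sub>r = D\<^sub>r\<^sub>+\<^sub>1 + D\<^sub>r\<^sub>-\<^sub>1\<close> and therefore span the polynomials in C.
  The Radford image \<open>R\<^sub>s\<close> is, up to a common factor, \<open>\<Psi>\<^sub>s(C)\<close> times a sum of spectral idempotents of
  K, and with the same factor \<open>R\<^sub>s + R\<^sub>l\<^sub>-\<^sub>s\<close> is \<open>\<Psi>\<^sub>s(C)\<close>.  The Higman map is linear over the polynomials
  in C, kills \<open>E\<^sup>u K\<^sup>p\<close> and \<open>F\<^sup>u K\<^sup>p\<close> unless \<open>u = 0\<close> and l divides p, and sends 1 to a multiple of \<open>\<Psi>'(C)\<close>.
  Since \<open>\<Psi>'(C) f(C) = \<Sum>\<^sub>i f(c\<^sub>i) \<Psi>\<^sub>i(C)\<close>, the Higman ideal is spanned by \<open>R\<^sub>l\<close> and the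
  \<open>R\<^sub>s + R\<^sub>l\<^sub>-\<^sub>s\<close>, and lies in both spans.  Conversely, if \<open>f(C) = \<Sum>\<^sub>s b\<^sub>s R\<^sub>s\<close>, the action on the projective
  cover of \<open>V\<^sub>s\<close>, where \<open>C - c\<^sub>s\<close> is nilpotent but not zero, shows that \<open>f'(c\<^sub>s)\<close> is \<open>b\<^sub>s\<close> times a nonzero
  constant that is the same for s and \<open>l - s\<close>; as \<open>c\<^sub>s = c\<^sub>l\<^sub>-\<^sub>s\<close>, this gives \<open>b\<^sub>s = b\<^sub>l\<^sub>-\<^sub>s\<close>.
\<close>

section \<open>Algebras with central complex scalars\<close>

text \<open>The obstacle is linear independence: generators and relations alone do not bound the
  algebra from below. The argument is arranged so that independence enters at one point, the
  equality of \<open>b s\<close> and \<open>b (l - s)\<close>, where a single matrix coefficient on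
  an explicit module of dimension 2 l decides. The other steps inside the algebra are identities
  valid in every ring with central scalars whose elements \<open>E\<close>, \<open>F\<close>,
  \<open>K\<close> satisfy the relations, or they use only that certain products span. Such
  identities are proved weight by weight. Against a spectral idempotent of K, the products E^m F^m
  and F^m E^m become products of factors C - c_i, so that claims about the algebra turn into claims
  about complex polynomials. As l is odd, 2 is invertible modulo l, and a chain of weights in steps
  of 2 meets every residue once: a full chain of factors is Psi, a chain with one factor removed is
  a summand of Psi'. The pairing of s with l - s comes from c_s = c_(l-s), which makes every root of
  Psi except c_0 double.\<close>

locale central_scalars =
  fixes sc :: "complex \<Rightarrow> 'a::ring_1"
  assumes sc_add: "sc (a + b) = sc a + sc b"
    and sc_mult: "sc (a * b) = sc a * sc b"
    and sc_1 [simp]: "sc 1 = 1"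
    and sc_comm: "sc a * x = x * sc a"
begin

definition smul :: "complex \<Rightarrow> 'a \<Rightarrow> 'a" (infixr \<open>\<cdot>\<close> 75) where
  "c \<cdot> x = sc c * x"

sublocale vector_space smul
  by unfold_locales (auto simp: smul_def sc_add sc_mult algebra_simps)

lemma smul_mult [simp]: "(c \<cdot> x) * y = c \<cdot> (x * y)"
  by (simp add: smul_def mult.assoc)

lemma mult_smul [simp]: "x * (c \<cdot> y) = c \<cdot> (x * y)"
  unfolding smul_def by (metis mult.assoc sc_comm)

lemma smul_1_eq: "c \<cdot> 1 = sc c"
  by (simp add: smul_def)

lemma sc_0 [simp]: "sc 0 = 0"
  using sc_add[of 0 0] by simp

lemma sc_minus: "sc (- c) = - sc c"
  using scale_minus_left[of c 1] by (simp add: smul_1_eq)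

lemma power_smul: "(c \<cdot> x) ^ n = c ^ n \<cdot> x ^ n"
  by (induction n) (simp_all add: mult_ac)

text \<open>Horner evaluation at an element of a noncommutative ring. Identities between elements
  f(C) can then be proved in the commutative ring \<open>complex poly\<close>.\<close>

definition ev :: "'a \<Rightarrow> complex poly \<Rightarrow> 'a" where
  "ev x p = fold_coeffs (\<lambda>a b. sc a + x * b) p 0"

lemma ev_0 [simp]: "ev x 0 = 0"
  by (simp add: ev_def)

lemma ev_pCons: "ev x (pCons a p) = sc a + x * ev x p"
  by (cases "p = 0 \<and> a = 0") (auto simp: ev_def)

lemma ev_1 [simp]: "ev x 1 = 1"
  by (simp add: one_pCons ev_pCons)

lemma ev_add: "ev x (p + r) = ev x p + ev x r"
  by (induction p r rule: poly_induct2) (simp_all add: ev_pCons sc_add algebra_simps)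

lemma ev_smult: "ev x (smult c p) = c \<cdot> ev x p"
proof (induction p)
  case (pCons a p)
  have "sc (c * a) = c \<cdot> sc a"
    by (simp add: smul_def sc_mult)
  then show ?case
    using pCons by (simp add: ev_pCons scale_right_distrib)
qed simp

lemma ev_commute:
  assumes "y * x = x * y"
  shows "y * ev x p = ev x p * y"
proof (induction p)
  case (pCons a p)
  have "y * (x * ev x p) = x * (y * ev x p)"
    by (simp add: mult.assoc[symmetric] assms)
  then show ?case
    using pCons sc_comm[of a y] by (simp add: ev_pCons distrib_left distrib_right mult.assoc)
qed simp

lemma ev_mult: "ev x (p * r) = ev x p * ev x r"
  by (induction p)
    (simp_all add: ev_pCons ev_add ev_smult smul_def algebra_simps)

lemma ev_minus: "ev x (- p) = - ev x p"
  using ev_smult[of x "-1" p] by simp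

lemma ev_diff: "ev x (p - r) = ev x p - ev x r"
  using ev_add[of x p "- r"] by (simp add: ev_minus)

lemma ev_sum: "ev x (\<Sum>i\<in>A. f i) = (\<Sum>i\<in>A. ev x (f i))"
  by (induction A rule: infinite_finite_induct) (simp_all add: ev_add)

lemma ev_linear: "ev x [:- c, 1:] = x - sc c"
  by (simp add: ev_pCons sc_minus)

lemma ev_monom: "ev x [:0, 1:] = x"
  by (simp add: ev_pCons)

end

section \<open>Roots of unity and periodic families\<close>

locale odd_root =
  fixes l h :: nat and q :: complex
  assumes l_odd: "l = 2 * h + 1" and l_ge: "l \<ge> 3" and root: "primitive_root l q"
begin

lemma q_nz [simp]: "q \<noteq> 0"
proof
  assume "q = 0"
  moreover have "q ^ l = 1"
    using root by (simp add: primitive_root_def)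
  ultimately show False
    using l_ge by (simp add: power_0_left split: if_splits)
qed

lemma l_pos [simp]: "0 < l"
  using l_ge by simp

lemma odd_l [simp]: "odd l"
  by (subst l_odd) simp

lemma q_powi_l: "q powi (int l * n) = 1"
proof -
  have "q powi int l = 1"
    using root by (simp add: primitive_root_def)
  then show ?thesis
    by (simp add: power_int_mult)
qed

lemma q_powi_mod: "q powi (n mod int l) = q powi n"
proof -
  have "q powi n = q powi (int l * (n div int l) + n mod int l)"
    by simp
  also have "\<dots> = q powi (n mod int l)"
    by (subst power_int_add) (simp_all add: q_powi_l)
  finally show ?thesis ..
qed

lemma q_powi_eq_1_iff: "q powi n = 1 \<longleftrightarrow> int l dvd n"
proof
  assume "q powi n = 1"
  then have "q powi (n mod int l) = 1"
    by (simp add: q_powi_mod)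
  then have "q ^ nat (n mod int l) = 1"
    by (simp add: power_int_def)
  moreover have "nat (n mod int l) < l"
    by (simp add: nat_less_iff)
  ultimately have "\<not> 0 < nat (n mod int l)"
    using root by (auto simp: primitive_root_def)
  moreover have "0 \<le> n mod int l"
    by simp
  ultimately have "n mod int l = 0"
    by linarith
  then show "int l dvd n"
    by (simp add: dvd_eq_mod_eq_0)
next
  assume "int l dvd n"
  then show "q powi n = 1"
    by (auto simp: q_powi_l)
qed

lemma q_powi_eq_iff: "q powi m = q powi n \<longleftrightarrow> int l dvd (m - n)"
  by (simp add: q_powi_eq_1_iff[symmetric] power_int_diff)

text \<open>Oddness of l enters here: 2 is a unit modulo l, so q^2 is again a primitive l-th root of
  unity.\<close>

lemma l_dvd_double: "int l dvd 2 * n \<longleftrightarrow> int l dvd n"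
  by (rule coprime_dvd_mult_right_iff) (simp add: l_odd coprime_commute)

lemma qdiff_nz [simp]: "q \<noteq> inverse q"
proof
  assume "q = inverse q"
  then have "q powi 2 = 1"
    by (simp add: power2_eq_square field_simps)
  then show False
    using l_dvd_double[of 1] l_ge q_powi_eq_1_iff[of 2] by simp
qed

definition d :: complex where "d = (q - inverse q)\<^sup>2"

lemma d_nz [simp]: "d \<noteq> 0"
  by (simp add: d_def)

definition cc :: "int \<Rightarrow> complex" where "cc n = q powi n + q powi (- n)"

definition qi :: "int \<Rightarrow> complex" where "qi n = (q powi n - q powi (- n)) / (q - inverse q)"

lemma qint_eq: "qint q n = qi (int n)"
  by (simp add: qint_def qi_def)

lemma qi_0 [simp]: "qi 0 = 0"
  by (simp add: qi_def)

lemma qi_1 [simp]: "qi 1 = 1"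
  by (simp add: qi_def)

lemma cc_minus: "cc (- n) = cc n"
  by (simp add: cc_def)

lemma qi_eq_0_iff: "qi n = 0 \<longleftrightarrow> int l dvd n"
proof -
  have "qi n = 0 \<longleftrightarrow> q powi n = q powi (- n)"
    by (simp add: qi_def)
  also have "\<dots> \<longleftrightarrow> int l dvd 2 * n"
    by (simp add: q_powi_eq_iff)
  finally show ?thesis
    by (simp add: l_dvd_double)
qed

text \<open>Multiplying out two differences. It converts the matrix entries of E F and F E, which
  are products of quantum integers, into differences of the eigenvalues c_n of the Casimir
  element.\<close>

lemma d_qi_qi: "d * (qi m * qi n) = cc (m + n) - cc (m - n)"
proof -
  have "d * (qi m * qi n) = (q powi m - q powi (- m)) * (q powi n - q powi (- n))"
    by (simp add: d_def qi_def power2_eq_square)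
  also have "\<dots> = cc (m + n) - cc (m - n)"
    by (simp add: cc_def power_int_add power_int_diff power_int_minus algebra_simps divide_inverse)
  finally show ?thesis .
qed

lemma q_powi_pred: "q powi (int (l - 1) * n) = q powi (- n)"
proof -
  have "int (l - 1) = int l - 1"
    using l_ge by simp
  then show ?thesis
    by (simp only: q_powi_eq_iff) (simp add: algebra_simps)
qed

text \<open>The relation for E F - F E on the n-th basis vector of a module of highest weight t - 1,
  where E has the coefficients [n][t - n]. It serves V_r with t = r and the projective module with t
  = s and t = - s.\<close>

lemma qi_commutator: "qi (n + 1) * qi (t - (n + 1)) - qi n * qi (t - n) = qi (t - 1 - 2 * n)"
proof -
  have "d * (qi (n + 1) * qi (t - (n + 1)) - qi n * qi (t - n)) = cc (2 * n - t) - cc (2 * n + 2 - t)"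
    by (simp add: right_diff_distrib d_qi_qi algebra_simps)
  also have "\<dots> = cc (1 + (t - 1 - 2 * n)) - cc (1 - (t - 1 - 2 * n))"
    using cc_minus[of "2 * n - t"] by (simp add: algebra_simps)
  also have "\<dots> = d * (qi 1 * qi (t - 1 - 2 * n))"
    unfolding d_qi_qi ..
  finally show ?thesis
    by simp
qed

text \<open>After multiplication by q^(m+n) the difference c_m - c_n factors, and each factor
  vanishes on one residue class.\<close>

lemma cc_eq_iff: "cc m = cc n \<longleftrightarrow> int l dvd (m - n) \<or> int l dvd (m + n)"
proof -
  have "q powi m * q powi n * (cc m - cc n) = (q powi (m + n) - 1) * (q powi m - q powi n)"
    by (simp add: cc_def power_int_add power_int_minus field_simps)
  then have "cc m = cc n \<longleftrightarrow> q powi (m + n) = 1 \<or> q powi m = q powi n"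
    by (metis (no_types, opaque_lifting) eq_iff_diff_eq_0 mult_eq_0_iff power_int_not_zero q_nz)
  then show ?thesis
    by (auto simp: q_powi_eq_iff q_powi_eq_1_iff)
qed

text \<open>Families indexed by integers with period l stand for functions on Z/l. An affine map of
  unit slope is injective on residues, hence a permutation; slope 1 gives the shifts, slope 2 the
  chains of weights.\<close>

lemma bij_betw_affine_mod:
  assumes "coprime u (int l)"
  shows "bij_betw (\<lambda>i. nat ((u * int i + b) mod int l)) {..<l} {..<l}"
proof -
  have "inj_on (\<lambda>i. nat ((u * int i + b) mod int l)) {..<l}"
  proof (rule inj_onI)
    fix i j
    assume ij: "i \<in> {..<l}" "j \<in> {..<l}"
      and "nat ((u * int i + b) mod int l) = nat ((u * int j + b) mod int l)"
    then have "(u * int i + b) mod int l = (u * int j + b) mod int l"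
      by (metis l_pos nat_int_comparison(2) of_nat_0 pos_mod_sign nat_eq_iff2 of_nat_0_less_iff)
    then have "int l dvd u * (int i - int j)"
      by (simp add: mod_eq_dvd_iff algebra_simps)
    then have "int l dvd int i - int j"
      using assms by (metis coprime_commute coprime_dvd_mult_right_iff)
    then show "i = j"
      using ij by (metis lessThan_iff mod_eq_dvd_iff mod_less of_nat_eq_iff zmod_int)
  qed
  moreover have "(\<lambda>i. nat ((u * int i + b) mod int l)) ` {..<l} \<subseteq> {..<l}"
    by (auto simp: nat_less_iff)
  ultimately show ?thesis
    by (simp add: bij_betw_def endo_inj_surj)
qed

lemma periodic_mod:
  fixes f :: "int \<Rightarrow> 'b"
  assumes "\<And>n. f (n + int l) = f n"
  shows "f (n mod int l) = f n"
proof -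
  have "f (n + int l * int k) = f n" for n k
  proof (induction k)
    case (Suc k)
    then show ?case
      using assms[of "n + int l * int k"] by (simp add: algebra_simps)
  qed simp
  \<comment> \<open>The iteration counts in natural numbers: it climbs from the remainder to n if
    the quotient is nonnegative, and from n to the remainder otherwise.\<close>
  from this[of "n mod int l" "nat (n div int l)"] this[of n "nat (- (n div int l))"]
  show ?thesis
    by (cases "n div int l \<ge> 0") (simp_all add: minus_mult_div_eq_mod[symmetric])
qed

lemma sum_periodic:
  fixes f :: "int \<Rightarrow> 'b::comm_monoid_add"
  assumes "\<And>n. f (n + int l) = f n" and "coprime u (int l)"
  shows "(\<Sum>i<l. f (u * int i + b)) = (\<Sum>i<l. f (int i))"
  using sum.reindex_bij_betw[OF bij_betw_affine_mod[OF assms(2)], of "\<lambda>i. f (int i)" b]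
  by (simp add: periodic_mod[where f = f, OF assms(1)])

lemma prod_periodic:
  fixes f :: "int \<Rightarrow> 'b::comm_monoid_mult"
  assumes "\<And>n. f (n + int l) = f n" and "coprime u (int l)"
  shows "(\<Prod>i<l. f (u * int i + b)) = (\<Prod>i<l. f (int i))"
  using prod.reindex_bij_betw[OF bij_betw_affine_mod[OF assms(2)], of "\<lambda>i. f (int i)" b]
  by (simp add: periodic_mod[where f = f, OF assms(1)])

lemma q_powi_add_l [simp]: "q powi (n + int l) = q powi n" "q powi (int l + n) = q powi n"
  using q_powi_l[of 1] by (simp_all add: power_int_add)

lemma cc_add_l [simp]: "cc (n + int l) = cc n"
  using q_powi_add_l(1)[of "- n - int l"] by (simp add: cc_def)

lemma sum_q_powi: "(\<Sum>i<l. q powi (n * int i)) = (if int l dvd n then of_nat l else 0)"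
proof (cases "int l dvd n")
  case True
  then have "q powi (n * int i) = 1" for i
    by (simp add: q_powi_eq_1_iff)
  then show ?thesis
    using True by simp
next
  case False
  have "(\<Sum>i<l. q powi (n * int i)) = (\<Sum>i<l. (q powi n) ^ i)"
    by (simp add: power_int_mult)
  also have "\<dots> = 0"
    using False geometric_sum[of "q powi n" l] q_powi_l[of n]
    by (simp add: q_powi_eq_1_iff power_int_mult mult.commute[of "int l"])
  finally show ?thesis
    using False by simp
qed

definition cpol :: "int \<Rightarrow> complex poly" where "cpol n = [:- cc n, 1:]"

definition Psi :: "complex poly" where "Psi = (\<Prod>i<l. cpol (int i))"

text \<open>The indices of the roots may be run through in steps of 2 from any starting point, since
  2 is a unit modulo l. In this order the factors appear along a chain of weights.\<close>

lemma Psi_eq: "Psi = (\<Prod>i<l. cpol (2 * int i + b))"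
  unfolding Psi_def by (rule prod_periodic[symmetric]) (simp_all add: cpol_def)

end

section \<open>Computations in an algebra satisfying the relations\<close>

text \<open>Stated for an arbitrary ring because it is used three times: for the quotient algebra
  and for each of the two legs of its tensor square.\<close>

locale uq = odd_root l h q + central_scalars sc
  for l h :: nat and q :: complex and sc :: "complex \<Rightarrow> 'a::ring_1" +
  fixes E F K :: 'a
  assumes E_nil: "E ^ l = 0" and F_nil: "F ^ l = 0" and K_tor: "K ^ l = 1"
    and KE: "K * E = sc (q powi 2) * E * K"
    and KF: "K * F = sc (q powi (- 2)) * F * K"
    and EF: "E * F - F * E = sc (1 / (q - inverse q)) * (K - K ^ (l - 1))"
begin

text \<open>Powers of K with exponents read modulo l, so that inverses and shifts of weights are
  handled by integer arithmetic instead of powers of \<open>K ^ (l - 1)\<close>.\<close>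

definition Kp :: "int \<Rightarrow> 'a" where "Kp n = K ^ nat (n mod int l)"

lemma K_pow_mod: "K ^ (n mod l) = K ^ n"
proof -
  have "K ^ n = K ^ (l * (n div l) + n mod l)"
    by simp
  also have "\<dots> = K ^ (n mod l)"
    by (simp only: power_add power_mult K_tor) simp
  finally show ?thesis ..
qed

lemma Kp_of_nat: "Kp (int n) = K ^ n"
  by (simp add: Kp_def nat_mod_distrib K_pow_mod)

lemma Kp_mod: "Kp (n mod int l) = Kp n"
  by (simp add: Kp_def)

lemma Kp_add: "Kp (m + n) = Kp m * Kp n"
proof -
  have "Kp (m + n) = Kp (int (nat (m mod int l) + nat (n mod int l)))"
    by (simp add: Kp_def mod_add_eq)
  then show ?thesis
    by (simp only: Kp_of_nat power_add) (simp add: Kp_def)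
qed

lemma Kp_0 [simp]: "Kp 0 = 1" and Kp_1: "Kp 1 = K"
  using Kp_of_nat[of 0] Kp_of_nat[of 1] by simp_all

lemma Kp_add_l [simp]: "Kp (n + int l) = Kp n"
  by (simp add: Kp_def)

lemma Kp_m1: "Kp (- 1) = K ^ (l - 1)"
proof -
  have "int (l - 1) = - 1 + int l"
    using l_ge by simp
  then show ?thesis
    by (metis Kp_of_nat Kp_add_l)
qed

lemma Kp_cancel: "Kp m * (Kp n * x) = Kp (m + n) * x"
  by (simp add: Kp_add mult.assoc)

lemma Kp_pow: "Kp m ^ n = Kp (m * int n)"
  by (induction n) (simp_all add: Kp_add algebra_simps)

lemma Kp_commute_gen:
  assumes "K * x = q powi a \<cdot> (x * K)"
  shows "Kp p * x = q powi (a * p) \<cdot> (x * Kp p)"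
proof -
  have *: "K ^ n * x = q powi (a * int n) \<cdot> (x * K ^ n)" for n
  proof (induction n)
    case (Suc n)
    have "K ^ Suc n * x = K * (K ^ n * x)"
      by (simp add: mult.assoc)
    also have "\<dots> = q powi (a * int n) \<cdot> ((K * x) * K ^ n)"
      by (simp add: Suc mult.assoc)
    also have "\<dots> = q powi (a * int (Suc n)) \<cdot> (x * K ^ Suc n)"
      by (simp add: assms power_int_add algebra_simps)
    finally show ?case .
  qed simp
  have "q powi (a * (p mod int l)) = q powi (a * p)"
    by (metis mod_mult_right_eq q_powi_mod)
  then show ?thesis
    by (simp add: Kp_def *)
qed

lemma Kp_E: "Kp p * E ^ m = q powi (2 * p * int m) \<cdot> (E ^ m * Kp p)"
proof (induction m)
  case (Suc m)
  have "Kp p * E = q powi (2 * p) \<cdot> (E * Kp p)"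
    by (rule Kp_commute_gen) (simp add: smul_def KE mult.assoc)
  then show ?case
    by (simp add: power_Suc2 mult.assoc[symmetric] Suc del: power_Suc)
       (simp add: mult.assoc power_int_add algebra_simps)
qed simp

lemma Kp_F: "Kp p * F ^ m = q powi (- 2 * p * int m) \<cdot> (F ^ m * Kp p)"
proof (induction m)
  case (Suc m)
  have "Kp p * F = q powi (- 2 * p) \<cdot> (F * Kp p)"
    by (rule Kp_commute_gen) (simp add: smul_def KF mult.assoc)
  then show ?case
    by (simp add: power_Suc2 mult.assoc[symmetric] Suc del: power_Suc)
       (simp add: mult.assoc power_int_add[symmetric] algebra_simps)
qed simp

text \<open>The forms with a trailing factor let the simplifier move K to the right inside
  right-nested products.\<close>

lemma Kp_E': "Kp p * (E ^ m * x) = q powi (2 * p * int m) \<cdot> (E ^ m * (Kp p * x))"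
  by (simp add: mult.assoc[symmetric] Kp_E)

lemma Kp_F': "Kp p * (F ^ m * x) = q powi (- 2 * p * int m) \<cdot> (F ^ m * (Kp p * x))"
  by (simp add: mult.assoc[symmetric] Kp_F)

definition Cas :: 'a where
  "Cas = d \<cdot> (E * F) + inverse q \<cdot> Kp 1 + q \<cdot> Kp (- 1)"

lemma dEF: "d \<cdot> (E * F) = Cas - inverse q \<cdot> Kp 1 - q \<cdot> Kp (- 1)"
  by (simp add: Cas_def)

lemma dFE: "d \<cdot> (F * E) = Cas - q \<cdot> Kp 1 - inverse q \<cdot> Kp (- 1)"
proof -
  have *: "F * E = E * F - (1 / (q - inverse q)) \<cdot> (Kp 1 - Kp (- 1))"
    using EF by (simp add: smul_def Kp_1 Kp_m1 algebra_simps)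
  have "d * (1 / (q - inverse q)) = q - inverse q"
    by (simp add: d_def power2_eq_square)
  then have "d \<cdot> (F * E) = d \<cdot> (E * F) - (q - inverse q) \<cdot> (Kp 1 - Kp (- 1))"
    unfolding * by (simp add: scale_right_diff_distrib)
  then show ?thesis
    by (simp add: dEF scale_left_diff_distrib scale_right_diff_distrib algebra_simps)
qed

text \<open>C has one expression through E F and one through F E. Moving E leftwards across the
  K-terms of the first exchanges their coefficients q and 1/q, which gives E times the
  second.\<close>

lemma Cas_E: "Cas * E = E * Cas"
proof -
  have q: "inverse q * (q * q) = q" "q * (inverse q * inverse q) = inverse q"
    by (simp_all add: field_simps)
  have "Kp p * E = q powi (2 * p) \<cdot> (E * Kp p)" for p
    using Kp_E[of p 1] by simp
  then have "Cas * E = d \<cdot> (E * (F * E)) + q \<cdot> (E * Kp 1) + inverse q \<cdot> (E * Kp (- 1))"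
    by (simp add: Cas_def distrib_right mult.assoc power2_eq_square power_int_minus q)
  also have "\<dots> = E * (d \<cdot> (F * E) + q \<cdot> Kp 1 + inverse q \<cdot> Kp (- 1))"
    by (simp add: distrib_left)
  finally show ?thesis
    by (simp add: dFE)
qed

lemma Cas_F: "Cas * F = F * Cas"
proof -
  have q: "inverse q * (q * q) = q" "q * (inverse q * inverse q) = inverse q"
    by (simp_all add: field_simps)
  have "Kp p * F = q powi (- 2 * p) \<cdot> (F * Kp p)" for p
    using Kp_F[of p 1] by simp
  then have *: "F * Kp p = q powi (2 * p) \<cdot> (Kp p * F)" for p
    by (simp add: power_int_minus)
  have "F * Cas = d \<cdot> (F * E * F) + q \<cdot> (Kp 1 * F) + inverse q \<cdot> (Kp (- 1) * F)"
    by (simp add: Cas_def distrib_left mult.assoc power2_eq_square power_int_minus q *)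
  also have "\<dots> = (d \<cdot> (F * E) + q \<cdot> Kp 1 + inverse q \<cdot> Kp (- 1)) * F"
    by (simp add: distrib_right)
  finally show ?thesis
    by (simp add: dFE)
qed

lemma Cas_Kp: "Cas * Kp p = Kp p * Cas"
proof -
  have "Kp p * (E * F) = E * F * Kp p"
    using Kp_E'[of p 1 F] Kp_F[of p 1] by (simp add: mult.assoc power_int_add[symmetric])
  then show ?thesis
    by (simp add: Cas_def distrib_left distrib_right Kp_add[symmetric] add.commute)
qed

lemma ev_E: "E ^ m * ev Cas p = ev Cas p * E ^ m"
  by (rule ev_commute) (simp add: Cas_E power_commuting_commutes)

lemma ev_F: "F ^ m * ev Cas p = ev Cas p * F ^ m"
  by (rule ev_commute) (simp add: Cas_F power_commuting_commutes)

lemma ev_Kp: "Kp m * ev Cas p = ev Cas p * Kp m"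
  by (rule ev_commute) (simp add: Cas_Kp)

lemma Cas_E_pow: "Cas * E ^ m = E ^ m * Cas" and Cas_F_pow: "Cas * F ^ m = F ^ m * Cas"
  using ev_E[of m "[:0, 1:]"] ev_F[of m "[:0, 1:]"] by (simp_all add: ev_monom)

text \<open>Centrality allows C to be placed between E^m and F^m, where its definition inserts one
  more pair E F; carrying K and its inverse across F^m produces the powers of q.\<close>

lemma EF_step:
  "Cas * (E ^ m * (F ^ m * Kp p)) = d \<cdot> (E ^ Suc m * (F ^ Suc m * Kp p))
    + q powi (- 1 - 2 * int m) \<cdot> (E ^ m * (F ^ m * Kp (p + 1)))
    + q powi (1 + 2 * int m) \<cdot> (E ^ m * (F ^ m * Kp (p - 1)))"
proof -
  have "Cas * (E ^ m * (F ^ m * Kp p)) = E ^ m * (Cas * (F ^ m * Kp p))"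
    by (simp add: mult.assoc[symmetric] Cas_E_pow)
  also have "\<dots> = E ^ m * ((d \<cdot> (E * F) + inverse q \<cdot> Kp 1 + q \<cdot> Kp (- 1)) * (F ^ m * Kp p))"
    by (simp add: Cas_def)
  also have "\<dots> = d \<cdot> (E ^ Suc m * (F ^ Suc m * Kp p))
      + (inverse q * q powi (- 2 * int m)) \<cdot> (E ^ m * (F ^ m * Kp (p + 1)))
      + (q * q powi (2 * int m)) \<cdot> (E ^ m * (F ^ m * Kp (p - 1)))"
    by (simp add: distrib_left distrib_right Kp_F' Kp_add[symmetric] mult.assoc power_Suc2[of E] add.commute
          del: power_Suc) (simp add: mult.assoc)
  finally show ?thesis
    by (simp add: power_int_add power_int_diff power_int_minus field_simps)
qed

lemma FE_step:
  "Cas * (F ^ m * (E ^ m * Kp p)) = d \<cdot> (F ^ Suc m * (E ^ Suc m * Kp p))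
    + q powi (1 + 2 * int m) \<cdot> (F ^ m * (E ^ m * Kp (p + 1)))
    + q powi (- 1 - 2 * int m) \<cdot> (F ^ m * (E ^ m * Kp (p - 1)))"
proof -
  have "Cas * (F ^ m * (E ^ m * Kp p)) = F ^ m * (Cas * (E ^ m * Kp p))"
    by (simp add: mult.assoc[symmetric] Cas_F_pow)
  also have "\<dots> = F ^ m * ((d \<cdot> (F * E) + q \<cdot> Kp 1 + inverse q \<cdot> Kp (- 1)) * (E ^ m * Kp p))"
    by (simp add: dFE)
  also have "\<dots> = d \<cdot> (F ^ Suc m * (E ^ Suc m * Kp p))
      + (q * q powi (2 * int m)) \<cdot> (F ^ m * (E ^ m * Kp (p + 1)))
      + (inverse q * q powi (- 2 * int m)) \<cdot> (F ^ m * (E ^ m * Kp (p - 1)))"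
    by (simp add: distrib_left distrib_right Kp_E' Kp_add[symmetric] mult.assoc power_Suc2[of F] add.commute
          del: power_Suc) (simp add: mult.assoc)
  finally show ?thesis
    by (simp add: power_int_add power_int_diff power_int_minus field_simps)
qed

text \<open>Discrete Fourier transform of the powers of K: the projection onto the eigenspace K =
  q^j.\<close>

definition e :: "int \<Rightarrow> 'a" where
  "e j = (1 / of_nat l) \<cdot> (\<Sum>i<l. q powi (- (j * int i)) \<cdot> Kp (int i))"

lemma sum_Kp_e: "(\<Sum>i<l. q powi (j * int i) \<cdot> Kp (int i)) = of_nat l \<cdot> e (- j)"
  by (simp add: e_def)

lemma e_add_l [simp]: "e (j + int l) = e j"
proof -
  have "q powi (- ((j + int l) * int i)) = q powi (- (j * int i))" for i
    by (subst q_powi_eq_iff) (simp add: algebra_simps)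
  then show ?thesis
    by (simp add: e_def)
qed

lemma Kp_e: "Kp p * e j = q powi (j * p) \<cdot> e j"
proof -
  define f where "f n = q powi (- (j * n)) \<cdot> Kp n" for n
  have per: "f (n + int l) = f n" for n
  proof -
    have "q powi (- (j * (n + int l))) = q powi (- (j * n))"
      by (subst q_powi_eq_iff) (simp add: algebra_simps)
    then show ?thesis
      by (simp add: f_def)
  qed
  have "Kp p * f n = q powi (j * p) \<cdot> f (1 * n + p)" for n
    by (simp add: f_def Kp_add[symmetric] power_int_add[symmetric] algebra_simps)
  then have "Kp p * (\<Sum>i<l. f (int i)) = q powi (j * p) \<cdot> (\<Sum>i<l. f (1 * int i + p))"
    by (simp only: sum_distrib_left scale_sum_right)
  also have "(\<Sum>i<l. f (1 * int i + p)) = (\<Sum>i<l. f (int i))"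
    by (rule sum_periodic) (simp_all add: per)
  finally show ?thesis
    by (simp add: e_def f_def scale_left_commute)
qed

text \<open>The weights 2 i + b exhaust all residues, and orthogonality of characters leaves only
  the term K^0.\<close>

lemma sum_e: "(\<Sum>i<l. e (2 * int i + b)) = 1"
proof -
  have "(\<Sum>i<l. e (2 * int i + b)) = (\<Sum>i<l. e (int i))"
    by (rule sum_periodic) simp_all
  also have "\<dots> = (1 / of_nat l) \<cdot> (\<Sum>k<l. \<Sum>j<l. q powi (- int k * int j) \<cdot> Kp (int k))"
    by (subst sum.swap) (simp add: e_def scale_sum_right mult.commute)
  also have "\<dots> = (1 / of_nat l) \<cdot> (\<Sum>k<l. (if int l dvd - int k then of_nat l else 0) \<cdot> Kp (int k))"
    by (simp only: scale_sum_left[symmetric] sum_q_powi)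
  also have "\<dots> = (1 / of_nat l) \<cdot> (\<Sum>k<l. if k = 0 then of_nat l \<cdot> 1 else 0)"
    by (intro arg_cong[where f = "smul _"] sum.cong) (auto simp: zdvd_not_zless)
  also have "\<dots> = 1"
    using l_ge by simp
  finally show ?thesis .
qed

text \<open>On a fixed weight the two K-terms of the recursions become scalars with sum c_(j+a), so
  inserting one more pair of E and F is multiplication by C - c_(j+a). Both \<open>EF_step\<close>
  and \<open>FE_step\<close> have this shape, with opposite signs of a.\<close>

lemma weight_step:
  assumes "\<And>p. Cas * (x * Kp p) = d \<cdot> (y * Kp p) + q powi a \<cdot> (x * Kp (p + 1)) + q powi (- a) \<cdot> (x * Kp (p - 1))"
  shows "d \<cdot> (y * e j) = ev Cas (cpol (j + a)) * (x * e j)"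
proof -
  have "Cas * (x * e j) = (Cas * (x * Kp 0)) * e j"
    by (simp add: mult.assoc)
  also have "\<dots> = d \<cdot> (y * e j) + q powi a \<cdot> (x * (Kp 1 * e j)) + q powi (- a) \<cdot> (x * (Kp (- 1) * e j))"
    unfolding assms by (simp add: distrib_right mult.assoc)
  also have "\<dots> = d \<cdot> (y * e j) + (q powi a * q powi j + q powi (- a) * q powi (- j)) \<cdot> (x * e j)"
    by (simp add: Kp_e scale_left_distrib add.assoc)
  also have "q powi a * q powi j + q powi (- a) * q powi (- j) = cc (j + a)"
    by (simp add: cc_def power_int_add[symmetric] algebra_simps)
  finally show ?thesis
    by (simp add: cpol_def ev_linear left_diff_distrib smul_def)
qed

lemma weight_pow:
  assumes "\<And>m. d \<cdot> (G (Suc m) * e j) = ev Cas (cpol (c m)) * (G m * e j)" and "G 0 = 1"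
  shows "d ^ m \<cdot> (G m * e j) = ev Cas (\<Prod>k<m. cpol (c k)) * e j"
proof (induction m)
  case (Suc m)
  have "d ^ Suc m \<cdot> (G (Suc m) * e j) = ev Cas (cpol (c m)) * (d ^ m \<cdot> (G m * e j))"
    by (metis assms(1) mult_smul power_Suc2 scale_scale)
  then show ?case
    by (simp only: Suc) (simp add: ev_mult mult.assoc[symmetric] mult.commute[of _ "cpol _"])
qed (simp add: assms)

text \<open>Here a = - 1 - 2 m, so the indices of the factors descend from j - 1; in
  \<open>FE_e\<close> they ascend from j + 1.\<close>

lemma EF_e:
  "d ^ m \<cdot> (E ^ m * (F ^ m * e j)) = ev Cas (\<Prod>k<m. cpol (j - 1 - 2 * int k)) * e j"
proof -
  have "d \<cdot> (E ^ Suc m * F ^ Suc m * e j) = ev Cas (cpol (j + (- 1 - 2 * int m))) * (E ^ m * F ^ m * e j)" for m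
    by (rule weight_step) (simp add: mult.assoc EF_step add.commute del: power_Suc)
  then show ?thesis
    using weight_pow[of "\<lambda>m. E ^ m * F ^ m"] by (simp add: mult.assoc add_diff_eq)
qed

lemma FE_e:
  "d ^ m \<cdot> (F ^ m * (E ^ m * e j)) = ev Cas (\<Prod>k<m. cpol (2 * int k + (j + 1))) * e j"
proof -
  have "d \<cdot> (F ^ Suc m * E ^ Suc m * e j) = ev Cas (cpol (j + (1 + 2 * int m))) * (F ^ m * E ^ m * e j)" for m
    by (rule weight_step) (simp add: mult.assoc FE_step del: power_Suc)
  then show ?thesis
    using weight_pow[of "\<lambda>m. F ^ m * E ^ m" j "\<lambda>m. 2 * int m + (j + 1)"] by (simp add: mult.assoc add_ac)
qed

text \<open>For m = l the left side of \<open>FE_e\<close> contains E^l = 0, while the chain of l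
  factors on the right is all of \<open>Psi\<close>. As this holds on every weight, it holds in the
  algebra.\<close>

lemma ev_Psi: "ev Cas Psi = 0"
proof -
  have "ev Cas Psi * e j = 0" for j
    using FE_e[of l j] by (simp add: E_nil Psi_eq[symmetric])
  then have "ev Cas Psi * (\<Sum>i<l. e (2 * int i + 0)) = 0"
    by (simp only: sum_distrib_left sum.neutral_const)
  then show ?thesis
    by (simp only: sum_e) simp
qed

end

section \<open>Gaussian binomial coefficients and Chebyshev polynomials\<close>

context odd_root
begin

lemma qfact_nz: "m < l \<Longrightarrow> qfact q m \<noteq> 0"
  by (auto simp: qfact_def qint_eq qi_eq_0_iff dest: dvd_imp_le)

lemma qfact_Suc: "qfact q (Suc m) = qfact q m * qi (int (Suc m))"
  by (simp add: qfact_def qint_eq prod.nat_ivl_Suc' mult.commute)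

text \<open>The balanced Gaussian binomial coefficient with an integer on top; it is used for m < l,
  where \<open>qfact q m\<close> is nonzero.\<close>

definition qb :: "int \<Rightarrow> nat \<Rightarrow> complex" where
  "qb a m = (\<Prod>i<m. qi (a - int i)) / qfact q m"

lemma qb_0 [simp]: "qb a 0 = 1"
  by (simp add: qb_def qfact_def)

lemma qb_eq_0: "0 \<le> a \<Longrightarrow> a < int m \<Longrightarrow> qb a m = 0"
proof -
  assume "0 \<le> a" "a < int m"
  then have "(\<Prod>i<m. qi (a - int i)) = 0"
    by (intro prod_zero bexI[of _ "nat a"]) auto
  then show ?thesis
    by (simp add: qb_def)
qed

lemma qi_pascal: "qi a = q powi m * qi (a - m) + q powi (m - a) * qi m"
  unfolding qi_def by (simp add: divide_simps power_int_add power_int_diff power_int_minus) (simp add: field_simps)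

lemma qi_pascal': "qi a = q powi (- m) * qi (a - m) + q powi (a - m) * qi m"
  using qi_pascal[of a "a - m"] by (simp add: qi_def algebra_simps diff_divide_distrib flip: power_int_add)

lemma qb_Suc_left:
  "qb a (Suc m) = qi a * ((\<Prod>i<m. qi (a - 1 - int i)) / qfact q (Suc m))"
  by (simp add: qb_def prod.lessThan_Suc_shift del: prod.lessThan_Suc) (simp add: algebra_simps)

lemma qb_Suc_right:
  "qb (a - 1) (Suc m) = qi (a - int (Suc m)) * ((\<Prod>i<m. qi (a - 1 - int i)) / qfact q (Suc m))"
  by (simp add: qb_def algebra_simps)

lemma qb_Suc_low:
  assumes "Suc m < l"
  shows "qb (a - 1) m = qi (int (Suc m)) * ((\<Prod>i<m. qi (a - 1 - int i)) / qfact q (Suc m))"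
proof -
  have "qi (int (Suc m)) \<noteq> 0"
    using assms qfact_nz[OF assms] by (simp add: qfact_Suc)
  then show ?thesis
    by (simp add: qb_def qfact_Suc)
qed

text \<open>All three binomials are multiples of one product P, so the two Pascal rules reduce to
  scalar identities between quantum integers. The two versions are exchanged by replacing q with its
  inverse.\<close>

lemma qb_pascal:
  assumes "Suc m < l"
  shows "qb a (Suc m) - q powi int (Suc m) * qb (a - 1) (Suc m) = q powi (int (Suc m) - a) * qb (a - 1) m"
    and "qb a (Suc m) - q powi (- int (Suc m)) * qb (a - 1) (Suc m) = q powi (a - int (Suc m)) * qb (a - 1) m"
proof -
  define P where "P = (\<Prod>i<m. qi (a - 1 - int i)) / qfact q (Suc m)"
  have *: "qb a (Suc m) = qi a * P" "qb (a - 1) (Suc m) = qi (a - int (Suc m)) * P"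
    "qb (a - 1) m = qi (int (Suc m)) * P"
    unfolding P_def by (rule qb_Suc_left qb_Suc_right qb_Suc_low[OF assms])+
  show "qb a (Suc m) - q powi int (Suc m) * qb (a - 1) (Suc m) = q powi (int (Suc m) - a) * qb (a - 1) m"
    unfolding * qi_pascal[of a "int (Suc m)"] by (simp only: algebra_simps)
  show "qb a (Suc m) - q powi (- int (Suc m)) * qb (a - 1) (Suc m) = q powi (a - int (Suc m)) * qb (a - 1) m"
    unfolding * qi_pascal'[of a "int (Suc m)"] by (simp only: algebra_simps)
qed

lemma binomial_expand_pair:
  fixes A :: complex
  assumes "(A - u * A') * (B - v * B') = w" and "u * v = 1"
  shows "A * B + A' * B' = w + v * (A * B') + u * (A' * B)"
proof -
  have "A * B + u * v * (A' * B') = w + v * (A * B') + u * (A' * B)"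
    unfolding assms(1)[symmetric] by (simp add: algebra_simps)
  then show ?thesis
    by (simp add: assms(2))
qed

text \<open>The product of the two Pascal rules, one for a and one for b. The weights q^m and q^(-m)
  cancel in the term with both tops lowered and survive in the mixed terms. This is the coefficient
  form of the recursion of the Drinfeld elements.\<close>

lemma qb_identity:
  assumes "m < l"
  shows "qb a m * qb b m + qb (a - 1) m * qb (b - 1) m =
    (if m = 0 then 0 else q powi (b - a) * (qb (a - 1) (m - 1) * qb (b - 1) (m - 1)))
    + q powi (- int m) * (qb a m * qb (b - 1) m) + q powi int m * (qb (a - 1) m * qb b m)"
proof (cases m)
  case (Suc k)
  have "(qb a m - q powi int m * qb (a - 1) m) * (qb b m - q powi (- int m) * qb (b - 1) m)
      = (q powi (int m - a) * qb (a - 1) k) * (q powi (b - int m) * qb (b - 1) k)"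
    using qb_pascal[of k] assms Suc by simp
  also have "\<dots> = q powi (b - a) * (qb (a - 1) k * qb (b - 1) k)"
    by (simp add: power_int_diff field_simps)
  finally have "(qb a m - q powi int m * qb (a - 1) m) * (qb b m - q powi (- int m) * qb (b - 1) m)
    = q powi (b - a) * (qb (a - 1) k * qb (b - 1) k)" .
  moreover have "q powi int m * q powi (- int m) = 1"
    by (simp add: power_int_minus)
  ultimately show ?thesis
    using binomial_expand_pair[of "qb a m" _ "qb (a - 1) m" "qb b m"] Suc by simp
qed simp

text \<open>Chebyshev polynomials of the second kind, normalised so that the value of
  \<open>cheb r\<close> at t + 1/t is (t^r - t^(-r)) / (t - 1/t).\<close>

fun cheb :: "nat \<Rightarrow> complex poly" where
  "cheb 0 = 0"
| "cheb (Suc 0) = 1"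
| "cheb (Suc (Suc r)) = [:0, 1:] * cheb (Suc r) - cheb r"

lemma cheb_degree: "degree (cheb (Suc r)) \<le> r \<and> coeff (cheb (Suc r)) r = 1"
proof (induction r rule: less_induct)
  case (less r)
  show ?case
  proof (cases r)
    case (Suc r')
    have 1: "degree (cheb (Suc r')) \<le> r'" "coeff (cheb (Suc r')) r' = 1"
      using less[of r'] Suc by auto
    have 2: "degree (cheb r') < r"
    proof (cases r')
      case (Suc k)
      then show ?thesis
        using less[of k] \<open>r = Suc r'\<close> by auto
    qed (use Suc in simp)
    have "degree (pCons 0 (cheb (Suc r'))) \<le> r"
      using 1 Suc by (simp add: degree_pCons_le le_trans[OF degree_pCons_le])
    then show ?thesis
      using 1 2 Suc by (auto simp: coeff_eq_0 intro!: degree_diff_le)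
  qed simp
qed

text \<open>The polynomials are monic of consecutive degrees, so subtracting a multiple of the last
  one lowers the degree.\<close>

lemma cheb_span:
  "degree f < n \<Longrightarrow> \<exists>c. f = (\<Sum>r=1..n. smult (c r) (cheb r))"
proof (induction n arbitrary: f)
  case (Suc n)
  define g where "g = f - smult (coeff f n) (cheb (Suc n))"
  have "degree g \<le> n"
    unfolding g_def using Suc.prems cheb_degree[of n]
    by (intro degree_diff_le) (auto intro: le_trans[OF degree_smult_le])
  moreover have "coeff g n = 0"
    by (simp add: g_def cheb_degree)
  ultimately consider "g = 0" | "degree g < n"
    by (metis leading_coeff_0_iff nat_less_le)
  then obtain c where c: "g = (\<Sum>r=1..n. smult (c r) (cheb r))"
  proof cases
    case 1
    then show ?thesis
      by (intro that[of "\<lambda>_. 0"]) simp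
  qed (use Suc.IH in blast)
  show ?case
  proof (intro exI)
    show "f = (\<Sum>r=1..Suc n. smult ((c(Suc n := coeff f n)) r) (cheb r))"
      using c by (simp add: g_def algebra_simps)
  qed
qed simp

lemma monic_Psi: "degree Psi = l" "lead_coeff Psi = 1"
proof -
  have "degree Psi = (\<Sum>i<l. degree (cpol (int i)))"
    unfolding Psi_def by (rule degree_prod_eq_sum_degree) (auto simp: cpol_def)
  then show "degree Psi = l"
    by (simp add: cpol_def)
  show "lead_coeff Psi = 1"
    by (simp add: Psi_def lead_coeff_prod cpol_def)
qed

end

section \<open>Drinfeld elements as polynomials in the Casimir element\<close>

context uq
begin

lemma ev_mod_Psi: "ev Cas (f mod Psi) = ev Cas f"
  using ev_add[of Cas "Psi * (f div Psi)" "f mod Psi"] by (simp add: ev_mult ev_Psi)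

definition X :: "nat \<Rightarrow> int \<Rightarrow> 'a" where
  "X m p = d ^ m \<cdot> (E ^ m * (F ^ m * Kp p))"

lemma Cas_X:
  "Cas * X m p = X (Suc m) p + q powi (- 1 - 2 * int m) \<cdot> X m (p + 1) + q powi (1 + 2 * int m) \<cdot> X m (p - 1)"
  by (simp add: X_def EF_step scale_right_distrib mult.commute del: power_Suc) (simp add: mult_ac)

text \<open>The coefficient that remains in R_21 R, for the term of order m in E and F, when the
  first leg is evaluated on the basis vector v_N of V_r.\<close>

definition g :: "nat \<Rightarrow> nat \<Rightarrow> nat \<Rightarrow> complex" where
  "g r N m = q powi (- (int m * int m) - int m - (1 + int m) * (int r - 1 - 2 * int N))
     * (qb (int N) m * qb (int r - int N + int m - 1) m)"

text \<open>Closed form of the Drinfeld image of the q-character of V_r; \<open>drinfeld_cls\<close>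
  derives it from the R-matrix.\<close>

definition Del :: "nat \<Rightarrow> 'a" where
  "Del r = (\<Sum>N<r. \<Sum>m<l. g r N m \<cdot> X m (int r - 1 - 2 * int N + int m))"

text \<open>Once the common power Q of q is split off, this is \<open>qb_identity\<close> for a = N
  and b = r - N + m.\<close>

lemma g_identity:
  assumes "1 \<le> r" "r < l" "N \<le> r" "m < l"
  shows "g (Suc r) N m + (if 1 \<le> N \<and> N < r then g (r - 1) (N - 1) m else 0) =
    (if 1 \<le> N \<and> 1 \<le> m then g r (N - 1) (m - 1) else 0)
    + (if N < r then q powi (- 1 - 2 * int m) * g r N m else 0)
    + (if 1 \<le> N then q powi (1 + 2 * int m) * g r (N - 1) m else 0)"
proof -
  define a b where "a = int N" and "b = int r - int N + int m"
  define Q where "Q = q powi (- (int m * int m) - int m - (1 + int m) * (int r - 2 * int N))"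
  have A1: "g (Suc r) N m = Q * (qb a m * qb b m)"
    by (simp add: g_def a_def b_def Q_def algebra_simps)
  have A2: "g (r - 1) (N - 1) m = Q * (qb (a - 1) m * qb (b - 1) m)" if "1 \<le> N"
    using that assms by (simp add: g_def a_def b_def Q_def of_nat_diff algebra_simps)
  have B1: "g r (N - 1) (m - 1) = Q * (q powi (b - a) * (qb (a - 1) (m - 1) * qb (b - 1) (m - 1)))" if "1 \<le> N" "1 \<le> m"
  proof -
    have "g r (N - 1) (m - 1) = q powi (- (int m - 1) * (int m - 1) - (int m - 1) - int m * (int r - 1 - 2 * (int N - 1)))
        * (qb (a - 1) (m - 1) * qb (b - 1) (m - 1))"
      using that by (simp add: g_def a_def b_def of_nat_diff algebra_simps)
    also have "- (int m - 1) * (int m - 1) - (int m - 1) - int m * (int r - 1 - 2 * (int N - 1))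
        = (- (int m * int m) - int m - (1 + int m) * (int r - 2 * int N)) + (b - a)"
      by (simp add: a_def b_def algebra_simps)
    finally show ?thesis
      by (simp add: Q_def power_int_add del: add_diff_eq)
  qed
  have B2: "q powi (- 1 - 2 * int m) * g r N m = Q * (q powi (- int m) * (qb a m * qb (b - 1) m))"
  proof -
    have "q powi (- 1 - 2 * int m) * q powi (- (int m * int m) - int m - (1 + int m) * (int r - 1 - 2 * int N)) = Q * q powi (- int m)"
      unfolding Q_def by (simp add: power_int_add[symmetric] algebra_simps del: power_int_of_nat)
    then show ?thesis
      by (simp add: g_def a_def b_def mult.assoc[symmetric])
  qed
  have B3: "q powi (1 + 2 * int m) * g r (N - 1) m = Q * (q powi int m * (qb (a - 1) m * qb b m))" if "1 \<le> N"
  proof -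
    have "q powi (1 + 2 * int m) * q powi (- (int m * int m) - int m - (1 + int m) * (int r - 1 - 2 * (int N - 1))) = Q * q powi int m"
      unfolding Q_def by (simp add: power_int_add[symmetric] algebra_simps del: power_int_of_nat)
    moreover have "g r (N - 1) m = q powi (- (int m * int m) - int m - (1 + int m) * (int r - 1 - 2 * (int N - 1))) * (qb (a - 1) m * qb b m)"
      using that by (simp add: g_def a_def b_def of_nat_diff algebra_simps)
    ultimately show ?thesis
      by (simp only: mult.assoc[symmetric])
  qed
  have gen: "qb a m * qb b m + qb (a - 1) m * qb (b - 1) m =
    (if m = 0 then 0 else q powi (b - a) * (qb (a - 1) (m - 1) * qb (b - 1) (m - 1)))
    + q powi (- int m) * (qb a m * qb (b - 1) m) + q powi int m * (qb (a - 1) m * qb b m)"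
    by (rule qb_identity) fact
  \<comment> \<open>At both ends some of the sums contribute no term. For m > 0 the binomials
    concerned vanish there, because their top is nonnegative and smaller than m; the case m = 0 is
    direct.\<close>
  consider "N = 0" | "N = r" "1 \<le> N" | "1 \<le> N" "N < r"
    using assms by linarith
  then show ?thesis
  proof cases
    case 1
    show ?thesis
    proof (cases "m = 0")
      case False
      then have "qb a m = 0"
        using 1 by (simp add: a_def qb_eq_0)
      then show ?thesis
        using 1 assms A1 B2 by (simp del: mult_eq_0_iff)
    qed (use 1 assms A1 B2 in simp)
  next
    case 2
    have "qb (b - 1) m = (if m = 0 then 1 else 0)"
      using 2 by (simp add: b_def qb_eq_0)
    then show ?thesis
      using 2 gen A1 B1 B3 by (cases "m = 0") (simp_all add: algebra_simps)
  next
    case 3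
    have "g (Suc r) N m + g (r - 1) (N - 1) m = Q * (qb a m * qb b m + qb (a - 1) m * qb (b - 1) m)"
      using 3 A1 A2 by (simp add: distrib_left)
    then show ?thesis
      using 3 B1 B2 B3 unfolding gen by (simp add: distrib_left)
  qed
qed

text \<open>C acts on each \<open>X m p\<close> by a three-term rule; after shifting N or m, all
  sums run over the same elements and \<open>g_identity\<close> compares the coefficients. The term
  of order l produced by the shift in m vanishes because E^l = 0.\<close>

lemma Del_step:
  assumes "1 \<le> r" "r < l"
  shows "Cas * Del r = Del (Suc r) + Del (r - 1)"
proof -
  \<comment> \<open>The K-exponent r - 2 N + m is the one occurring in \<open>Del (Suc r)\<close>;
    in the other sums it appears after N is replaced by N - 1, or m by m - 1, where needed.\<close>
  define Y where "Y N m = X m (int r - 2 * int N + int m)" for N m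
  obtain k where l: "l = Suc k"
    using l_pos by (cases l) auto
  have shiftN: "(\<Sum>N<r. f (Suc N)) = (\<Sum>N<Suc r. if 1 \<le> N then f N else 0)" for f :: "nat \<Rightarrow> 'a"
    by (simp add: sum.lessThan_Suc_shift del: sum.lessThan_Suc)
  have T1: "(\<Sum>N<r. \<Sum>m<l. g r N m \<cdot> X (Suc m) (int r - 1 - 2 * int N + int m))
      = (\<Sum>N<Suc r. \<Sum>m<l. (if 1 \<le> N \<and> 1 \<le> m then g r (N - 1) (m - 1) else 0) \<cdot> Y N m)"
  proof -
    have "X l p = 0" for p
      by (simp add: X_def E_nil)
    then have "(\<Sum>m<l. g r N m \<cdot> X (Suc m) (int r - 1 - 2 * int N + int m))
      = (\<Sum>m<l. (if 1 \<le> m then g r N (m - 1) else 0) \<cdot> Y (Suc N) m)" for N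
    proof -
      have "(\<Sum>m<Suc k. g r N m \<cdot> X (Suc m) (int r - 1 - 2 * int N + int m))
        = (\<Sum>m<k. g r N m \<cdot> X (Suc m) (int r - 1 - 2 * int N + int m))"
        by (subst sum.lessThan_Suc) (simp add: \<open>\<And>p. X l p = 0\<close> flip: l)
      also have "\<dots> = (\<Sum>m<Suc k. (if 1 \<le> m then g r N (m - 1) else 0) \<cdot> Y (Suc N) m)"
        by (subst sum.lessThan_Suc_shift) (simp add: Y_def algebra_simps)
      finally show ?thesis
        by (simp only: l)
    qed
    then have "(\<Sum>N<r. \<Sum>m<l. g r N m \<cdot> X (Suc m) (int r - 1 - 2 * int N + int m))
      = (\<Sum>N<r. \<Sum>m<l. (if 1 \<le> m then g r (Suc N - 1) (m - 1) else 0) \<cdot> Y (Suc N) m)"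
      by (simp only: diff_Suc_1)
    also have "\<dots> = (\<Sum>N<Suc r. if 1 \<le> N then \<Sum>m<l. (if 1 \<le> m then g r (N - 1) (m - 1) else 0) \<cdot> Y N m else 0)"
      by (rule shiftN)
    also have "\<dots> = (\<Sum>N<Suc r. \<Sum>m<l. (if 1 \<le> N \<and> 1 \<le> m then g r (N - 1) (m - 1) else 0) \<cdot> Y N m)"
      by (intro sum.cong) auto
    finally show ?thesis .
  qed
  have T2: "(\<Sum>N<r. \<Sum>m<l. (q powi (- 1 - 2 * int m) * g r N m) \<cdot> X m (int r - 1 - 2 * int N + int m + 1))
      = (\<Sum>N<Suc r. \<Sum>m<l. (if N < r then q powi (- 1 - 2 * int m) * g r N m else 0) \<cdot> Y N m)"
    by (simp add: Y_def algebra_simps)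
  have T3: "(\<Sum>N<r. \<Sum>m<l. (q powi (1 + 2 * int m) * g r N m) \<cdot> X m (int r - 1 - 2 * int N + int m - 1))
      = (\<Sum>N<Suc r. \<Sum>m<l. (if 1 \<le> N then q powi (1 + 2 * int m) * g r (N - 1) m else 0) \<cdot> Y N m)"
  proof -
    have "(\<Sum>N<r. \<Sum>m<l. (q powi (1 + 2 * int m) * g r N m) \<cdot> X m (int r - 1 - 2 * int N + int m - 1))
      = (\<Sum>N<r. \<Sum>m<l. (q powi (1 + 2 * int m) * g r (Suc N - 1) m) \<cdot> Y (Suc N) m)"
      by (simp add: Y_def algebra_simps)
    also have "\<dots> = (\<Sum>N<Suc r. if 1 \<le> N then \<Sum>m<l. (q powi (1 + 2 * int m) * g r (N - 1) m) \<cdot> Y N m else 0)"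
      by (rule shiftN)
    also have "\<dots> = (\<Sum>N<Suc r. \<Sum>m<l. (if 1 \<le> N then q powi (1 + 2 * int m) * g r (N - 1) m else 0) \<cdot> Y N m)"
      by (intro sum.cong) auto
    finally show ?thesis .
  qed
  have D1: "Del (Suc r) = (\<Sum>N<Suc r. \<Sum>m<l. g (Suc r) N m \<cdot> Y N m)"
    by (simp add: Del_def Y_def del: sum.lessThan_Suc)
  have D2: "Del (r - 1) = (\<Sum>N<Suc r. \<Sum>m<l. (if 1 \<le> N \<and> N < r then g (r - 1) (N - 1) m else 0) \<cdot> Y N m)"
  proof -
    obtain r' where r: "r = Suc r'"
      using assms by (cases r) auto
    have "Del (r - 1) = (\<Sum>N<r. if N < r - 1 then \<Sum>m<l. g (r - 1) N m \<cdot> Y (Suc N) m else 0)"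
      unfolding Del_def r by (simp add: Y_def r algebra_simps)
    also have "\<dots> = (\<Sum>N<Suc r. if 1 \<le> N then if N < r then \<Sum>m<l. g (r - 1) (N - 1) m \<cdot> Y N m else 0 else 0)"
      by (subst shiftN[symmetric]) (auto intro!: sum.cong)
    also have "\<dots> = (\<Sum>N<Suc r. \<Sum>m<l. (if 1 \<le> N \<and> N < r then g (r - 1) (N - 1) m else 0) \<cdot> Y N m)"
      by (intro sum.cong) auto
    finally show ?thesis .
  qed
  have "Cas * Del r =
      (\<Sum>N<r. \<Sum>m<l. g r N m \<cdot> X (Suc m) (int r - 1 - 2 * int N + int m))
    + (\<Sum>N<r. \<Sum>m<l. (q powi (- 1 - 2 * int m) * g r N m) \<cdot> X m (int r - 1 - 2 * int N + int m + 1))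
    + (\<Sum>N<r. \<Sum>m<l. (q powi (1 + 2 * int m) * g r N m) \<cdot> X m (int r - 1 - 2 * int N + int m - 1))"
    by (simp add: Del_def sum_distrib_left Cas_X scale_right_distrib sum.distrib mult.commute)
  also have "\<dots> = (\<Sum>N<Suc r. \<Sum>m<l.
      ((if 1 \<le> N \<and> 1 \<le> m then g r (N - 1) (m - 1) else 0)
      + (if N < r then q powi (- 1 - 2 * int m) * g r N m else 0)
      + (if 1 \<le> N then q powi (1 + 2 * int m) * g r (N - 1) m else 0)) \<cdot> Y N m)"
    unfolding T1 T2 T3 by (simp only: scale_left_distrib sum.distrib)
  also have "\<dots> = (\<Sum>N<Suc r. \<Sum>m<l.
      (g (Suc r) N m + (if 1 \<le> N \<and> N < r then g (r - 1) (N - 1) m else 0)) \<cdot> Y N m)"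
    using assms by (intro sum.cong refl arg_cong2[where f = smul] g_identity[symmetric]) auto
  also have "\<dots> = Del (Suc r) + Del (r - 1)"
    unfolding D1 D2 by (simp only: scale_left_distrib sum.distrib)
  finally show ?thesis .
qed

lemma Del_eq: "r \<le> l \<Longrightarrow> Del r = ev Cas (cheb r)"
proof (induction r rule: cheb.induct)
  case 1
  then show ?case
    by (simp add: Del_def)
next
  case 2
  have "g (Suc 0) 0 m = (if m = 0 then 1 else 0)" for m
    by (simp add: g_def qb_eq_0)
  then have "Del (Suc 0) = (\<Sum>m<l. (if m = 0 then 1 else 0) \<cdot> X m (int m))"
    by (simp add: Del_def)
  also have "\<dots> = (\<Sum>m<l. if m = 0 then X 0 0 else 0)"
    by (rule sum.cong) auto
  finally show ?case
    by (simp add: X_def)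
next
  case (3 r)
  then show ?case
    using Del_step[of "Suc r"]
    by (simp only: cheb.simps ev_diff ev_mult ev_monom) (simp add: algebra_simps)
qed

text \<open>Reduction modulo the monic polynomial \<open>Psi\<close>, which C annihilates, brings
  the degree below l, and there the Chebyshev polynomials span.\<close>

lemma Del_span: "\<exists>c. ev Cas f = (\<Sum>r=1..l. c r \<cdot> Del r)"
proof -
  have "degree (f mod Psi) < l"
    using degree_mod_less[of Psi f] monic_Psi l_pos by (cases "Psi = 0"; cases "f mod Psi = 0") auto
  then obtain c where c: "f mod Psi = (\<Sum>r=1..l. smult (c r) (cheb r))"
    using cheb_span by blast
  have "ev Cas f = (\<Sum>r=1..l. c r \<cdot> Del r)"
    unfolding ev_mod_Psi[of f, symmetric] c by (simp add: ev_sum ev_smult Del_eq)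
  then show ?thesis
    by (rule exI[where x = c])
qed

lemma sum_Del_ev: "(\<Sum>r=1..l. c r \<cdot> Del r) = ev Cas (\<Sum>r=1..l. smult (c r) (cheb r))"
  by (simp add: ev_sum ev_smult Del_eq)

end

section \<open>The polynomials \<open>Psis s\<close> and the derivative of
  \<open>Psi\<close>\<close>

context odd_root
begin

text \<open>The coefficient of E^a on V_s: it sends v_n to \<open>wt s n a\<close> times
  v_(n-a).\<close>

definition wt :: "nat \<Rightarrow> nat \<Rightarrow> nat \<Rightarrow> complex" where
  "wt s n a = (\<Prod>i<a. qi (int n - int i) * qi (int s - int n + int i))"

definition Psis :: "nat \<Rightarrow> complex poly" where
  "Psis s = Psi div cpol (int s)"

lemma Psis_eq: "cpol (int s) * Psis s = Psi"
proof -
  have "cpol (int (s mod l)) dvd Psi"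
    unfolding Psi_def by (rule dvd_prodI) auto
  moreover have "cpol (int (s mod l)) = cpol (int s)"
    using periodic_mod[of cc "int s"] by (simp add: zmod_int cpol_def)
  ultimately show ?thesis
    by (simp add: Psis_def)
qed

lemma cpol_add_l [simp]: "cpol (n + int l) = cpol n"
  by (simp add: cpol_def)

lemma cpol_nz [simp]: "cpol n \<noteq> 0"
  by (simp add: cpol_def)

lemma cc_reflect [simp]: "cc (int l - n) = cc n"
  by (simp add: cc_eq_iff)

lemma Psis_reflect: "s \<le> l \<Longrightarrow> Psis (l - s) = Psis s"
  by (simp add: Psis_def cpol_def of_nat_diff)

text \<open>Multiplied by y - c_s the sum telescopes. The next factor of the weight is c_s - c_z and
  the next factor of the product is y - c_z, and y - c_s is the second minus the first. The first
  end of the telescope is \<open>Psi\<close>, the last is 0.\<close>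

lemma telescope:
  assumes "n < l"
  shows "(\<Sum>a<l. smult (d ^ a * wt s n a) (\<Prod>k<l - 1 - a. cpol (2 * int k + (2 * int n + 2 - int s)))) = Psis s"
    (is "?S = _")
proof -
  define Q where "Q m = (\<Prod>k<m. cpol (2 * int k + (2 * int n + 2 - int s)))" for m
  have P: "d ^ a * wt s n a = (\<Prod>i<a. cc (int s) - cc (2 * (int n - int i) - int s))" for a
  proof -
    have "d * (qi (int n - int i) * qi (int s - int n + int i)) = cc (int s) - cc (2 * (int n - int i) - int s)" for i
      by (simp add: d_qi_qi algebra_simps)
    then have "(\<Prod>i<a. cc (int s) - cc (2 * (int n - int i) - int s))
        = (\<Prod>i<a. d * (qi (int n - int i) * qi (int s - int n + int i)))"
      by (simp only:)
    then show ?thesis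
      by (simp add: wt_def prod.distrib)
  qed
  have step: "cpol (int s) * smult (d ^ a * wt s n a) (Q (l - 1 - a))
      = smult (d ^ a * wt s n a) (Q (l - a)) - smult (d ^ Suc a * wt s n (Suc a)) (Q (l - Suc a))" if al: "a < l" for a
  proof -
    define z where "z = 2 * (int n - int a) - int s"
    obtain m where m: "l = a + Suc m"
      using less_iff_Suc_add[of a l] al by auto
    have "Q (l - a) = Q m * cpol (2 * int m + (2 * int n + 2 - int s))"
      using m by (simp add: Q_def)
    \<comment> \<open>The last index of the chain exceeds z by 2 l, which \<open>cpol\<close> does
      not see.\<close>
    also have "2 * int m + (2 * int n + 2 - int s) = z + int l + int l"
      by (subst (1 2) m) (simp add: z_def)
    finally have "Q (l - a) = Q m * cpol z"
      by (simp only: cpol_add_l)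
    moreover have "l - 1 - a = m" "l - Suc a = m"
      using m by auto
    moreover have "cpol (int s) * smult w p = smult w (p * cpol z) - smult (w * (cc (int s) - cc z)) p" for w p
      by (simp add: cpol_def algebra_simps smult_diff_left smult_diff_right)
    moreover have "d ^ Suc a * wt s n (Suc a) = (d ^ a * wt s n a) * (cc (int s) - cc z)"
      unfolding P by (simp add: z_def)
    ultimately show ?thesis
      by (simp only:)
  qed
  have "cpol (int s) * ?S = (\<Sum>a<l. smult (d ^ a * wt s n a) (Q (l - a)) - smult (d ^ Suc a * wt s n (Suc a)) (Q (l - Suc a)))"
    unfolding sum_distrib_left Q_def[symmetric] by (intro sum.cong step) auto
  also have "\<dots> = smult (d ^ 0 * wt s n 0) (Q (l - 0)) - smult (d ^ l * wt s n l) (Q (l - l))"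
    by (rule sum_lessThan_telescope')
  \<comment> \<open>The factor i = n, which occurs because n < l, equals c_s - c_(-s) = 0.\<close>
  also have "d ^ l * wt s n l = 0"
    unfolding P using assms by (intro prod_zero) (auto simp: cc_minus intro!: bexI[of _ n])
  also have "smult (d ^ 0 * wt s n 0) (Q (l - 0)) - smult 0 (Q (l - l)) = Psi"
    by (simp add: wt_def Q_def Psi_eq[symmetric])
  finally have "cpol (int s) * ?S = cpol (int s) * Psis s"
    by (simp add: Psis_eq)
  then show ?thesis
    by simp
qed

text \<open>Product rule. With the factor b removed, the factors above it, read backwards modulo l,
  descend from j - 1, and those below it ascend from j + 1; these are the chains of
  \<open>EF_e\<close> and \<open>FE_e\<close> on the weight j.\<close>

lemma pderiv_Psi: "pderiv Psi = (\<Sum>b<l. (\<Prod>k<l - 1 - b. cpol (j - 1 - 2 * int k)) * (\<Prod>k<b. cpol (2 * int k + (j + 1))))"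
proof -
  have "pderiv Psi = (\<Sum>b<l. (\<Prod>t\<in>{..<l} - {b}. cpol (2 * int t + (j + 1))))"
    by (subst Psi_eq[of "j + 1"]) (simp add: pderiv_prod cpol_def pderiv_pCons)
  also have "\<dots> = (\<Sum>b<l. (\<Prod>k<l - 1 - b. cpol (j - 1 - 2 * int k)) * (\<Prod>k<b. cpol (2 * int k + (j + 1))))"
  proof (intro sum.cong refl)
    fix b assume b: "b \<in> {..<l}"
    then have "{..<l} - {b} = {b<..<l} \<union> {..<b}" "{b<..<l} \<inter> {..<b} = {}"
      by auto
    then have "(\<Prod>t\<in>{..<l} - {b}. cpol (2 * int t + (j + 1)))
        = (\<Prod>t\<in>{b<..<l}. cpol (2 * int t + (j + 1))) * (\<Prod>t<b. cpol (2 * int t + (j + 1)))"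
      by (simp add: prod.union_disjoint)
    also have "(\<Prod>t\<in>{b<..<l}. cpol (2 * int t + (j + 1))) = (\<Prod>k<l - 1 - b. cpol (j - 1 - 2 * int k))"
    proof (rule prod.reindex_bij_witness[of _ "\<lambda>k. l - 1 - k" "\<lambda>t. l - 1 - t"])
      fix t assume t: "t \<in> {b<..<l}"
      then have "2 * int t + (j + 1) = j - 1 - 2 * int (l - 1 - t) + int l + int l"
        by (simp add: of_nat_diff)
      then show "cpol (j - 1 - 2 * int (l - 1 - t)) = cpol (2 * int t + (j + 1))"
        by (simp only: cpol_def cc_add_l)
    qed auto
    finally show "(\<Prod>t\<in>{..<l} - {b}. cpol (2 * int t + (j + 1)))
      = (\<Prod>k<l - 1 - b. cpol (j - 1 - 2 * int k)) * (\<Prod>k<b. cpol (2 * int k + (j + 1)))" .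
  qed
  finally show ?thesis .
qed

end

section \<open>Radford elements and the Higman map\<close>

context uq
begin

text \<open>The Radford image of the q-character of V_s without its constant factor, as computed in
  \<open>radford_cls\<close>.\<close>

definition Rad :: "nat \<Rightarrow> 'a" where
  "Rad s = (\<Sum>n<s. \<Sum>a<l. wt s n a \<cdot> (F ^ (l - 1 - a) * (E ^ (l - 1 - a) * e (2 * int n + 1 - int s))))"

text \<open>Of the power of d, the part d^a goes to the weight and d^(l-1-a) to \<open>FE_e\<close>.
  For each n this leaves the sum of \<open>telescope\<close>, multiplied by an idempotent.\<close>

lemma Rad_eq:
  assumes "s \<le> l"
  shows "d ^ (l - 1) \<cdot> Rad s = ev Cas (Psis s) * (\<Sum>n<s. e (2 * int n + 1 - int s))"
proof -
  have "d ^ (l - 1) \<cdot> (\<Sum>a<l. wt s n a \<cdot> (F ^ (l - 1 - a) * (E ^ (l - 1 - a) * e (2 * int n + 1 - int s))))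
      = ev Cas (Psis s) * e (2 * int n + 1 - int s)" if "n < s" for n
  proof -
    define j where "j = 2 * int n + 1 - int s"
    have "d ^ (l - 1) \<cdot> (wt s n a \<cdot> (F ^ (l - 1 - a) * (E ^ (l - 1 - a) * e j)))
      = (d ^ a * wt s n a) \<cdot> (d ^ (l - 1 - a) \<cdot> (F ^ (l - 1 - a) * (E ^ (l - 1 - a) * e j)))" if "a < l" for a
    proof -
      have "d ^ (l - 1) = d ^ a * d ^ (l - 1 - a)"
        using that by (simp flip: power_add)
      then show ?thesis
        by (simp add: mult_ac)
    qed
    then have "d ^ (l - 1) \<cdot> (\<Sum>a<l. wt s n a \<cdot> (F ^ (l - 1 - a) * (E ^ (l - 1 - a) * e j)))
      = (\<Sum>a<l. (d ^ a * wt s n a) \<cdot> (d ^ (l - 1 - a) \<cdot> (F ^ (l - 1 - a) * (E ^ (l - 1 - a) * e j))))"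
      unfolding scale_sum_right by (intro sum.cong) auto
    also have "\<dots> = ev Cas (\<Sum>a<l. smult (d ^ a * wt s n a) (\<Prod>k<l - 1 - a. cpol (2 * int k + (j + 1)))) * e j"
      by (simp only: FE_e ev_sum ev_smult sum_distrib_right smul_mult)
    also have "j + 1 = 2 * int n + 2 - int s"
      by (simp add: j_def)
    also have "(\<Sum>a<l. smult (d ^ a * wt s n a) (\<Prod>k<l - 1 - a. cpol (2 * int k + (2 * int n + 2 - int s)))) = Psis s"
      by (rule telescope) (use that assms in simp)
    finally show ?thesis
      by (simp add: j_def)
  qed
  then show ?thesis
    by (simp add: Rad_def scale_sum_right sum_distrib_left)
qed

text \<open>The weights belonging to l - s continue those belonging to s, modulo l, to a complete
  chain in steps of 2, so all the idempotents together sum to 1.\<close>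

lemma Rad_pair:
  assumes "s \<le> l"
  shows "d ^ (l - 1) \<cdot> (Rad s + Rad (l - s)) = ev Cas (Psis s)"
proof -
  have "e (2 * int n + 1 - int (l - s)) = e (2 * int (n + s) + 1 - int s)" for n
    using assms e_add_l[of "2 * int n + 1 - int (l - s)"] by (simp add: of_nat_diff algebra_simps)
  then have "(\<Sum>n<l - s. e (2 * int n + 1 - int (l - s))) = (\<Sum>n\<in>{s..<l}. e (2 * int n + 1 - int s))"
    by (intro sum.reindex_bij_witness[of _ "\<lambda>n. n - s" "\<lambda>n. n + s"]) auto
  moreover have "{..<l} = {..<s} \<union> {s..<l}" "{..<s} \<inter> {s..<l} = {}"
    using assms by auto
  ultimately have "(\<Sum>n<s. e (2 * int n + 1 - int s)) + (\<Sum>n<l - s. e (2 * int n + 1 - int (l - s)))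
      = (\<Sum>n<l. e (2 * int n + (1 - int s)))"
    by (simp add: sum.union_disjoint add_diff_eq)
  then have "(\<Sum>n<s. e (2 * int n + 1 - int s)) + (\<Sum>n<l - s. e (2 * int n + 1 - int (l - s))) = 1"
    by (simp only: sum_e)
  moreover have "d ^ (l - 1) \<cdot> (Rad s + Rad (l - s)) = ev Cas (Psis s) *
      ((\<Sum>n<s. e (2 * int n + 1 - int s)) + (\<Sum>n<l - s. e (2 * int n + 1 - int (l - s))))"
    using assms by (simp only: scale_right_distrib Rad_eq Psis_reflect distrib_left diff_le_self)
  ultimately show ?thesis
    by simp
qed

text \<open>The Higman map without the factor \<open>zeta\<close>, with coproduct and antipode of
  the integral written out; a, b and j come from the powers of F, of E and of K. The link is
  \<open>higman_cls\<close>.\<close>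

definition Tau :: "'a \<Rightarrow> 'a" where
  "Tau x = (\<Sum>a<l. \<Sum>b<l. \<Sum>j<l. q powi (2 * int a - 2 * (int b * int b) - 4 * int b) \<cdot>
     (Kp (- int b - int j) * (E ^ (l - 1 - b) * (Kp (int b - int a) * (F ^ (l - 1 - a) * (x *
       (F ^ a * (Kp (int a + 1) * (E ^ b * Kp (int j - 1))))))))))"

lemma Tau_add: "Tau (x + y) = Tau x + Tau y"
  by (simp add: Tau_def distrib_left distrib_right scale_right_distrib sum.distrib)

lemma Tau_smul: "Tau (c \<cdot> x) = c \<cdot> Tau x"
  by (simp add: Tau_def scale_sum_right mult.commute)

lemma Tau_0 [simp]: "Tau 0 = 0"
  by (simp add: Tau_def)

lemma Tau_ev: "Tau (ev Cas f * x) = ev Cas f * Tau x"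
proof -
  have E: "E ^ m * (ev Cas f * y) = ev Cas f * (E ^ m * y)" and F: "F ^ m * (ev Cas f * y) = ev Cas f * (F ^ m * y)"
    and K: "Kp p * (ev Cas f * y) = ev Cas f * (Kp p * y)" for m p y
    by (metis ev_E ev_F ev_Kp mult.assoc)+
  show ?thesis
    by (simp add: Tau_def sum_distrib_left mult.assoc E F K)
qed

text \<open>Carrying K from x to the right end or to the left end of the term costs the same power
  of q, and the K-factors obtained differ by the shift of j by one. The sum over j is periodic, so
  the shift does not change it.\<close>

lemma Tau_K: "Tau (x * Kp 1) = Tau (Kp 1 * x)"
proof -
  have "(\<Sum>j<l. c \<cdot> (Kp (- int b - int j) * (E ^ (l - 1 - b) * (Kp (int b - int a) * (F ^ (l - 1 - a) * (x * Kp 1 *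
       (F ^ a * (Kp (int a + 1) * (E ^ b * Kp (int j - 1)))))))))) =
    (\<Sum>j<l. c \<cdot> (Kp (- int b - int j) * (E ^ (l - 1 - b) * (Kp (int b - int a) * (F ^ (l - 1 - a) * (Kp 1 * x *
       (F ^ a * (Kp (int a + 1) * (E ^ b * Kp (int j - 1))))))))))" if ab: "a < l" "b < l" for c a b
  proof -
    define G where "G n = (q powi (2 * int b - 2 * int a) * c) \<cdot> (Kp (- int b - n) * (E ^ (l - 1 - b) * (Kp (int b - int a) * (F ^ (l - 1 - a) * (x *
       (F ^ a * (Kp (int a + 1) * (E ^ b * Kp n))))))))" for n
    have KK: "Kp m * (Kp n * y) = Kp n * (Kp m * y)" for m n y
      by (simp add: Kp_cancel add.commute)
    have 1: "Kp 1 * (F ^ a * (Kp (int a + 1) * (E ^ b * Kp p)))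
        = q powi (2 * int b - 2 * int a) \<cdot> (F ^ a * (Kp (int a + 1) * (E ^ b * Kp (p + 1))))" for p
      by (simp add: Kp_F' Kp_E' KK[of 1] Kp_E mult.commute add.commute power_int_add[symmetric] flip: Kp_add)
    have KL: "Kp (- int b - (n + int l)) = Kp (- int b - n)" for n
      using Kp_add_l[of "- int b - (n + int l)"] by (simp only: diff_diff_eq[symmetric] diff_add_cancel)
    have 3: "Kp (- int b - n) * (Kp 1 * y) = Kp (- int b - (n - 1)) * y" for n y
      by (simp add: Kp_cancel algebra_simps)
    have FK: "F ^ m * (Kp 1 * y) = q powi (2 * int m) \<cdot> (Kp 1 * (F ^ m * y))" for m y
      by (simp add: Kp_F' power_int_add[symmetric])
    have EK: "E ^ m * (Kp 1 * y) = q powi (- 2 * int m) \<cdot> (Kp 1 * (E ^ m * y))" for m y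
      by (simp add: Kp_E' power_int_add[symmetric])
    have 2: "E ^ (l - 1 - b) * (Kp (int b - int a) * (F ^ (l - 1 - a) * (Kp 1 * y)))
        = q powi (2 * int b - 2 * int a) \<cdot> (Kp 1 * (E ^ (l - 1 - b) * (Kp (int b - int a) * (F ^ (l - 1 - a) * y))))" for y
    proof -
      have "2 * int (l - 1 - a) + - 2 * int (l - 1 - b) = 2 * int b - 2 * int a"
        using ab by (simp add: of_nat_diff)
      then show ?thesis
        by (simp add: FK EK KK[of _ 1] power_int_add[symmetric] del: power_int_of_nat)
    qed
    have "(\<Sum>j<l. c \<cdot> (Kp (- int b - int j) * (E ^ (l - 1 - b) * (Kp (int b - int a) * (F ^ (l - 1 - a) * (x * Kp 1 *
       (F ^ a * (Kp (int a + 1) * (E ^ b * Kp (int j - 1))))))))))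
      = (\<Sum>j<l. G (int j))"
      by (simp only: G_def mult.assoc 1 mult_smul scale_scale mult.commute[of c] diff_add_cancel)
    also have "\<dots> = (\<Sum>j<l. G (1 * int j + (- 1)))"
      by (rule sum_periodic[symmetric]) (simp_all add: G_def KL)
    also have "\<dots> = (\<Sum>j<l. c \<cdot> (Kp (- int b - int j) * (E ^ (l - 1 - b) * (Kp (int b - int a) * (F ^ (l - 1 - a) * (Kp 1 * x *
       (F ^ a * (Kp (int a + 1) * (E ^ b * Kp (int j - 1))))))))))"
      by (simp only: G_def mult.assoc 2 3 mult_smul scale_scale mult.commute[of c] mult_1 add_uminus_conv_diff)
    finally show ?thesis .
  qed
  note * = this
  show ?thesis
    unfolding Tau_def by (rule sum.cong[OF refl], rule sum.cong[OF refl], rule *) simp_all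
qed

text \<open>Moving K around x once multiplies the value by c, so a weight c different from 1 forces
  the value 0.\<close>

lemma Tau_weight:
  assumes "Kp 1 * x = c \<cdot> (x * Kp 1)" and "c \<noteq> 1"
  shows "Tau (x * Kp p) = 0"
proof -
  have "Tau (x * Kp p) = Tau (x * Kp (p - 1) * Kp 1)"
    by (simp add: mult.assoc Kp_add[symmetric])
  also have "\<dots> = Tau (Kp 1 * (x * Kp (p - 1)))"
    by (rule Tau_K)
  also have "\<dots> = c \<cdot> Tau (x * Kp p)"
    by (simp add: mult.assoc[symmetric] assms Tau_smul) (simp add: mult.assoc Kp_add[symmetric])
  finally have "(1 - c) \<cdot> Tau (x * Kp p) = 0"
    by (simp add: scale_left_diff_distrib)
  then show ?thesis
    using assms by simp
qed

lemma Tau_E: "Tau (ev Cas f * (E ^ u * Kp p)) = 0" if "0 < u"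
proof (cases "u < l")
  case True
  have "q powi (2 * int u) \<noteq> 1"
    using True that by (simp add: q_powi_eq_1_iff l_dvd_double nat_dvd_not_less)
  then show ?thesis
    using Tau_weight[of "E ^ u" "q powi (2 * int u)" p] Kp_E[of 1 u] by (simp add: Tau_ev)
next
  case False
  then have "E ^ u = E ^ l * E ^ (u - l)"
    by (simp flip: power_add)
  then show ?thesis
    by (simp add: E_nil)
qed

lemma Tau_F: "Tau (ev Cas f * (F ^ u * Kp p)) = 0" if "0 < u"
proof (cases "u < l")
  case True
  have "q powi (- 2 * int u) \<noteq> 1"
    using True that l_dvd_double[of "int u"] by (simp add: q_powi_eq_1_iff nat_dvd_not_less del: power_int_minus)
  then show ?thesis
    using Tau_weight[of "F ^ u" "q powi (- 2 * int u)" p] Kp_F[of 1 u] by (simp add: Tau_ev)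
next
  case False
  then have "F ^ u = F ^ l * F ^ (u - l)"
    by (simp flip: power_add)
  then show ?thesis
    by (simp add: F_nil)
qed

lemma sum_const_smul: "(\<Sum>j<n. x) = of_nat n \<cdot> x"
  by (induction n) (simp_all add: scale_left_distrib add.commute del: sum_constant)

lemma sum_sum_smul: "(\<Sum>a<n. \<Sum>j<m. (c * f a) \<cdot> x) = (of_nat m * (c * (\<Sum>a<n. f a))) \<cdot> x"
proof -
  have "(of_nat m * (c * (\<Sum>a<n. f a))) \<cdot> x = (\<Sum>a<n. (of_nat m * (c * f a)) \<cdot> x)"
    by (simp add: sum_distrib_left scale_sum_left)
  then show ?thesis
    by (simp add: sum_const_smul del: sum_constant)
qed

text \<open>On the idempotent all K-factors become scalars. Modulo l the total exponent of q is
  independent of j and contains a only through - 2 p a, so the sum over j gives l and the sum over a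
  is a character sum. The exponents agree only modulo l, hence the appeal to
  \<open>q_powi_eq_iff\<close>.\<close>

lemma Tau_Kp_e:
  "Tau (Kp p) * e i = (\<Sum>b<l. (of_nat l * (q powi (p * (i + 2 * int b)) * (\<Sum>a<l. q powi (- 2 * p * int a)))) \<cdot>
     (E ^ (l - 1 - b) * (F ^ (l - 1) * (E ^ b * e i))))"
proof -
  have "q powi (2 * int a - 2 * (int b * int b) - 4 * int b) \<cdot>
     (Kp (- int b - int j) * (E ^ (l - 1 - b) * (Kp (int b - int a) * (F ^ (l - 1 - a) * (Kp p *
       (F ^ a * (Kp (int a + 1) * (E ^ b * (Kp (int j - 1) * e i)))))))))
    = (q powi (p * (i + 2 * int b)) * q powi (- 2 * p * int a)) \<cdot> (E ^ (l - 1 - b) * (F ^ (l - 1) * (E ^ b * e i)))"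
    if "a < l" "b < l" for a b j
  proof -
    have F: "F ^ (l - 1 - a) * (F ^ a * x) = F ^ (l - 1) * x" for x
      using that by (simp add: mult.assoc[symmetric] power_add[symmetric])
    have "Kp (- int b - int j) * (E ^ (l - 1 - b) * (Kp (int b - int a) * (F ^ (l - 1 - a) * (Kp p *
       (F ^ a * (Kp (int a + 1) * (E ^ b * (Kp (int j - 1) * e i))))))))
      = (q powi (i * (int j - 1)) * (q powi (2 * (int a + 1) * int b) * (q powi (i * (int a + 1)) *
        (q powi (- 2 * p * int a) * (q powi (2 * p * int b) * (q powi (i * p) *
        (q powi (- 2 * (int b - int a) * int (l - 1)) * (q powi (2 * (int b - int a) * int b) * (q powi (i * (int b - int a)) *
        (q powi (2 * (- int b - int j) * int (l - 1 - b)) * (q powi (- 2 * (- int b - int j) * int (l - 1))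
         * (q powi (2 * (- int b - int j) * int b) * q powi (i * (- int b - int j)))))))))))))) \<cdot>
       (E ^ (l - 1 - b) * (F ^ (l - 1) * (E ^ b * e i)))"
      by (simp only: Kp_e mult_smul Kp_E' Kp_F' F scale_scale mult.assoc)
    moreover have "q powi (2 * int a - 2 * (int b * int b) - 4 * int b) *
       (q powi (i * (int j - 1)) * (q powi (2 * (int a + 1) * int b) * (q powi (i * (int a + 1)) *
        (q powi (- 2 * p * int a) * (q powi (2 * p * int b) * (q powi (i * p) *
        (q powi (- 2 * (int b - int a) * int (l - 1)) * (q powi (2 * (int b - int a) * int b) * (q powi (i * (int b - int a)) *
        (q powi (2 * (- int b - int j) * int (l - 1 - b)) * (q powi (- 2 * (- int b - int j) * int (l - 1))
         * (q powi (2 * (- int b - int j) * int b) * q powi (i * (- int b - int j))))))))))))))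
      = q powi (p * (i + 2 * int b)) * q powi (- 2 * p * int a)"
    proof -
      have l: "int (l - 1 - b) = int l - 1 - int b" "int (l - 1) = int l - 1"
        using that by auto
      show ?thesis
        unfolding l by (simp only: power_int_add[symmetric] q_nz simp_thms q_powi_eq_iff)
          (simp add: algebra_simps)
    qed
    ultimately show ?thesis
      by (simp only: scale_scale)
  qed
  note * = this
  have "Tau (Kp p) * e i = (\<Sum>a<l. \<Sum>b<l. \<Sum>j<l. (q powi (p * (i + 2 * int b)) * q powi (- 2 * p * int a)) \<cdot>
      (E ^ (l - 1 - b) * (F ^ (l - 1) * (E ^ b * e i))))"
    unfolding Tau_def sum_distrib_right smul_mult mult.assoc[where 'a = 'a]
    by ((rule sum.cong[OF refl])+, rule *) simp_all
  also have "\<dots> = (\<Sum>b<l. \<Sum>a<l. \<Sum>j<l. (q powi (p * (i + 2 * int b)) * q powi (- 2 * p * int a)) \<cdot>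
      (E ^ (l - 1 - b) * (F ^ (l - 1) * (E ^ b * e i))))"
    by (rule sum.swap)
  also have "\<dots> = (\<Sum>b<l. (of_nat l * (q powi (p * (i + 2 * int b)) * (\<Sum>a<l. q powi (- 2 * p * int a)))) \<cdot>
     (E ^ (l - 1 - b) * (F ^ (l - 1) * (E ^ b * e i))))"
    by (simp only: sum_sum_smul)
  finally show ?thesis .
qed

text \<open>F^(l-1) is split as F^m F^b with m = l - 1 - b, so that F^b E^b and E^m F^m each become
  a polynomial in C on the given weight.\<close>

lemma EFE_e:
  assumes "b < l"
  shows "d ^ (l - 1) \<cdot> (E ^ (l - 1 - b) * (F ^ (l - 1) * (E ^ b * e j)))
    = ev Cas ((\<Prod>k<l - 1 - b. cpol (j - 1 - 2 * int k)) * (\<Prod>k<b. cpol (2 * int k + (j + 1)))) * e j"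
proof -
  define m where "m = l - 1 - b"
  have lm: "l - 1 = m + b"
    using assms by (simp add: m_def)
  have "d ^ (l - 1) \<cdot> (E ^ m * (F ^ (l - 1) * (E ^ b * e j))) = d ^ m \<cdot> (E ^ m * (F ^ m * (d ^ b \<cdot> (F ^ b * (E ^ b * e j)))))"
    unfolding lm by (simp add: power_add mult.assoc)
  also have "\<dots> = ev Cas (\<Prod>k<b. cpol (2 * int k + (j + 1))) * (d ^ m \<cdot> (E ^ m * (F ^ m * e j)))"
    unfolding FE_e by (simp only: mult.assoc[symmetric] ev_E ev_F mult_smul)
  also have "\<dots> = ev Cas ((\<Prod>k<l - 1 - b. cpol (j - 1 - 2 * int k)) * (\<Prod>k<b. cpol (2 * int k + (j + 1)))) * e j"
    unfolding EF_e m_def by (simp add: mult.assoc[symmetric] ev_mult[symmetric] mult.commute)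
  finally show ?thesis
    by (simp add: m_def)
qed

lemma eq_0_by_e: "(\<And>j. x * e j = 0) \<Longrightarrow> x = 0"
proof -
  assume *: "\<And>j. x * e j = 0"
  have "x = x * (\<Sum>i<l. e (2 * int i + 0))"
    by (simp only: sum_e) simp
  then show "x = 0"
    by (simp add: sum_distrib_left *)
qed

text \<open>On each weight the l terms left by \<open>Tau_Kp_e\<close> are the l summands of the
  product rule in \<open>pderiv_Psi\<close>. One factor l comes from the sum over j and one from the
  sum over a.\<close>

lemma Tau_1: "d ^ (l - 1) \<cdot> Tau 1 = (of_nat l)\<^sup>2 \<cdot> ev Cas (pderiv Psi)"
proof -
  have "(d ^ (l - 1) \<cdot> Tau 1 - (of_nat l)\<^sup>2 \<cdot> ev Cas (pderiv Psi)) * e j = 0" for j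
  proof -
    have "d ^ (l - 1) \<cdot> (Tau 1 * e j) = (\<Sum>b<l. (of_nat l)\<^sup>2 \<cdot> (d ^ (l - 1) \<cdot> (E ^ (l - 1 - b) * (F ^ (l - 1) * (E ^ b * e j)))))"
      using Tau_Kp_e[of 0 j] by (simp add: scale_sum_right power2_eq_square mult_ac)
    also have "\<dots> = (of_nat l)\<^sup>2 \<cdot> (ev Cas (pderiv Psi) * e j)"
      unfolding pderiv_Psi[of j] ev_sum sum_distrib_right scale_sum_right
      by (intro sum.cong refl arg_cong[where f = "smul _"] EFE_e) simp
    finally show ?thesis
      by (simp add: left_diff_distrib)
  qed
  then show ?thesis
    using eq_0_by_e by fastforce
qed

lemma Tau_Kp:
  assumes "\<not> int l dvd p"
  shows "Tau (Kp p) = 0"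
proof (rule eq_0_by_e)
  fix j
  have "(\<Sum>a<l. q powi (- 2 * p * int a)) = 0"
    using assms by (subst sum_q_powi) (simp add: l_dvd_double)
  then show "Tau (Kp p) * e j = 0"
    by (simp only: Tau_Kp_e) simp
qed

end

section \<open>Quotients by two-sided ideals as a type\<close>

lemma type_ring_simps [simp]:
  "carrier type_ring = UNIV" "monoid.mult type_ring = (*)" "one type_ring = 1"
  "zero type_ring = 0" "add type_ring = (+)"
  by (simp_all add: type_ring_def)

lemma ring_type_ring: "ring (type_ring :: 'a::ring_1 ring)"
  by (rule ringI, rule abelian_groupI, auto simp: algebra_simps intro: monoid.intro exI[of _ "- _"] left_minus)

interpretation tr: ring "type_ring :: 'a::ring_1 ring"
  by (rule ring_type_ring)

lemma tr_minus [simp]: "\<ominus>\<^bsub>type_ring\<^esub> x = - (x :: 'a::ring_1)"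
  by (rule tr.minus_equality) auto

lemma ideal_gen: "ideal (genideal type_ring S) (type_ring :: 'a::ring_1 ring)"
  by (rule tr.genideal_ideal) simp

lemma gen_in: "x \<in> S \<Longrightarrow> x \<in> genideal (type_ring :: 'a::ring_1 ring) S"
  using tr.genideal_self[of S] by auto

lemma gen_add: "x \<in> genideal (type_ring :: 'a::ring_1 ring) S \<Longrightarrow> y \<in> genideal type_ring S \<Longrightarrow> x + y \<in> genideal type_ring S"
  and gen_zero [simp]: "0 \<in> genideal (type_ring :: 'a::ring_1 ring) S"
  and gen_uminus: "x \<in> genideal (type_ring :: 'a::ring_1 ring) S \<Longrightarrow> - x \<in> genideal type_ring S"
  and gen_mult_left: "x \<in> genideal (type_ring :: 'a::ring_1 ring) S \<Longrightarrow> a * x \<in> genideal type_ring S"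
  and gen_mult_right: "x \<in> genideal (type_ring :: 'a::ring_1 ring) S \<Longrightarrow> x * a \<in> genideal type_ring S"
proof -
  interpret ideal "genideal type_ring S" "type_ring :: 'a ring"
    by (rule ideal_gen)
  show "x \<in> genideal type_ring S \<Longrightarrow> y \<in> genideal type_ring S \<Longrightarrow> x + y \<in> genideal type_ring S"
    using a_closed by simp
  show "0 \<in> genideal type_ring S"
    using zero_closed by simp
  show "x \<in> genideal type_ring S \<Longrightarrow> - x \<in> genideal type_ring S"
    using a_inv_closed by fastforce
  show "x \<in> genideal type_ring S \<Longrightarrow> a * x \<in> genideal type_ring S"
    using I_l_closed by simp
  show "x \<in> genideal type_ring S \<Longrightarrow> x * a \<in> genideal type_ring S"
    using I_r_closed by simp
qed

lemma gen_diff: "x \<in> genideal (type_ring :: 'a::ring_1 ring) S \<Longrightarrow> y \<in> genideal type_ring S \<Longrightarrow> x - y \<in> genideal type_ring S"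
  using gen_add[of x S "- y"] gen_uminus[of y S] by simp

lemma gen_subset:
  assumes "S \<subseteq> J" and "0 \<in> J" and "\<And>x y. x \<in> J \<Longrightarrow> y \<in> J \<Longrightarrow> x + y \<in> J"
    and "\<And>a x. x \<in> J \<Longrightarrow> a * x \<in> J" and "\<And>a x. x \<in> J \<Longrightarrow> x * a \<in> J"
  shows "genideal (type_ring :: 'a::ring_1 ring) S \<subseteq> J"
proof -
  \<comment> \<open>Closure under negation is absorption of the factor - 1.\<close>
  have "- x \<in> J" if "x \<in> J" for x
    using assms(4)[OF that, of "- 1"] by simp
  moreover have "inv\<^bsub>\<lparr>carrier = UNIV, monoid.mult = (+), one = 0\<rparr>\<^esub> x = - x" for x :: 'a
    using tr_minus[of x] by (simp add: a_inv_def)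
  ultimately have "subgroup J (add_monoid (type_ring :: 'a ring))"
    using assms by (intro subgroup.intro) auto
  then have "ideal J (type_ring :: 'a ring)"
    using assms by (intro idealI ring_type_ring) auto
  then show ?thesis
    using assms(1) by (intro tr.genideal_minimal)
qed

text \<open>The disjunction covers homomorphisms and antihomomorphisms alike; the antipode is of the
  second kind.\<close>

lemma gen_subset_kernel:
  fixes f :: "'a::ring_1 \<Rightarrow> 'b::ring_1"
  assumes "\<And>x y. f (x + y) = f x + f y" and "\<And>x y. f (x * y) = f x * f y \<or> f (x * y) = f y * f x"
    and "\<And>s. s \<in> S \<Longrightarrow> f s = 0" and "x \<in> genideal type_ring S"
  shows "f x = 0"
proof -
  have "f 0 = 0"
    using assms(1)[of 0 0] by simp
  moreover have "f (a * x) = 0" "f (x * a) = 0" if "f x = 0" for a x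
    using assms(2)[of a x] assms(2)[of x a] that by auto
  ultimately have "genideal type_ring S \<subseteq> {x. f x = 0}"
    using assms(1,3) by (intro gen_subset) auto
  then show ?thesis
    using assms(4) by auto
qed

definition fam_rel :: "('a::ring_1 set \<Rightarrow> 'a) \<Rightarrow> ('a set \<Rightarrow> 'a) \<Rightarrow> bool" where
  "fam_rel f g \<longleftrightarrow> (\<forall>J. f J - g J \<in> genideal type_ring J)"

lemma fam_rel_eqI: "(\<And>J. f J = g J) \<Longrightarrow> fam_rel f g"
  by (simp add: fam_rel_def)

lemma equivp_fam_rel: "equivp fam_rel"
proof (rule equivpI)
  show "reflp fam_rel"
    by (simp add: reflp_def fam_rel_def)
  show "symp fam_rel"
    unfolding symp_def fam_rel_def by (metis gen_uminus minus_diff_eq)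
  show "transp fam_rel"
    unfolding transp_def fam_rel_def by (metis gen_add diff_add_cancel add_diff_eq)
qed

text \<open>
  A quotient by an ideal that depends on variables is not a type, so quotients by all ideals are
  collected in one product ring, which is a type.  A single quotient is embedded in it by filling
  the other components with an augmentation that kills the ideal.
\<close>

quotient_type (overloaded) 'a fam = "'a::ring_1 set \<Rightarrow> 'a" / fam_rel
  by (rule equivp_fam_rel)

instantiation fam :: (ring_1) ring_1
begin

lift_definition zero_fam :: "'a fam" is "\<lambda>_. 0" .

lift_definition plus_fam :: "'a fam \<Rightarrow> 'a fam \<Rightarrow> 'a fam" is "\<lambda>f g J. f J + g J"
  unfolding fam_rel_def by (metis gen_add add_diff_add)

lift_definition uminus_fam :: "'a fam \<Rightarrow> 'a fam" is "\<lambda>f J. - f J"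
  unfolding fam_rel_def by (metis gen_uminus minus_diff_minus)

lift_definition minus_fam :: "'a fam \<Rightarrow> 'a fam \<Rightarrow> 'a fam" is "\<lambda>f g J. f J - g J"
  unfolding fam_rel_def
proof (intro allI)
  fix f f' g g' :: "'a set \<Rightarrow> 'a" and J
  assume "\<forall>J. f J - f' J \<in> genideal type_ring J" "\<forall>J. g J - g' J \<in> genideal type_ring J"
  then have "(f J - f' J) - (g J - g' J) \<in> genideal type_ring J"
    by (auto intro: gen_diff[of "f J - f' J" J "g J - g' J"])
  moreover have "(f J - f' J) - (g J - g' J) = f J - g J - (f' J - g' J)"
    by simp
  ultimately show "f J - g J - (f' J - g' J) \<in> genideal type_ring J"
    by (simp only:)
qed

lift_definition times_fam :: "'a fam \<Rightarrow> 'a fam \<Rightarrow> 'a fam" is "\<lambda>f g J. f J * g J"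
  unfolding fam_rel_def
proof (intro allI)
  fix f f' g g' :: "'a set \<Rightarrow> 'a" and J
  assume "\<forall>J. f J - f' J \<in> genideal type_ring J" "\<forall>J. g J - g' J \<in> genideal type_ring J"
  then have "(f J - f' J) * g J + f' J * (g J - g' J) \<in> genideal type_ring J"
    by (intro gen_add gen_mult_left gen_mult_right) auto
  then show "f J * g J - f' J * g' J \<in> genideal type_ring J"
    by (simp add: algebra_simps)
qed

lift_definition one_fam :: "'a fam" is "\<lambda>_. 1" .

instance
proof
  fix a b c :: "'a fam"
  show "a + b + c = a + (b + c)" "a + b = b + a" "0 + a = a" "- a + a = 0" "a - b = a + - b"
    "a * b * c = a * (b * c)" "(a + b) * c = a * c + b * c" "a * (b + c) = a * b + a * c" "1 * a = a" "a * 1 = a"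
    by (transfer, rule fam_rel_eqI, simp add: algebra_simps)+
  \<comment> \<open>The component at the empty set of generators is the ring itself, and there 0 and
    1 differ.\<close>
  show "(0 :: 'a fam) \<noteq> 1"
  proof transfer
    have "genideal (type_ring :: 'a ring) {} \<subseteq> {0}"
      by (rule gen_subset) auto
    then show "\<not> fam_rel (\<lambda>_. 0) (\<lambda>_. 1 :: 'a)"
      by (auto simp: fam_rel_def intro!: exI[of _ "{}"] dest!: subsetD)
  qed
qed

end

definition fam_of :: "'a set \<Rightarrow> ('a \<Rightarrow> 'a) \<Rightarrow> 'a \<Rightarrow> 'a::ring_1 fam" where
  "fam_of S chi x = abs_fam (\<lambda>J. if J = S then x else chi x)"

locale augmentation =
  fixes chi :: "'a::ring_1 \<Rightarrow> 'a" and S :: "'a set"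
  assumes chi_add: "chi (x + y) = chi x + chi y"
    and chi_mult: "chi (x * y) = chi x * chi y"
    and chi_1: "chi 1 = 1"
    and chi_S: "x \<in> S \<Longrightarrow> chi x = 0"
begin

abbreviation "pr \<equiv> fam_of S chi"

lemma pr_add: "pr (x + y) = pr x + pr y"
  unfolding fam_of_def plus_fam.abs_eq by (rule arg_cong[where f = abs_fam]) (auto simp: chi_add)

lemma pr_mult: "pr (x * y) = pr x * pr y"
  unfolding fam_of_def times_fam.abs_eq by (rule arg_cong[where f = abs_fam]) (auto simp: chi_mult)

lemma pr_1: "pr 1 = 1"
  unfolding fam_of_def one_fam_def map_fun_apply id_apply
  by (simp add: chi_1 one_fam.abs_eq cong: if_cong)

lemma chi_ideal: "x \<in> genideal type_ring S \<Longrightarrow> chi x = 0"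
  by (rule gen_subset_kernel[of chi S]) (auto simp: chi_add chi_mult chi_S)

lemma chi_diff: "chi (x - y) = chi x - chi y"
  using chi_add[of "x - y" y] by simp

text \<open>Outside the component \<open>S\<close> the two families differ by chi (x - y), which is
  0 as soon as x - y lies in the ideal; so that one component decides.\<close>

lemma pr_eq_iff: "pr x = pr y \<longleftrightarrow> x - y \<in> genideal type_ring S"
proof -
  have "pr x = pr y \<longleftrightarrow> fam_rel (\<lambda>J. if J = S then x else chi x) (\<lambda>J. if J = S then y else chi y)"
    unfolding fam_of_def by (rule fam.abs_eq_iff)
  also have "\<dots> \<longleftrightarrow> x - y \<in> genideal type_ring S"
    using chi_ideal[of "x - y"] by (auto simp: fam_rel_def chi_diff)
  finally show ?thesis .
qed

lemma pr_0: "pr 0 = 0"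
  using pr_add[of 0 0] by simp

lemma pr_eq_0_iff: "pr x = 0 \<longleftrightarrow> x \<in> genideal type_ring S"
  using pr_eq_iff[of x 0] by (simp add: pr_0)

lemma pr_sum: "pr (\<Sum>i\<in>A. f i) = (\<Sum>i\<in>A. pr (f i))"
  by (induction A rule: infinite_finite_induct) (simp_all add: pr_0 pr_add)

lemma pr_uminus: "pr (- x) = - pr x"
  using pr_add[of x "- x"] by (simp add: pr_0 eq_neg_iff_add_eq_0 add.commute)

lemma pr_diff: "pr (x - y) = pr x - pr y"
  using pr_add[of x "- y"] by (simp add: pr_uminus)

lemma pr_power: "pr (x ^ n) = pr x ^ n"
  by (induction n) (simp_all add: pr_1 pr_mult)

end

section \<open>Linear extensions on monoid algebras\<close>

lemma scal_add: "scal (a + b) = scal a + scal b"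
  by (simp add: scal_def single_add)

lemma scal_mult: "scal (a * b) = scal a * scal b"
  by (simp add: scal_def mult_single)

lemma scal_1 [simp]: "scal 1 = 1"
  by (simp add: scal_def)

lemma scal_single: "scal c * Poly_Mapping.single w a = Poly_Mapping.single w (c * a)"
  by (simp add: scal_def mult_single)

lemma poly_mapping_induct [case_names single add]:
  fixes x :: "'a \<Rightarrow>\<^sub>0 complex"
  assumes "\<And>w c. P (Poly_Mapping.single w c)" and "\<And>x y. P x \<Longrightarrow> P y \<Longrightarrow> P (x + y)"
  shows "P x"
proof (induction x rule: update_induct)
  case const
  show ?case
    using assms(1)[of _ 0] by simp
next
  case (update x k v)
  have "Poly_Mapping.update k v x = Poly_Mapping.single k v + x"
    using update(1) by (intro poly_mapping_eqI)
      (auto simp: lookup_update lookup_add lookup_single when_def in_keys_iff)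
  then show ?case
    using update assms by simp
qed

lemma scal_comm: "scal c * x = x * scal c"
  by (induction x rule: poly_mapping_induct)
    (simp_all add: scal_def mult_single distrib_left distrib_right mult.commute)

interpretation fr: central_scalars "scal :: complex \<Rightarrow> ('a::monoid_add \<Rightarrow>\<^sub>0 complex)"
  by unfold_locales (rule scal_add scal_mult scal_1 scal_comm)+

context central_scalars
begin

definition lin :: "('w \<Rightarrow> 'a) \<Rightarrow> ('w \<Rightarrow>\<^sub>0 complex) \<Rightarrow> 'a" where
  "lin \<phi> x = (\<Sum>w\<in>Poly_Mapping.keys x. sc (Poly_Mapping.lookup x w) * \<phi> w)"

lemma lin_superset:
  assumes "finite A" "Poly_Mapping.keys x \<subseteq> A"
  shows "lin \<phi> x = (\<Sum>w\<in>A. sc (Poly_Mapping.lookup x w) * \<phi> w)"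
  unfolding lin_def using assms by (intro sum.mono_neutral_left) (auto simp: in_keys_iff)

lemma lin_single [simp]: "lin \<phi> (Poly_Mapping.single w c) = sc c * \<phi> w"
  by (subst lin_superset[of "{w}"]) auto

lemma lin_add: "lin \<phi> (x + y) = lin \<phi> x + lin \<phi> y"
proof -
  let ?A = "Poly_Mapping.keys x \<union> Poly_Mapping.keys y"
  have "lin \<phi> z = (\<Sum>w\<in>?A. sc (Poly_Mapping.lookup z w) * \<phi> w)" if "Poly_Mapping.keys z \<subseteq> ?A" for z
    using that by (intro lin_superset) auto
  then show ?thesis
    by (simp add: keys_add lookup_add sc_add distrib_right sum.distrib)
qed

lemma lin_0 [simp]: "lin \<phi> 0 = 0"
  by (simp add: lin_def)

lemma lin_uminus: "lin \<phi> (- x) = - lin \<phi> x"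
  using lin_add[of \<phi> x "- x"] by (simp add: eq_neg_iff_add_eq_0 add.commute)

lemma lin_diff: "lin \<phi> (x - y) = lin \<phi> x - lin \<phi> y"
  using lin_add[of \<phi> x "- y"] by (simp add: lin_uminus)

lemma lin_sum: "lin \<phi> (\<Sum>i\<in>A. f i) = (\<Sum>i\<in>A. lin \<phi> (f i))"
  by (induction A rule: infinite_finite_induct) (simp_all add: lin_add)

lemma lin_scal: "lin \<phi> (scal c * x) = sc c * lin \<phi> x"
  by (induction x rule: poly_mapping_induct)
    (simp_all add: scal_single sc_mult mult.assoc distrib_left lin_add)

lemma lin_mult:
  assumes "\<And>u v. \<phi> (u + v) = \<phi> u * \<phi> v"
  shows "lin \<phi> (x * y) = lin \<phi> x * lin \<phi> y"
proof (induction x rule: poly_mapping_induct)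
  case (single u a)
  show ?case
  proof (induction y rule: poly_mapping_induct)
    case (single v b)
    have "\<phi> u * (sc b * \<phi> v) = sc b * (\<phi> u * \<phi> v)"
      using mult_smul[of "\<phi> u" b "\<phi> v"] by (simp add: smul_def)
    then show ?case
      by (simp add: mult_single assms sc_mult mult.assoc)
  qed (simp_all add: distrib_left lin_add)
qed (simp_all add: distrib_right lin_add)

lemma lin_mult_rev:
  assumes "\<And>u v. \<phi> (u + v) = \<phi> v * \<phi> u"
  shows "lin \<phi> (x * y) = lin \<phi> y * lin \<phi> x"
proof (induction x rule: poly_mapping_induct)
  case (single u a)
  show ?case
  proof (induction y rule: poly_mapping_induct)
    case (single v b)
    have "\<phi> v * (sc a * \<phi> u) = sc a * (\<phi> v * \<phi> u)"
      using mult_smul[of "\<phi> v" a "\<phi> u"] by (simp add: smul_def)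
    then show ?case
      using scale_left_commute[of a b "\<phi> v * \<phi> u"]
      by (simp add: mult_single assms sc_mult mult.assoc smul_def)
  qed (simp_all add: distrib_left distrib_right lin_add)
qed (simp_all add: distrib_left distrib_right lin_add)

end

text \<open>With the complex numbers themselves as the algebra, \<open>cs.lin\<close> is the
  extension of a function on words to a linear functional; matrix entries and coordinates are
  treated this way.\<close>

interpretation cs: central_scalars "id :: complex \<Rightarrow> complex"
  by unfold_locales (simp_all add: mult.commute)

lemma prod_list_plus: "prod_list (map f (u + v)) = prod_list (map f u) * prod_list (map f v)"
  by (simp add: plus_list_def)

lemma alg_lift_lin: "alg_lift f = fr.lin (\<lambda>w. prod_list (map f w))"
  by (simp add: fun_eq_iff alg_lift_def fr.lin_def)

lemma antialg_lift_lin: "antialg_lift f = fr.lin (\<lambda>w. prod_list (map f (rev w)))"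
  by (simp add: fun_eq_iff antialg_lift_def fr.lin_def)

lemma alg_lift_mult: "alg_lift f (x * y) = alg_lift f x * alg_lift f y"
  unfolding alg_lift_lin by (rule fr.lin_mult) (rule prod_list_plus)

lemma antialg_lift_mult: "antialg_lift f (x * y) = antialg_lift f y * antialg_lift f x"
  unfolding antialg_lift_lin by (rule fr.lin_mult_rev) (simp add: plus_list_def)

lemma alg_lift_add: "alg_lift f (x + y) = alg_lift f x + alg_lift f y"
  unfolding alg_lift_lin by (rule fr.lin_add)

lemma antialg_lift_add: "antialg_lift f (x + y) = antialg_lift f x + antialg_lift f y"
  unfolding antialg_lift_lin by (rule fr.lin_add)

lemma alg_lift_gen: "alg_lift f (gen g) = f g"
  by (simp add: alg_lift_lin gen_def)

lemma antialg_lift_gen: "antialg_lift f (gen g) = f g"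
  by (simp add: antialg_lift_lin gen_def)

lemma alg_lift_scal: "alg_lift f (scal c) = scal c"
  by (simp add: alg_lift_lin scal_def[of c, where 'a = "generator list"]) (simp add: zero_list_def)

lemma antialg_lift_scal: "antialg_lift f (scal c) = scal c"
  by (simp add: antialg_lift_lin scal_def[of c, where 'a = "generator list"]) (simp add: zero_list_def)

section \<open>Pure tensors\<close>

text \<open>The embeddings of x as x (x) 1 and, in \<open>inr\<close>, of y as 1 (x) y. Every pure
  tensor is a product of two such elements, and they commute, so tensor calculus becomes calculus
  with two commuting copies.\<close>

definition inl :: "falg \<Rightarrow> falg2" where "inl = fr.lin (\<lambda>w. Poly_Mapping.single (w, 0) 1)"

definition inr :: "falg \<Rightarrow> falg2" where "inr = fr.lin (\<lambda>w. Poly_Mapping.single (0, w) 1)"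

lemma inl_add: "inl (x + y) = inl x + inl y" and inr_add: "inr (x + y) = inr x + inr y"
  unfolding inl_def inr_def by (rule fr.lin_add)+

lemma inl_diff: "inl (x - y) = inl x - inl y" and inr_diff: "inr (x - y) = inr x - inr y"
  unfolding inl_def inr_def by (rule fr.lin_diff)+

lemma inl_mult: "inl (x * y) = inl x * inl y" and inr_mult: "inr (x * y) = inr x * inr y"
  unfolding inl_def inr_def by (rule fr.lin_mult; simp add: mult_single)+

lemma inl_single: "inl (Poly_Mapping.single w c) = Poly_Mapping.single (w, 0) c"
  and inr_single: "inr (Poly_Mapping.single w c) = Poly_Mapping.single (0, w) c"
  by (simp_all add: inl_def inr_def scal_single)

lemma inl_scal: "inl (scal c) = scal c" and inr_scal: "inr (scal c) = scal c"
  unfolding scal_def by (simp_all add: inl_single inr_single zero_prod_def)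

lemma inl_1 [simp]: "inl 1 = 1" and inr_1 [simp]: "inr 1 = 1"
  using inl_scal[of 1] inr_scal[of 1] by simp_all

lemma inl_power: "inl (x ^ n) = inl x ^ n" and inr_power: "inr (x ^ n) = inr x ^ n"
  by (induction n) (simp_all add: inl_mult inr_mult)

lemma inl_inr_single: "inl (Poly_Mapping.single u a) * inr (Poly_Mapping.single v b) = Poly_Mapping.single (u, v) (a * b)"
  by (simp add: inl_single inr_single mult_single)

lemma inr_inl: "inr y * inl x = inl x * inr y"
proof (induction x rule: poly_mapping_induct)
  case (single u a)
  show ?case
    by (induction y rule: poly_mapping_induct)
      (simp_all add: inl_single inr_single mult_single inr_add distrib_left distrib_right mult.commute)
qed (simp_all add: inl_add distrib_left distrib_right)

lemma pure_tensor_eq: "x \<otimes>\<^sub>f y = inl x * inr y"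
proof -
  have x: "inl x = (\<Sum>u\<in>Poly_Mapping.keys x. Poly_Mapping.single (u, 0) (Poly_Mapping.lookup x u))"
    and y: "inr y = (\<Sum>v\<in>Poly_Mapping.keys y. Poly_Mapping.single (0, v) (Poly_Mapping.lookup y v))"
    by (simp_all add: inl_def inr_def fr.lin_def scal_single)
  show ?thesis
    unfolding x y pure_tensor_def by (simp add: sum_product mult_single)
qed

lemma single_pair: "Poly_Mapping.single (u, v) c = scal c * (inl (Poly_Mapping.single u 1) * inr (Poly_Mapping.single v 1))"
  by (simp add: inl_inr_single scal_single)

section \<open>Cosets\<close>

lemma coset_def': "genideal type_ring S +>\<^bsub>type_ring\<^esub> x = {i + x | i. i \<in> genideal (type_ring :: 'a::ring_1 ring) S}"
  by (auto simp: a_r_coset_def r_coset_def)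

lemma coset_eq_iff:
  "genideal type_ring S +>\<^bsub>type_ring\<^esub> x = genideal type_ring S +>\<^bsub>type_ring\<^esub> y
    \<longleftrightarrow> x - y \<in> genideal (type_ring :: 'a::ring_1 ring) S"
proof
  assume "genideal type_ring S +>\<^bsub>type_ring\<^esub> x = genideal type_ring S +>\<^bsub>type_ring\<^esub> y"
  moreover have "x \<in> genideal type_ring S +>\<^bsub>type_ring\<^esub> x"
    unfolding coset_def' by (auto intro!: exI[of _ 0])
  ultimately show "x - y \<in> genideal type_ring S"
    unfolding coset_def' by auto
next
  assume xy: "x - y \<in> genideal type_ring S"
  have "\<exists>j. i + x = j + y \<and> j \<in> genideal type_ring S" if "i \<in> genideal type_ring S" for i
    using gen_add[OF that xy] by (intro exI[of _ "i + (x - y)"]) auto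
  moreover have "\<exists>j. i + y = j + x \<and> j \<in> genideal type_ring S" if "i \<in> genideal type_ring S" for i
    using gen_diff[OF that xy] by (intro exI[of _ "i - (x - y)"]) auto
  ultimately show "genideal type_ring S +>\<^bsub>type_ring\<^esub> x = genideal type_ring S +>\<^bsub>type_ring\<^esub> y"
    unfolding coset_def' by blast
qed

lemma the_elem_coset:
  assumes "\<And>i. i \<in> genideal (type_ring :: 'a::ring_1 ring) S \<Longrightarrow> f (i + x) = f x"
  shows "the_elem (f ` (genideal type_ring S +>\<^bsub>type_ring\<^esub> x)) = f x"
proof -
  have "f ` (genideal type_ring S +>\<^bsub>type_ring\<^esub> x) = {f x}"
    unfolding coset_def' using assms by (auto simp: image_iff intro!: exI[of _ "0 + x"] exI[of _ 0])
  then show ?thesis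
    by simp
qed

lemma coset_mult:
  "(genideal type_ring S +>\<^bsub>type_ring\<^esub> x) \<otimes>\<^bsub>type_ring Quot genideal type_ring S\<^esub> (genideal type_ring S +>\<^bsub>type_ring\<^esub> y)
    = genideal type_ring S +>\<^bsub>type_ring\<^esub> (x * y :: 'a::ring_1)"
  using ideal.rcoset_mult_add[OF ideal_gen, of x y S] by (simp add: FactRing_def)

lemma coset_add:
  "(genideal type_ring S +>\<^bsub>type_ring\<^esub> x) \<oplus>\<^bsub>type_ring Quot genideal type_ring S\<^esub> (genideal type_ring S +>\<^bsub>type_ring\<^esub> y)
    = genideal type_ring S +>\<^bsub>type_ring\<^esub> (x + y :: 'a::ring_1)"
  using ideal.a_rcos_sum[OF ideal_gen, of x y S] by (simp add: FactRing_def)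

lemma coset_one: "\<one>\<^bsub>type_ring Quot genideal type_ring S\<^esub> = genideal type_ring S +>\<^bsub>type_ring\<^esub> (1 :: 'a::ring_1)"
  by (simp add: FactRing_def)

lemma coset_zero: "\<zero>\<^bsub>type_ring Quot genideal type_ring S\<^esub> = genideal type_ring S +>\<^bsub>type_ring\<^esub> (0 :: 'a::ring_1)"
  by (simp add: FactRing_def coset_def')

lemma coset_carrier: "carrier (type_ring Quot genideal type_ring S) = range (\<lambda>x :: 'a::ring_1. genideal type_ring S +>\<^bsub>type_ring\<^esub> x)"
  by (auto simp: FactRing_def A_RCOSETS_def' )

lemma coset_ring: "ring (type_ring Quot genideal (type_ring :: 'a::ring_1 ring) S)"
  by (rule ideal.quotient_is_ring[OF ideal_gen])

lemma coset_finsum: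
  assumes "finite A"
  shows "(\<Oplus>\<^bsub>type_ring Quot genideal type_ring S\<^esub>i\<in>A. (genideal type_ring S +>\<^bsub>type_ring\<^esub> f i))
    = genideal type_ring S +>\<^bsub>type_ring\<^esub> (\<Sum>i\<in>A. f i :: 'a::ring_1)"
proof -
  interpret Q: ring "type_ring Quot genideal (type_ring :: 'a ring) S"
    by (rule coset_ring)
  show ?thesis
    using assms
  proof (induction A)
    case (insert i A)
    then show ?case
      by (subst Q.finsum_insert) (auto simp: coset_carrier coset_add)
  qed (simp add: coset_zero)
qed

section \<open>The quotient algebras\<close>

locale uq_concrete = odd_root l h q for l h :: nat and q :: complex
begin

text \<open>The counit with scalar values inside the free algebra: a ring endomorphism that kills
  the relations, as \<open>augmentation\<close> requires. \<open>cou2\<close> plays the same role on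
  the tensor square.\<close>

definition cou :: "falg \<Rightarrow> falg" where "cou = alg_lift (\<lambda>g. scal (counit_gen g))"

definition cou2 :: "falg2 \<Rightarrow> falg2" where
  "cou2 = fr.lin (\<lambda>(u, v). scal (prod_list (map counit_gen u) * prod_list (map counit_gen v)))"

definition rels2 :: "falg2 set" where
  "rels2 = inl ` rel_ideal l q \<union> inr ` rel_ideal l q"

lemma rel_ideal2_eq: "rel_ideal2 l q = genideal type_ring rels2"
  by (simp add: rel_ideal2_def rels2_def pure_tensor_eq)

lemma relations_kill:
  fixes f :: "falg \<Rightarrow> 'b::ring_1"
  assumes "\<And>x y. f (x + y) = f x + f y" and "\<And>x y. f (x * y) = f x * f y" and "f 1 = 1"
    and "f fE ^ l = 0" "f fF ^ l = 0" "f fK ^ l = 1"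
    and "f fK * f fE = f (scal (q powi 2)) * f fE * f fK"
    and "f fK * f fF = f (scal (q powi (- 2))) * f fF * f fK"
    and "f fE * f fF - f fF * f fE = f (scal (1 / (q - inverse q))) * (f fK - f fK ^ (l - 1))"
    and "x \<in> relations l q"
  shows "f x = 0"
proof -
  have pow: "f (x ^ n) = f x ^ n" for x n
    by (induction n) (simp_all add: assms)
  have diff: "f (x - y) = f x - f y" for x y
    using assms(1)[of "x - y" y] by simp
  show ?thesis
    using assms(10) unfolding relations_def
    by (auto simp: pow diff assms(2-9))
qed

lemma relations_kill_anti:
  fixes f :: "falg \<Rightarrow> 'b::ring_1"
  assumes "\<And>x y. f (x + y) = f x + f y" and "\<And>x y. f (x * y) = f y * f x" and "f 1 = 1"
    and "f fE ^ l = 0" "f fF ^ l = 0" "f fK ^ l = 1"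
    and "f fE * f fK = f fK * f fE * f (scal (q powi 2))"
    and "f fF * f fK = f fK * f fF * f (scal (q powi (- 2)))"
    and "f fF * f fE - f fE * f fF = (f fK - f fK ^ (l - 1)) * f (scal (1 / (q - inverse q)))"
    and "x \<in> relations l q"
  shows "f x = 0"
proof -
  have pow: "f (x ^ n) = f x ^ n" for x n
    by (induction n) (simp_all add: assms power_commutes)
  have diff: "f (x - y) = f x - f y" for x y
    using assms(1)[of "x - y" y] by simp
  show ?thesis
    using assms(10) unfolding relations_def
    by (auto simp: pow diff assms(2-9) mult.assoc[symmetric])
qed

lemma cou_gens: "cou fE = 0" "cou fF = 0" "cou fK = 1" "cou (scal c) = scal c"
  by (simp_all add: cou_def alg_lift_gen alg_lift_scal)

lemma cou_add: "cou (x + y) = cou x + cou y" and cou_mult: "cou (x * y) = cou x * cou y" and cou_1: "cou 1 = 1"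
  using cou_gens(4)[of 1] by (simp_all add: cou_def alg_lift_add alg_lift_mult)

lemma cou_relations: "x \<in> relations l q \<Longrightarrow> cou x = 0"
  by (rule relations_kill[of cou])
    (simp_all add: cou_gens cou_add cou_mult cou_1 power_0_left)

sublocale A: augmentation cou "relations l q"
  by unfold_locales (simp_all add: cou_add cou_mult cou_1 cou_relations)

abbreviation pr :: "falg \<Rightarrow> falg fam" where "pr \<equiv> A.pr"

abbreviation scq :: "complex \<Rightarrow> falg fam" where "scq c \<equiv> pr (scal c)"

text \<open>The scalar has to commute with every element of the product ring, not only with the
  image of \<open>pr\<close>. It does because the augmentation fixes scalars, so that the scalar is
  a constant family.\<close>

lemma scq_central: "scq c * x = x * scq c"
proof -
  have x: "x = abs_fam (rep_fam x)"
    by (rule Quotient_abs_rep[OF Quotient_fam, symmetric])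
  have "scq c = abs_fam (\<lambda>_. scal c)"
    by (simp add: fam_of_def cou_gens cong: if_cong)
  then show ?thesis
    by (subst (1 2) x) (simp add: times_fam.abs_eq scal_comm)
qed

lemma pr_rel: "x \<in> relations l q \<Longrightarrow> pr x = 0"
  by (simp add: A.pr_eq_0_iff gen_in)

sublocale U: uq l h q scq "pr fE" "pr fF" "pr fK"
proof unfold_locales
  show "scq a * x = x * scq a" for a x
    by (rule scq_central)
  have rel: "pr (fE ^ l) = 0" "pr (fF ^ l) = 0" "pr (fK ^ l - 1) = 0"
    "pr (fK * fE - scal (q powi 2) * fE * fK) = 0" "pr (fK * fF - scal (q powi (- 2)) * fF * fK) = 0"
    "pr (fE * fF - fF * fE - scal (1 / (q - inverse q)) * (fK - fK ^ (l - 1))) = 0"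
    by (rule pr_rel, simp add: relations_def)+
  show "pr fE ^ l = 0" "pr fF ^ l = 0" "pr fK ^ l = 1"
    "pr fK * pr fE = scq (q powi 2) * pr fE * pr fK"
    "pr fK * pr fF = scq (q powi - 2) * pr fF * pr fK"
    "pr fE * pr fF - pr fF * pr fE = scq (1 / (q - inverse q)) * (pr fK - pr fK ^ (l - 1))"
    using rel by (simp_all add: A.pr_power A.pr_diff A.pr_mult A.pr_1)
qed (simp_all add: scal_add scal_mult A.pr_add A.pr_mult A.pr_1)

lemma cou2_mult: "cou2 (x * y) = cou2 x * cou2 y"
  unfolding cou2_def by (rule fr.lin_mult) (auto simp: prod_list_plus scal_mult[symmetric] mult_ac)

lemma cou2_add: "cou2 (x + y) = cou2 x + cou2 y"
  unfolding cou2_def by (rule fr.lin_add)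

lemma cou2_scal: "cou2 (scal c) = scal c"
  by (simp add: cou2_def scal_def[of c, where 'a = "generator list \<times> generator list"] zero_prod_def)
    (simp add: zero_list_def scal_def)

lemma cou2_gens:
  "cou2 (inl (gen g)) = scal (counit_gen g)" "cou2 (inr (gen g)) = scal (counit_gen g)"
  by (simp_all add: cou2_def gen_def inl_single inr_single zero_list_def)

lemma cou2_1: "cou2 1 = 1"
  using cou2_scal[of 1] by simp

lemma cou2_rels2: "x \<in> rels2 \<Longrightarrow> cou2 x = 0"
proof -
  have "cou2 (inl y) = 0" if "y \<in> rel_ideal l q" for y
  proof (rule gen_subset_kernel[where f = "\<lambda>y. cou2 (inl y)"])
    show "y \<in> genideal type_ring (relations l q)"
      using that by (simp add: rel_ideal_def)
    show "cou2 (inl s) = 0" if "s \<in> relations l q" for s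
      using that by (rule relations_kill[where f = "\<lambda>y. cou2 (inl y)", rotated -1])
        (simp_all add: inl_add inl_mult inl_scal cou2_add cou2_mult cou2_scal cou2_gens cou2_1 power_0_left)
  qed (simp_all add: inl_add inl_mult cou2_add cou2_mult)
  moreover have "cou2 (inr y) = 0" if "y \<in> rel_ideal l q" for y
  proof (rule gen_subset_kernel[where f = "\<lambda>y. cou2 (inr y)"])
    show "y \<in> genideal type_ring (relations l q)"
      using that by (simp add: rel_ideal_def)
    show "cou2 (inr s) = 0" if "s \<in> relations l q" for s
      using that by (rule relations_kill[where f = "\<lambda>y. cou2 (inr y)", rotated -1])
        (simp_all add: inr_add inr_mult inr_scal cou2_add cou2_mult cou2_scal cou2_gens cou2_1 power_0_left)
  qed (simp_all add: inr_add inr_mult cou2_add cou2_mult)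
  ultimately show "x \<in> rels2 \<Longrightarrow> cou2 x = 0"
    by (auto simp: rels2_def)
qed

sublocale A2: augmentation cou2 rels2
  by unfold_locales (simp_all add: cou2_add cou2_mult cou2_1 cou2_rels2)

abbreviation pr2 :: "falg2 \<Rightarrow> falg2 fam" where "pr2 \<equiv> A2.pr"

lemma cls_eq_iff: "cls l q x = cls l q y \<longleftrightarrow> pr x = pr y"
  by (simp add: cls_def rel_ideal_def coset_eq_iff A.pr_eq_iff)

lemma cls2_eq_iff: "cls2 l q x = cls2 l q y \<longleftrightarrow> pr2 x = pr2 y"
  by (simp add: cls2_def rel_ideal2_eq coset_eq_iff A2.pr_eq_iff)

lemma cls_mult: "cls l q x \<otimes>\<^bsub>Uqsl2 l q\<^esub> cls l q y = cls l q (x * y)"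
  by (simp add: cls_def rel_ideal_def Uqsl2_def coset_mult)

lemma cls2_mult: "cls2 l q x \<otimes>\<^bsub>Uqsl2_tensor l q\<^esub> cls2 l q y = cls2 l q (x * y)"
  by (simp add: cls2_def rel_ideal2_eq Uqsl2_tensor_def coset_mult)

lemma cls_one: "\<one>\<^bsub>Uqsl2 l q\<^esub> = cls l q 1"
  by (simp add: cls_def rel_ideal_def Uqsl2_def coset_one)

lemma cls_carrier: "carrier (Uqsl2 l q) = range (cls l q)"
  by (simp add: cls_def[abs_def] rel_ideal_def Uqsl2_def coset_carrier)

lemma cls_finsum: "finite A \<Longrightarrow> (\<Oplus>\<^bsub>Uqsl2 l q\<^esub>i\<in>A. cls l q (f i)) = cls l q (\<Sum>i\<in>A. f i)"
  by (simp add: cls_def rel_ideal_def Uqsl2_def coset_finsum)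

lemma scale_cls: "scale l q c (cls l q x) = cls l q (scal c * x)"
  by (simp add: scale_def cls_mult)

lemma cls_inv_K: "inv\<^bsub>Uqsl2 l q\<^esub> cls l q fK = cls l q (fK ^ (l - 1))"
proof (rule monoid.inv_char)
  show "monoid (Uqsl2 l q)"
    unfolding Uqsl2_def rel_ideal_def using coset_ring by (rule ring.is_monoid)
  have "fK ^ l = fK * fK ^ (l - 1)" "fK ^ l = fK ^ (l - 1) * fK"
    by (simp_all flip: power_Suc power_Suc2)
  moreover have "cls l q (fK ^ l) = \<one>\<^bsub>Uqsl2 l q\<^esub>"
    using U.K_tor by (simp add: cls_one cls_eq_iff A.pr_power A.pr_1)
  ultimately show "cls l q fK \<otimes>\<^bsub>Uqsl2 l q\<^esub> cls l q (fK ^ (l - 1)) = \<one>\<^bsub>Uqsl2 l q\<^esub>"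
    "cls l q (fK ^ (l - 1)) \<otimes>\<^bsub>Uqsl2 l q\<^esub> cls l q fK = \<one>\<^bsub>Uqsl2 l q\<^esub>"
    by (simp_all add: cls_mult)
qed (auto simp: cls_carrier)

lemma the_elem_cls:
  assumes "\<And>y. pr y = pr x \<Longrightarrow> f y = f x"
  shows "the_elem (f ` cls l q x) = f x"
  unfolding cls_def rel_ideal_def
  by (rule the_elem_coset) (rule assms, simp add: A.pr_add A.pr_eq_0_iff)

lemma the_elem_cls2:
  assumes "\<And>y. pr2 y = pr2 x \<Longrightarrow> f y = f x"
  shows "the_elem (f ` cls2 l q x) = f x"
  unfolding cls2_def rel_ideal2_eq
  by (rule the_elem_coset) (rule assms, simp add: A2.pr_add A2.pr_eq_0_iff)

end

section \<open>The q-binomial theorem at a root of unity\<close>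

text \<open>The Gaussian binomial coefficient with parameter p, by Pascal recursion rather than as a
  quotient, because quantum factorials may vanish at a root of unity.\<close>

fun gb :: "complex \<Rightarrow> nat \<Rightarrow> nat \<Rightarrow> complex" where
  "gb p n 0 = 1"
| "gb p 0 (Suc i) = 0"
| "gb p (Suc n) (Suc i) = p ^ Suc i * gb p n (Suc i) + gb p n i"

lemma gb_gt: "n < i \<Longrightarrow> gb p n i = 0"
  by (induction p n i rule: gb.induct) auto

lemma gb_diag: "gb p n n = 1"
  by (induction n) (simp_all add: gb_gt)

text \<open>Multiplying from the left by A + B and moving A across B^i costs p^i, and the
  coefficients then obey the recursion of \<open>gb\<close>.\<close>

lemma (in central_scalars) q_binomial:
  assumes AB: "A * B = p \<cdot> (B * A)"
  shows "(A + B) ^ n = (\<Sum>i\<le>n. gb p n i \<cdot> (B ^ i * A ^ (n - i)))"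
proof (induction n)
  case (Suc n)
  have ABi: "A * B ^ i = p ^ i \<cdot> (B ^ i * A)" for i
  proof (induction i)
    case (Suc i)
    have "A * B ^ Suc i = (A * B ^ i) * B"
      by (simp only: power_Suc2 mult.assoc)
    also have "\<dots> = p ^ i \<cdot> (B ^ i * (A * B))"
      by (simp add: Suc mult.assoc)
    also have "\<dots> = p ^ Suc i \<cdot> (B ^ Suc i * A)"
      by (simp add: AB mult.assoc[symmetric] power_commutes mult.commute)
    finally show ?case .
  qed simp
  have "(A + B) ^ Suc n = (\<Sum>i\<le>n. gb p n i \<cdot> (A * B ^ i * A ^ (n - i))) + (\<Sum>i\<le>n. gb p n i \<cdot> (B ^ Suc i * A ^ (n - i)))"
  proof -
    have "(A + B) ^ Suc n = (\<Sum>i\<le>n. gb p n i \<cdot> ((A + B) * (B ^ i * A ^ (n - i))))"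
      unfolding power_Suc Suc by (simp only: sum_distrib_left mult_smul)
    then show ?thesis
      by (simp only: distrib_right scale_right_distrib sum.distrib power_Suc mult.assoc)
  qed
  also have "(\<Sum>i\<le>n. gb p n i \<cdot> (A * B ^ i * A ^ (n - i))) = (\<Sum>i\<le>Suc n. (p ^ i * gb p n i) \<cdot> (B ^ i * A ^ (Suc n - i)))"
    by (simp add: gb_gt ABi mult.assoc Suc_diff_le mult.commute)
  also have "\<dots> = A ^ Suc n + (\<Sum>i\<le>n. (p ^ Suc i * gb p n (Suc i)) \<cdot> (B ^ Suc i * A ^ (n - i)))"
    by (subst sum.atMost_Suc_shift) simp
  also have "\<dots> + (\<Sum>i\<le>n. gb p n i \<cdot> (B ^ Suc i * A ^ (n - i)))
      = A ^ Suc n + (\<Sum>i\<le>n. gb p (Suc n) (Suc i) \<cdot> (B ^ Suc i * A ^ (n - i)))"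
    by (simp add: scale_left_distrib sum.distrib add.assoc)
  also have "\<dots> = (\<Sum>i\<le>Suc n. gb p (Suc n) i \<cdot> (B ^ i * A ^ (Suc n - i)))"
    by (subst sum.atMost_Suc_shift) simp
  finally show ?case .
qed simp

text \<open>The quotient formula with the denominator cleared, so that it also holds where the
  denominator is 0.\<close>

lemma gb_closed:
  assumes "p \<noteq> 0"
  shows "gb p n i * (\<Prod>k<i. p powi (int k + 1) - 1) = (\<Prod>k<i. p powi (int n - int k) - 1)"
  using assms
proof (induction p n i rule: gb.induct)
  case (2 p i)
  have "(\<Prod>k<Suc i. p powi (int 0 - int k) - 1) = 0"
    by (intro prod_zero bexI[of _ 0]) auto
  then show ?case
    by simp
next
  case (3 p n i)
  define P where "P = (\<Prod>k<i. p powi (int n - int k) - 1)"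
  define D where "D = (\<Prod>k<i. p powi (int k + 1) - 1)"
  have IH: "gb p n (Suc i) * (D * (p powi (int i + 1) - 1)) = P * (p powi (int n - int i) - 1)" "gb p n i * D = P"
    using 3 by (simp_all add: P_def D_def)
  have "gb p (Suc n) (Suc i) * (\<Prod>k<Suc i. p powi (int k + 1) - 1)
      = p ^ Suc i * (gb p n (Suc i) * (D * (p powi (int i + 1) - 1))) + gb p n i * D * (p powi (int i + 1) - 1)"
    by (simp add: D_def algebra_simps)
  also have "\<dots> = P * (p powi (int i + 1) * (p powi (int n - int i) - 1) + (p powi (int i + 1) - 1))"
    unfolding IH using 3(3) by (simp add: power_int_add algebra_simps)
  also have "p powi (int i + 1) * (p powi (int n - int i) - 1) + (p powi (int i + 1) - 1) = p powi (int (Suc n)) - 1"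
    using 3(3) by (simp add: right_diff_distrib power_int_add[symmetric] del: power_int_of_nat)
  also have "P * (p powi (int (Suc n)) - 1) = (\<Prod>k<Suc i. p powi (int (Suc n) - int k) - 1)"
    by (simp add: P_def prod.lessThan_Suc_shift del: prod.lessThan_Suc)
  finally show ?case .
qed simp

context odd_root
begin

definition bt :: "nat \<Rightarrow> complex" where
  "bt i = (- 1) ^ i * q powi (- (int i * (int i + 1)))"

lemma q2_powi: "(q powi 2) powi n = q powi (2 * n)"
  by (simp only: power_int_mult)

text \<open>On the right of \<open>gb_closed\<close> the factor k = 0 is q^(2l) - 1 = 0, while for i
  < l no factor multiplying \<open>gb\<close> on the left vanishes.\<close>

lemma gb_root:
  assumes "0 < i" "i < l"
  shows "gb (q powi 2) l i = 0"
proof -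
  have "(\<Prod>k<i. (q powi 2) powi (int l - int k) - 1) = 0"
  proof (rule prod_zero)
    have "(q powi 2) powi (int l - int 0) - 1 = 0"
      by (simp only: q2_powi of_nat_0 diff_zero mult.commute[of 2] q_powi_l) simp
    then show "\<exists>k\<in>{..<i}. (q powi 2) powi (int l - int k) - 1 = 0"
      using assms by (intro bexI[of _ 0]) simp_all
  qed simp
  moreover have "(q powi 2) powi (int k + 1) - 1 \<noteq> 0" if "k < i" for k
  proof -
    have "\<not> l dvd Suc k"
      using assms that by (intro nat_dvd_not_less) auto
    then have "\<not> int l dvd int k + 1"
      by (metis of_nat_Suc of_nat_dvd_iff add.commute)
    then show ?thesis
      by (simp only: q2_powi right_minus_eq q_powi_eq_1_iff l_dvd_double) simp
  qed
  then have "(\<Prod>k<i. (q powi 2) powi (int k + 1) - 1) \<noteq> 0"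
    by simp
  ultimately show ?thesis
    using gb_closed[of "q powi 2" l i] by (metis mult_eq_0_iff power_int_not_zero q_nz)
qed

text \<open>The inner entries of row l vanish, so the Pascal recursion ties each entry of row l - 1
  to the negative of its predecessor, up to a power of q^2; \<open>bt\<close> solves this
  recursion.\<close>

lemma gb_root': "i < l \<Longrightarrow> gb (q powi 2) (l - 1) i = bt i"
proof (induction i)
  case (Suc i)
  obtain m where l: "l = Suc m"
    using l_pos by (cases l) auto
  have "gb (q powi 2) (Suc m) (Suc i) = 0"
    using gb_root[of "Suc i"] Suc.prems by (simp only: l)
  then have "(q powi 2) ^ Suc i * gb (q powi 2) m (Suc i) = - gb (q powi 2) m i"
    by (simp add: eq_neg_iff_add_eq_0)
  then have "q powi (2 * int (Suc i)) * gb (q powi 2) m (Suc i) = - bt i"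
    using Suc l by (metis Suc_lessD diff_Suc_1 power_int_of_nat q2_powi)
  then have "q powi (- 2 * int (Suc i)) * (q powi (2 * int (Suc i)) * gb (q powi 2) m (Suc i)) = - (q powi (- 2 * int (Suc i)) * bt i)"
    by (simp only: mult_minus_right)
  then have "gb (q powi 2) m (Suc i) = - (q powi (- 2 * int (Suc i)) * bt i)"
    by (simp only: mult.assoc[symmetric] power_int_add[symmetric] q_nz simp_thms mult_minus_left add.left_inverse power_int_0_right mult_1)
  also have "\<dots> = bt (Suc i)"
    by (simp add: bt_def power_int_add[symmetric] algebra_simps del: power_int_of_nat)
  finally show ?case
    by (simp add: l)
qed (simp add: bt_def)

lemma bt_rev: "b < l \<Longrightarrow> bt (l - 1 - b) = bt b"
proof -
  assume b: "b < l"
  have "(- 1 :: complex) ^ (l - 1 - b) = (- 1) ^ b"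
    using b odd_l by (intro minus_one_power_iff[THEN trans]) (auto simp: minus_one_power_iff)
  moreover have "q powi (- (int (l - 1 - b) * (int (l - 1 - b) + 1))) = q powi (- (int b * (int b + 1)))"
  proof -
    have "int (l - 1 - b) = int l - 1 - int b"
      using b by auto
    then show ?thesis
      by (simp only: q_powi_eq_iff) (simp add: algebra_simps)
  qed
  ultimately show ?thesis
    by (simp add: bt_def)
qed

end

section \<open>The tensor square as two commuting copies of the algebra\<close>

context uq_concrete
begin

abbreviation scq2 :: "complex \<Rightarrow> falg2 fam" where "scq2 c \<equiv> pr2 (scal c)"

lemma scq2_central: "scq2 c * x = x * scq2 c"
proof -
  have x: "x = abs_fam (rep_fam x)"
    by (rule Quotient_abs_rep[OF Quotient_fam, symmetric])
  have "scq2 c = abs_fam (\<lambda>_. scal c)"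
    by (simp add: fam_of_def cou2_scal cong: if_cong)
  then show ?thesis
    by (subst (1 2) x) (simp add: times_fam.abs_eq scal_comm)
qed

lemma pr2_inl_rel: "x \<in> rel_ideal l q \<Longrightarrow> pr2 (inl x) = 0" and pr2_inr_rel: "x \<in> rel_ideal l q \<Longrightarrow> pr2 (inr x) = 0"
  unfolding A2.pr_eq_0_iff by (rule gen_in; simp add: rels2_def)+

lemma rel_ideal_relations: "x \<in> relations l q \<Longrightarrow> x \<in> rel_ideal l q"
  by (simp add: rel_ideal_def gen_in)

text \<open>Both legs share the scalars \<open>scq2\<close>, so \<open>T1.smul\<close> serves for
  elements of either leg and for mixed products.\<close>

sublocale T1: uq l h q scq2 "pr2 (inl fE)" "pr2 (inl fF)" "pr2 (inl fK)"
proof unfold_locales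
  show "scq2 a * x = x * scq2 a" for a x
    by (rule scq2_central)
  have rel: "pr2 (inl (fE ^ l)) = 0" "pr2 (inl (fF ^ l)) = 0" "pr2 (inl (fK ^ l - 1)) = 0"
    "pr2 (inl (fK * fE - (scal (q powi 2) * fE * fK))) = 0" "pr2 (inl (fK * fF - (scal (q powi (- 2)) * fF * fK))) = 0"
    "pr2 (inl (fE * fF - (fF * fE) - (scal (1 / (q - inverse q)) * (fK - fK ^ (l - 1))))) = 0"
    by (rule pr2_inl_rel, rule rel_ideal_relations, simp add: relations_def)+
  show "pr2 (inl fE) ^ l = 0" "pr2 (inl fF) ^ l = 0" "pr2 (inl fK) ^ l = 1"
    "pr2 (inl fK) * pr2 (inl fE) = scq2 (q powi 2) * pr2 (inl fE) * pr2 (inl fK)"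
    "pr2 (inl fK) * pr2 (inl fF) = scq2 (q powi - 2) * pr2 (inl fF) * pr2 (inl fK)"
    "pr2 (inl fE) * pr2 (inl fF) - pr2 (inl fF) * pr2 (inl fE) = scq2 (1 / (q - inverse q)) * (pr2 (inl fK) - pr2 (inl fK) ^ (l - 1))"
    using rel by (simp_all add: inl_diff inl_mult inl_power inl_scal A2.pr_power A2.pr_add A2.pr_diff A2.pr_mult A2.pr_1 A2.pr_uminus)
qed (simp_all add: scal_add scal_mult A2.pr_add A2.pr_mult A2.pr_1)

sublocale T2: uq l h q scq2 "pr2 (inr fE)" "pr2 (inr fF)" "pr2 (inr fK)"
proof unfold_locales
  have rel: "pr2 (inr (fE ^ l)) = 0" "pr2 (inr (fF ^ l)) = 0" "pr2 (inr (fK ^ l - 1)) = 0"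
    "pr2 (inr (fK * fE - (scal (q powi 2) * fE * fK))) = 0" "pr2 (inr (fK * fF - (scal (q powi (- 2)) * fF * fK))) = 0"
    "pr2 (inr (fE * fF - (fF * fE) - (scal (1 / (q - inverse q)) * (fK - fK ^ (l - 1))))) = 0"
    by (rule pr2_inr_rel, rule rel_ideal_relations, simp add: relations_def)+
  show "pr2 (inr fE) ^ l = 0" "pr2 (inr fF) ^ l = 0" "pr2 (inr fK) ^ l = 1"
    "pr2 (inr fK) * pr2 (inr fE) = scq2 (q powi 2) * pr2 (inr fE) * pr2 (inr fK)"
    "pr2 (inr fK) * pr2 (inr fF) = scq2 (q powi - 2) * pr2 (inr fF) * pr2 (inr fK)"
    "pr2 (inr fE) * pr2 (inr fF) - pr2 (inr fF) * pr2 (inr fE) = scq2 (1 / (q - inverse q)) * (pr2 (inr fK) - pr2 (inr fK) ^ (l - 1))"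
    using rel by (simp_all add: inr_diff inr_mult inr_power inr_scal A2.pr_power A2.pr_add A2.pr_diff A2.pr_mult A2.pr_1 A2.pr_uminus)
qed

end

lemma mult_interchange:
  fixes a b c d :: "'b::monoid_mult"
  assumes "b * c = c * b"
  shows "(a * b) * (c * d) = (a * c) * (b * d)"
proof -
  have "(a * b) * (c * d) = a * ((b * c) * d)"
    by (simp only: mult.assoc)
  then show ?thesis
    by (simp only: assms mult.assoc)
qed

lemma power_mult_commuting:
  fixes x y :: "'b::monoid_mult"
  assumes "y * x = x * y"
  shows "(x * y) ^ n = x ^ n * y ^ n"
proof (induction n)
  case (Suc n)
  have "y * x ^ n = x ^ n * y"
    by (rule power_commuting_commutes[OF assms[symmetric], symmetric])
  then show ?case
    by (simp add: Suc mult_interchange)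
qed simp

lemma sum_triple_product:
  fixes f :: "'i \<Rightarrow> 'b::semiring_0"
  shows "sum f A * sum g B * sum k C = (\<Sum>a\<in>A. \<Sum>b\<in>B. \<Sum>c\<in>C. f a * g b * k c)"
proof -
  have "sum f A * sum g B * s = (\<Sum>a\<in>A. \<Sum>b\<in>B. f a * g b * s)" for s
    by (simp only: sum_product) (simp only: sum_distrib_right)
  then have "sum f A * sum g B * sum k C = (\<Sum>a\<in>A. \<Sum>b\<in>B. f a * g b * sum k C)" .
  also have "\<dots> = (\<Sum>a\<in>A. \<Sum>b\<in>B. \<Sum>c\<in>C. f a * g b * k c)"
    by (intro sum.cong refl) (rule sum_distrib_left)
  finally show ?thesis .
qed

section \<open>The coproduct and the legs of the integral\<close>

context uq_concrete
begin

lemma pr2_commute: "pr2 (inr y) * pr2 (inl x) = pr2 (inl x) * pr2 (inr y)"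
  by (simp flip: A2.pr_mult add: inr_inl)

abbreviation "E1 \<equiv> pr2 (inl fE)"
abbreviation "F1 \<equiv> pr2 (inl fF)"
abbreviation "K1 \<equiv> pr2 (inl fK)"
abbreviation "E2 \<equiv> pr2 (inr fE)"
abbreviation "F2 \<equiv> pr2 (inr fF)"
abbreviation "K2 \<equiv> pr2 (inr fK)"

lemma T1_Kp: "T1.Kp n = pr2 (inl (fK ^ nat (n mod int l)))"
  by (simp add: T1.Kp_def inl_power A2.pr_power)

lemma Kl1: "K1 ^ (l - 1) = T1.Kp (- 1)" "K2 ^ (l - 1) = T2.Kp (- 1)"
  by (simp_all add: T1.Kp_m1 T2.Kp_m1)

definition cop :: "falg \<Rightarrow> falg2 fam" where "cop x = pr2 (alg_lift (coproduct_gen l) x)"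

lemma cop_add: "cop (x + y) = cop x + cop y" and cop_mult: "cop (x * y) = cop x * cop y" and cop_scal: "cop (scal c) = scq2 c"
  by (simp_all add: cop_def alg_lift_add alg_lift_mult alg_lift_scal A2.pr_add A2.pr_mult)

lemma cop_1: "cop 1 = 1"
  using cop_scal[of 1] by (simp add: A2.pr_1)

lemma cop_power: "cop (x ^ n) = cop x ^ n"
  by (induction n) (simp_all add: cop_1 cop_mult)

lemma cop_sum: "cop (\<Sum>i\<in>A. f i) = (\<Sum>i\<in>A. cop (f i))"
proof (induction A rule: infinite_finite_induct)
  have "cop 0 = 0"
    using cop_add[of 0 0] by simp
  then show "cop (sum f {}) = (\<Sum>i\<in>{}. cop (f i))" "infinite A \<Longrightarrow> cop (sum f A) = (\<Sum>i\<in>A. cop (f i))" for A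
    by simp_all
qed (simp_all add: cop_add)

lemma cop_gens:
  "cop fE = E1 * K2 + E2" "cop fF = T1.Kp (- 1) * F2 + F1" "cop fK = K1 * K2"
  by (simp_all add: cop_def alg_lift_gen pure_tensor_eq A2.pr_add A2.pr_mult inl_power A2.pr_power Kl1[unfolded One_nat_def] add.commute)

text \<open>The two summands of the coproduct of E commute up to q^2, as \<open>q_binomial\<close>
  requires; \<open>A2F\<close> says the same for F.\<close>

lemma A2E: "E1 * K2 * E2 = T1.smul (q powi 2) (E2 * (E1 * K2))"
proof -
  have "E1 * K2 * E2 = E1 * (T1.smul (q powi 2) (E2 * K2))"
    using T2.Kp_E[of 1 1] by (simp add: T2.Kp_1 mult.assoc)
  then show ?thesis
    by (simp add: mult.assoc[symmetric] pr2_commute)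
qed

lemma A2F: "T1.Kp (- 1) * F2 * F1 = T1.smul (q powi 2) (F1 * (T1.Kp (- 1) * F2))"
proof -
  have "T1.Kp (- 1) * F2 * F1 = T1.Kp (- 1) * F1 * F2"
    by (simp add: mult.assoc pr2_commute)
  also have "T1.Kp (- 1) * F1 = T1.smul (q powi 2) (F1 * T1.Kp (- 1))"
    using T1.Kp_F[of "- 1" 1] by simp
  finally show ?thesis
    by (simp add: mult.assoc)
qed

lemma pow_E: "(E1 * K2) ^ n = E1 ^ n * T2.Kp (int n)"
  by (simp add: power_mult_commuting pr2_commute T2.Kp_of_nat)

lemma pow_F: "(T1.Kp (- 1) * F2) ^ n = T1.Kp (- int n) * F2 ^ n"
proof -
  have "F2 * T1.Kp m = T1.Kp m * F2" for m
    by (simp add: T1_Kp pr2_commute)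
  then show ?thesis
    by (simp add: power_mult_commuting T1.Kp_pow)
qed

text \<open>Only the outer entries of row l survive, so the l-th power of a sum of two elements
  commuting up to q^2 is the sum of the l-th powers.\<close>

lemma gb_ends: "(\<Sum>i\<le>l. T1.smul (gb (q powi 2) l i) (f i)) = f 0 + f l"
proof -
  have "(\<Sum>i\<le>l. T1.smul (gb (q powi 2) l i) (f i)) = (\<Sum>i\<in>{0, l}. T1.smul (gb (q powi 2) l i) (f i))"
    by (rule sum.mono_neutral_right) (auto simp: gb_root[simplified])
  then show ?thesis
    by (simp add: gb_diag)
qed

text \<open>The nilpotency relations follow from \<open>gb_ends\<close>. The others are checked in
  normal form: letters of the first leg to the left, and K to the right of E and F within each
  leg.\<close>

lemma cop_relations: "x \<in> relations l q \<Longrightarrow> cop x = 0"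
proof (rule relations_kill[where f = cop])
  show "cop fE ^ l = 0"
    unfolding cop_gens T1.q_binomial[OF A2E] gb_ends by (simp add: pow_E T1.E_nil T2.E_nil)
  show "cop fF ^ l = 0"
    unfolding cop_gens T1.q_binomial[OF A2F] gb_ends by (simp add: pow_F T1.F_nil T2.F_nil)
  have KK: "K2 * K1 = K1 * K2" "K2 * (K1 * x) = K1 * (K2 * x)" for x
    by (simp_all add: pr2_commute mult.assoc[symmetric])
  have KKn: "(K1 * K2) ^ n = K1 ^ n * K2 ^ n" for n
    by (simp add: power_mult_commuting pr2_commute)
  show "cop fK ^ l = 1"
    by (simp add: cop_gens KKn T1.K_tor T2.K_tor)
  have C: "K2 * E1 = E1 * K2" "K2 * F1 = F1 * K2" "E2 * K1 = K1 * E2" "F2 * K1 = K1 * F2" "E2 * E1 = E1 * E2" "E2 * F1 = F1 * E2"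
      "F2 * E1 = E1 * F2" "F2 * F1 = F1 * F2"
      "F2 * T1.Kp m = T1.Kp m * F2" "E2 * T1.Kp m = T1.Kp m * E2" "K2 * T1.Kp m = T1.Kp m * K2" for m
    by (simp_all add: pr2_commute T1_Kp)
  have C': "K2 * (E1 * y) = E1 * (K2 * y)" "K2 * (F1 * y) = F1 * (K2 * y)" "E2 * (K1 * y) = K1 * (E2 * y)" "F2 * (K1 * y) = K1 * (F2 * y)" 
     "E2 * (E1 * y) = E1 * (E2 * y)" "E2 * (F1 * y) = F1 * (E2 * y)"
      "F2 * (E1 * y) = E1 * (F2 * y)" "F2 * (F1 * y) = F1 * (F2 * y)"
      "F2 * (T1.Kp m * y) = T1.Kp m * (F2 * y)" "E2 * (T1.Kp m * y) = T1.Kp m * (E2 * y)" "K2 * (T1.Kp m * y) = T1.Kp m * (K2 * y)" for m y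
    by (simp_all add: C mult.assoc[symmetric])
  have KE: "K1 * E1 = T1.smul (q powi 2) (E1 * K1)" "K2 * E2 = T1.smul (q powi 2) (E2 * K2)"
    "K1 * F1 = T1.smul (q powi (- 2)) (F1 * K1)" "K2 * F2 = T1.smul (q powi (- 2)) (F2 * K2)"
    using T1.Kp_E[of 1 1] T2.Kp_E[of 1 1] T1.Kp_F[of 1 1] T2.Kp_F[of 1 1] by (simp_all add: T1.Kp_1 T2.Kp_1)
  have KE': "K1 * (E1 * y) = T1.smul (q powi 2) (E1 * (K1 * y))" "K2 * (E2 * y) = T1.smul (q powi 2) (E2 * (K2 * y))"
    "K1 * (F1 * y) = T1.smul (q powi (- 2)) (F1 * (K1 * y))" "K2 * (F2 * y) = T1.smul (q powi (- 2)) (F2 * (K2 * y))" for y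
    by (simp_all add: KE mult.assoc[symmetric])
  have KK1: "K1 * T1.Kp (- 1) = T1.Kp (- 1) * K1"
    using T1.Kp_add[of 1 "- 1"] T1.Kp_add[of "- 1" 1] by (simp add: T1.Kp_1)
  have KK1': "K1 * (T1.Kp (- 1) * y) = T1.Kp (- 1) * (K1 * y)" for y
    by (simp add: KK1 mult.assoc[symmetric])
  show "cop fK * cop fE = cop (scal (q powi 2)) * cop fE * cop fK"
    unfolding cop_gens cop_scal T1.smul_def[symmetric] mult.assoc
    by (simp add: distrib_left distrib_right mult.assoc C C' KE KE' KK T1.scale_right_distrib)
  show "cop fK * cop fF = cop (scal (q powi - 2)) * cop fF * cop fK"
    unfolding cop_gens cop_scal T1.smul_def[symmetric] mult.assoc
    by (simp add: distrib_left distrib_right mult.assoc C C' KE KE' KK KK1' T1.scale_right_distrib)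
  define c where "c = 1 / (q - inverse q)"
  have EF1: "E1 * F1 = F1 * E1 + T1.smul c (K1 - T1.Kp (- 1))" "E2 * F2 = F2 * E2 + T1.smul c (K2 - T2.Kp (- 1))"
    using T1.EF T2.EF by (simp_all add: c_def T1.smul_def T1.Kp_m1 T2.Kp_m1 algebra_simps)
  have EF1': "E1 * (F1 * y) = F1 * (E1 * y) + T1.smul c ((K1 - T1.Kp (- 1)) * y)" for y
    by (simp add: EF1 mult.assoc[symmetric] distrib_right)
  have E1K: "T1.Kp (- 1) * E1 = T1.smul (q powi (- 2)) (E1 * T1.Kp (- 1))"
    using T1.Kp_E[of "- 1" 1] by simp
  have E1K': "T1.Kp (- 1) * (E1 * y) = T1.smul (q powi (- 2)) (E1 * (T1.Kp (- 1) * y))" for y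
    by (simp add: E1K mult.assoc[symmetric])
  have KKl: "(K1 * K2) ^ (l - 1) = T1.Kp (- 1) * T2.Kp (- 1)"
    unfolding KKn Kl1 ..
  have K11: "T1.Kp (- 1) * (K1 * y) = y" "T2.Kp (- 1) * (K2 * y) = y" for y
    using T1.Kp_cancel[of "- 1" 1 y] T2.Kp_cancel[of "- 1" 1 y] by (simp_all add: T1.Kp_1 T2.Kp_1)
  \<comment> \<open>The mixed products of E (x) K with K^(-1) (x) F cancel, as do those of 1 (x) E
    with F (x) 1. The remaining commutators contribute K (x) K - K^(-1) (x) K and K^(-1) (x) K -
    K^(-1) (x) K^(-1), up to a common factor.\<close>
  show "cop fE * cop fF - cop fF * cop fE = cop (scal (1 / (q - inverse q))) * (cop fK - cop fK ^ (l - 1))"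
    unfolding cop_gens cop_scal c_def[symmetric] KKl T1.smul_def[symmetric]
    by (simp add: distrib_left distrib_right mult.assoc C C' KE KE' KK EF1 EF1' E1K E1K' right_diff_distrib left_diff_distrib T1.scale_right_diff_distrib K11
      T1.scale_right_distrib)
qed (simp_all add: cop_add cop_mult cop_1)

lemma cop_ideal: "x \<in> rel_ideal l q \<Longrightarrow> cop x = 0"
  unfolding rel_ideal_def by (rule gen_subset_kernel[where f = cop]) (auto simp: cop_add cop_mult cop_relations)

lemma coproduct_cls: "coproduct l q (cls l q x) = cls2 l q (alg_lift (coproduct_gen l) x)"
proof -
  have "cls2 l q (alg_lift (coproduct_gen l) y) = cls2 l q (alg_lift (coproduct_gen l) x)" if "pr y = pr x" for y
  proof -
    have "cop (y - x) = 0"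
      using that by (intro cop_ideal) (simp add: rel_ideal_def A.pr_eq_iff)
    then have "cop y = cop x"
      using cop_add[of "y - x" x] by simp
    then show ?thesis
      by (simp add: cls2_eq_iff cop_def)
  qed
  then show ?thesis
    unfolding coproduct_def by (rule the_elem_cls)
qed

definition zeta :: complex where "zeta = of_real (sqrt (real l)) / (qfact q (l - 1))\<^sup>2"

definition Lam :: falg where "Lam = scal zeta * fF ^ (l - 1) * fE ^ (l - 1) * (\<Sum>j<l. fK ^ j)"

lemma Lambda_eq: "Lambda l q = cls l q Lam"
  by (simp add: Lambda_def Lam_def zeta_def)

text \<open>\<open>legL\<close> and \<open>legR\<close> are the Sweedler components of the integral:
  a and b count the letters F and E in the first leg, j is the power of the grouplike K (x) K. The
  exponent a + 1 is - (l - 1 - a) modulo l.\<close>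

definition legL :: "nat \<Rightarrow> nat \<Rightarrow> nat \<Rightarrow> falg" where
  "legL a b j = fF ^ a * fK ^ (a + 1) * fE ^ b * fK ^ j"

definition legR :: "nat \<Rightarrow> nat \<Rightarrow> nat \<Rightarrow> falg" where
  "legR a b j = fF ^ (l - 1 - a) * fE ^ (l - 1 - b) * fK ^ (b + j)"

lemma cop_F_pow: "cop fF ^ (l - 1) = (\<Sum>a<l. T1.smul (bt a) (F1 ^ a * (T1.Kp (int a + 1) * F2 ^ (l - 1 - a))))"
proof -
  have "cop fF ^ (l - 1) = (\<Sum>a\<le>l - 1. T1.smul (gb (q powi 2) (l - 1) a) (F1 ^ a * (T1.Kp (- int (l - 1 - a)) * F2 ^ (l - 1 - a))))"
    unfolding cop_gens T1.q_binomial[OF A2F] pow_F ..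
  also have "{..l - 1} = {..<l}"
    using l_ge by auto
  also have "(\<Sum>a<l. T1.smul (gb (q powi 2) (l - 1) a) (F1 ^ a * (T1.Kp (- int (l - 1 - a)) * F2 ^ (l - 1 - a))))
      = (\<Sum>a<l. T1.smul (bt a) (F1 ^ a * (T1.Kp (int a + 1) * F2 ^ (l - 1 - a))))"
  proof (intro sum.cong refl)
    fix a assume "a \<in> {..<l}"
    then have a: "a < l" by simp
    have "- int (l - 1 - a) + int l = int a + 1"
      using a by auto
    then have "T1.Kp (- int (l - 1 - a)) = T1.Kp (int a + 1)"
      by (metis T1.Kp_add_l)
    then show "T1.smul (gb (q powi 2) (l - 1) a) (F1 ^ a * (T1.Kp (- int (l - 1 - a)) * F2 ^ (l - 1 - a)))
        = T1.smul (bt a) (F1 ^ a * (T1.Kp (int a + 1) * F2 ^ (l - 1 - a)))"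
      by (simp only: gb_root'[OF a])
  qed
  finally show ?thesis .
qed

lemma cop_E_pow: "cop fE ^ (l - 1) = (\<Sum>b<l. T1.smul (bt b) (E2 ^ (l - 1 - b) * (E1 ^ b * T2.Kp (int b))))"
proof -
  have "cop fE ^ (l - 1) = (\<Sum>i\<le>l - 1. T1.smul (gb (q powi 2) (l - 1) i) (E2 ^ i * (E1 ^ (l - 1 - i) * T2.Kp (int (l - 1 - i)))))"
    unfolding cop_gens T1.q_binomial[OF A2E] pow_E ..
  also have "\<dots> = (\<Sum>b<l. T1.smul (bt b) (E2 ^ (l - 1 - b) * (E1 ^ b * T2.Kp (int b))))"
  \<comment> \<open>The q-binomial theorem counts the letters E of the second leg. Reversing the
    order makes b count those of the first, and \<open>bt\<close> is symmetric under the
    reversal.\<close>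
  proof (rule sum.reindex_bij_witness[of _ "\<lambda>b. l - 1 - b" "\<lambda>i. l - 1 - i"])
    fix i assume "i \<in> {..l - 1}"
    then have i: "i < l" "l - 1 - (l - 1 - i) = i"
      using l_ge by auto
    then show "T1.smul (bt (l - 1 - i)) (E2 ^ (l - 1 - (l - 1 - i)) * (E1 ^ (l - 1 - i) * T2.Kp (int (l - 1 - i))))
      = T1.smul (gb (q powi 2) (l - 1) i) (E2 ^ i * (E1 ^ (l - 1 - i) * T2.Kp (int (l - 1 - i))))"
      by (simp only: gb_root' bt_rev i)
  qed auto
  finally show ?thesis .
qed

lemma cop_Lam:
  "cop Lam = (\<Sum>a<l. \<Sum>b<l. \<Sum>j<l. T1.smul (zeta * (bt a * bt b)) (pr2 (inl (legL a b j)) * pr2 (inr (legR a b j))))"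
proof -
  have legs: "F1 ^ a * (T1.Kp (int a + 1) * F2 ^ (l - 1 - a)) * (E2 ^ (l - 1 - b) * (E1 ^ b * T2.Kp (int b))) * (K1 * K2) ^ j
    = pr2 (inl (legL a b j)) * pr2 (inr (legR a b j))" for a b j
  proof -
    define u v w where "u = fF ^ a * fK ^ (a + 1)" and "v = fE ^ b" and "w = fK ^ j"
    define x y z where "x = fF ^ (l - 1 - a)" and "y = fE ^ (l - 1 - b)" and "z = fK ^ b"
    have "(inl fK * inr fK) ^ j = inl fK ^ j * inr fK ^ j"
      by (rule power_mult_commuting) (rule inr_inl)
    then have "(K1 * K2) ^ j = pr2 (inl w * inr w)"
      by (simp add: w_def inl_power inr_power A2.pr_mult[symmetric] A2.pr_power[symmetric])
    then have "F1 ^ a * (T1.Kp (int a + 1) * F2 ^ (l - 1 - a)) * (E2 ^ (l - 1 - b) * (E1 ^ b * T2.Kp (int b))) * (K1 * K2) ^ j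
      = pr2 (inl u * inr x * (inr y * (inl v * inr z)) * (inl w * inr w))"
      using T1.Kp_of_nat[of "a + 1"] T2.Kp_of_nat[of b]
      by (simp add: u_def v_def x_def y_def z_def A2.pr_mult A2.pr_power inl_mult inr_mult inl_power inr_power mult.assoc add.commute)
    also have "inl u * inr x * (inr y * (inl v * inr z)) * (inl w * inr w) = inl (u * v * w) * inr (x * y * (z * w))"
    proof -
      have c: "inr s * (inl t * r) = inl t * (inr s * r)" for s t r
        by (simp add: mult.assoc[symmetric] inr_inl)
      show ?thesis
        by (simp add: inl_mult inr_mult mult.assoc c inr_inl)
    qed
    finally show ?thesis
      by (simp add: legL_def legR_def u_def v_def w_def x_def y_def z_def power_add A2.pr_mult)
  qed
  have "cop Lam = T1.smul zeta (cop fF ^ (l - 1) * cop fE ^ (l - 1) * (\<Sum>j<l. (K1 * K2) ^ j))"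
    by (simp add: Lam_def cop_mult cop_scal cop_power cop_sum cop_gens(3) T1.smul_def mult.assoc)
  also have "\<dots> = (\<Sum>a<l. \<Sum>b<l. \<Sum>j<l. T1.smul (zeta * (bt a * bt b)) (F1 ^ a * (T1.Kp (int a + 1) * F2 ^ (l - 1 - a)) * (E2 ^ (l - 1 - b) * (E1 ^ b * T2.Kp (int b))) * (K1 * K2) ^ j))"
    unfolding cop_F_pow cop_E_pow sum_triple_product T1.scale_sum_right
    by (simp add: mult.commute mult.left_commute)
  finally show ?thesis
    unfolding legs .
qed

end

lemma (in central_scalars) minus_power: "(- z) ^ k = (- 1) ^ k \<cdot> z ^ k"
  using power_smul[of "- 1" z k] by simp

context uq
begin

text \<open>E K^(-1) and, in \<open>KF_pow\<close>, K F are the antipodes of E and F up to sign;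
  their powers are put in normal order.\<close>

lemma EK_pow: "(E * Kp (- 1)) ^ n = q powi (- (int n * (int n - 1))) \<cdot> (E ^ n * Kp (- int n))"
proof (induction n)
  case (Suc n)
  have "(E * Kp (- 1)) ^ Suc n = q powi (- (int n * (int n - 1))) \<cdot> (E * (Kp (- 1) * (E ^ n * Kp (- int n))))"
    by (simp add: Suc mult.assoc)
  also have "\<dots> = q powi (- (int n * (int n - 1)) - 2 * int n) \<cdot> (E ^ Suc n * Kp (- int (Suc n)))"
    by (simp add: Kp_E' Kp_add[symmetric] mult.assoc power_int_add[symmetric] del: power_int_of_nat)
  finally show ?case
    by (simp add: algebra_simps)
qed simp

lemma KF_pow: "(Kp 1 * F) ^ n = q powi (int n * (int n - 1)) \<cdot> (Kp (int n) * F ^ n)"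
proof (induction n)
  case (Suc n)
  have FK: "F * (Kp m * x) = q powi (2 * m) \<cdot> (Kp m * (F * x))" for m x
    using Kp_F'[of m 1 x] by (simp add: power_int_add[symmetric])
  have "(Kp 1 * F) ^ Suc n = q powi (int n * (int n - 1)) \<cdot> (Kp 1 * (F * (Kp (int n) * F ^ n)))"
    by (simp add: Suc mult.assoc)
  also have "\<dots> = q powi (int n * (int n - 1) + 2 * int n) \<cdot> (Kp (int (Suc n)) * F ^ Suc n)"
    by (simp add: FK Kp_cancel power_int_add[symmetric] del: power_int_of_nat)
  finally show ?case
    by (simp add: algebra_simps)
qed simp

end

context uq_concrete
begin

section \<open>Antipode, flip and bilinear extension\<close>

definition ant :: "falg \<Rightarrow> falg fam" where "ant x = pr (antialg_lift (antipode_gen l) x)"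

lemma ant_add: "ant (x + y) = ant x + ant y" and ant_mult: "ant (x * y) = ant y * ant x" and ant_scal: "ant (scal c) = scq c"
  by (simp_all add: ant_def antialg_lift_add antialg_lift_mult antialg_lift_scal A.pr_add A.pr_mult)

lemma ant_1: "ant 1 = 1"
  using ant_scal[of 1] by (simp add: A.pr_1)

lemma ant_power: "ant (x ^ n) = ant x ^ n"
  by (induction n) (simp_all add: ant_1 ant_mult power_commutes)

lemma ant_gens: "ant fE = - (pr fE * U.Kp (- 1))" "ant fF = - (U.Kp 1 * pr fF)" "ant fK = U.Kp (- 1)"
  by (simp_all add: ant_def antialg_lift_gen A.pr_uminus A.pr_mult A.pr_power U.Kp_m1 U.Kp_1)

text \<open>In the commutator relation the powers of q cancel, so the antipode sends E F and F E to
  F E and E F. The order is reversed, and so is the sign of K - K^(-1).\<close>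

lemma ant_relations: "x \<in> relations l q \<Longrightarrow> ant x = 0"
proof (rule relations_kill_anti[where f = ant])
  show "ant fE ^ l = 0" "ant fF ^ l = 0"
    by (simp_all only: ant_gens U.minus_power U.EK_pow U.KF_pow U.E_nil U.F_nil mult_zero_left mult_zero_right U.scale_zero_right)
  show "ant fK ^ l = 1"
    unfolding ant_gens U.Kp_pow using U.Kp_add_l[of "- int l"] by simp
  have KE: "U.Kp p * pr fE = U.smul (q powi (2 * p)) (pr fE * U.Kp p)" "U.Kp p * pr fF = U.smul (q powi (- 2 * p)) (pr fF * U.Kp p)" for p
    using U.Kp_E[of p 1] U.Kp_F[of p 1] by simp_all
  have KE': "U.Kp p * (pr fE * x) = U.smul (q powi (2 * p)) (pr fE * (U.Kp p * x))" "U.Kp p * (pr fF * x) = U.smul (q powi (- 2 * p)) (pr fF * (U.Kp p * x))" for p x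
    using U.Kp_E'[of p 1] U.Kp_F'[of p 1] by simp_all
  have sc: "x * ant (scal c) = U.smul c x" for x c
    by (simp add: ant_scal U.smul_def scq_central)
  have q2: "q\<^sup>2 * q powi (- 2) = 1" "q powi (- 2) * q\<^sup>2 = 1"
    by (simp_all add: power_int_minus)
  show "ant fE * ant fK = ant fK * ant fE * ant (scal (q powi 2))"
    unfolding sc ant_gens by (simp add: mult.assoc KE KE' U.Kp_add[symmetric] power_int_add[symmetric] q2)
  show "ant fF * ant fK = ant fK * ant fF * ant (scal (q powi (- 2)))"
    unfolding sc ant_gens by (simp add: mult.assoc KE KE' U.Kp_cancel U.Kp_add[symmetric] power_int_add[symmetric] q2)
  have "ant fF * ant fE = pr fF * pr fE"
    unfolding ant_gens by (simp add: mult.assoc KE KE' U.Kp_cancel U.Kp_add[symmetric] q2)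
  moreover have "ant fE * ant fF = pr fE * pr fF"
    unfolding ant_gens by (simp add: mult.assoc KE KE' U.Kp_cancel U.Kp_add[symmetric] q2)
  moreover have "ant fK - ant fK ^ (l - 1) = - (pr fK - pr fK ^ (l - 1))"
  proof -
    have "- int (l - 1) + int l = 1"
      using l_ge by auto
    then have "U.Kp (- 1 * int (l - 1)) = U.Kp 1"
      by (metis U.Kp_add_l mult_minus_left mult_1)
    then show ?thesis
      unfolding ant_gens U.Kp_pow by (simp add: U.Kp_1 U.Kp_m1)
  qed
  ultimately show "ant fF * ant fE - ant fE * ant fF = (ant fK - ant fK ^ (l - 1)) * ant (scal (1 / (q - inverse q)))"
  proof -
    have "pr fF * pr fE - pr fE * pr fF = - U.smul (1 / (q - inverse q)) (pr fK - pr fK ^ (l - 1))"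
      using U.EF by (simp add: U.smul_def algebra_simps)
    then show ?thesis
      by (simp only: sc \<open>ant fF * ant fE = _\<close> \<open>ant fE * ant fF = _\<close> \<open>ant fK - _ = _\<close> U.scale_minus_right)
  qed
qed (simp_all add: ant_add ant_mult ant_1)

lemma ant_eq: "pr x = pr y \<Longrightarrow> ant x = ant y"
proof -
  assume "pr x = pr y"
  then have "x - y \<in> genideal type_ring (relations l q)"
    by (simp add: A.pr_eq_iff)
  then have "ant (x - y) = 0"
    by (rule gen_subset_kernel[where f = ant, rotated -1]) (auto simp: ant_add ant_mult ant_relations)
  then show ?thesis
    using ant_add[of "x - y" y] by simp
qed

lemma antipode_cls: "antipode l q (cls l q x) = cls l q (antialg_lift (antipode_gen l) x)"
  unfolding antipode_def
proof (rule the_elem_cls)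
  fix y assume "pr y = pr x"
  then have "ant y = ant x"
    by (rule ant_eq)
  then show "cls l q (antialg_lift (antipode_gen l) y) = cls l q (antialg_lift (antipode_gen l) x)"
    by (simp add: cls_eq_iff ant_def)
qed

definition bil :: "(falg \<Rightarrow> falg \<Rightarrow> falg) \<Rightarrow> falg2 \<Rightarrow> falg" where
  "bil g = fr.lin (\<lambda>p. g (Poly_Mapping.single (fst p) 1) (Poly_Mapping.single (snd p) 1))"

text \<open>A bilinear map on representatives that respects the ideal in each argument. This is what
  makes the set in \<open>bilin_ext\<close> a singleton.\<close>

definition bilinear_mod :: "(falg \<Rightarrow> falg \<Rightarrow> falg) \<Rightarrow> bool" where
  "bilinear_mod g \<longleftrightarrow> (\<forall>x y z. g (x + y) z = g x z + g y z) \<and> (\<forall>x y z. g z (x + y) = g z x + g z y)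
    \<and> (\<forall>c x y. g (scal c * x) y = scal c * g x y) \<and> (\<forall>c x y. g x (scal c * y) = scal c * g x y)
    \<and> (\<forall>x y. pr x = 0 \<longrightarrow> pr (g x y) = 0) \<and> (\<forall>x y. pr y = 0 \<longrightarrow> pr (g x y) = 0)"

lemma bil_tensor:
  assumes "bilinear_mod g"
  shows "bil g (inl x * inr y) = g x y"
proof (induction x rule: poly_mapping_induct)
  case (single u a)
  show ?case
  proof (induction y rule: poly_mapping_induct)
    case (single v b)
    have "g (Poly_Mapping.single u a) (Poly_Mapping.single v b)
        = g (scal a * Poly_Mapping.single u 1) (scal b * Poly_Mapping.single v 1)"
      by (simp add: scal_single)
    also have "\<dots> = scal a * g (Poly_Mapping.single u 1) (scal b * Poly_Mapping.single v 1)"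
      using assms unfolding bilinear_mod_def by blast
    also have "g (Poly_Mapping.single u 1) (scal b * Poly_Mapping.single v 1) = scal b * g (Poly_Mapping.single u 1) (Poly_Mapping.single v 1)"
      using assms unfolding bilinear_mod_def by blast
    finally show ?case
      by (simp add: inl_inr_single bil_def scal_mult mult.assoc)
  next
    case (add y z)
    then show ?case
      using assms by (simp add: inr_add distrib_left bil_def fr.lin_add bilinear_mod_def)
  qed
next
  case (add y z)
  then show ?case
    using assms by (simp add: inl_add distrib_right bil_def fr.lin_add bilinear_mod_def)
qed

lemma bil_add: "bil g (x + y) = bil g x + bil g y" and bil_scal: "bil g (scal c * x) = scal c * bil g x"
  and bil_sum: "bil g (\<Sum>i\<in>A. f i) = (\<Sum>i\<in>A. bil g (f i))" and bil_diff: "bil g (x - y) = bil g x - bil g y"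
  by (simp_all add: bil_def fr.lin_add fr.lin_scal fr.lin_sum fr.lin_diff)

lemma bil_0 [simp]: "bil g 0 = 0"
  by (simp add: bil_def)

text \<open>By linearity the outer factors may be single pairs of words. The product is then a
  scalar multiple of a pure tensor with x inside one leg, and g sends it to 0 in the
  quotient.\<close>

lemma bil_kernel:
  assumes g: "bilinear_mod g" and x: "pr x = 0" and t: "t = inl x \<or> t = inr x"
  shows "pr (bil g (s * t * s')) = 0"
proof -
  have *: "pr (bil g (Poly_Mapping.single p c * t * Poly_Mapping.single p' c')) = 0" for p p' c c'
  proof -
    obtain u v u' v' where p: "p = (u, v)" "p' = (u', v')"
      by (cases p; cases p') auto
    define X Y X' Y' where "X = (Poly_Mapping.single u 1 :: falg)" and "Y = (Poly_Mapping.single v 1 :: falg)"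
      and "X' = (Poly_Mapping.single u' 1 :: falg)" and "Y' = (Poly_Mapping.single v' 1 :: falg)"
    have c: "inr r * (inl s * w) = inl s * (inr r * w)" for r s w
      by (simp add: mult.assoc[symmetric] inr_inl)
    have "Poly_Mapping.single p c * t * Poly_Mapping.single p' c' = scal c * (scal c' * ((inl X * inr Y) * t * (inl X' * inr Y')))"
      unfolding p single_pair[of u v] single_pair[of u' v'] X_def Y_def X'_def Y'_def
      by (simp only: mult.assoc) (metis (no_types) mult.assoc scal_comm)
    also have "(inl X * inr Y) * t * (inl X' * inr Y') = (if t = inl x then inl (X * x * X') * inr (Y * Y') else inl (X * X') * inr (Y * x * Y'))"
      using t by (auto simp: inl_mult inr_mult mult.assoc c inr_inl)
    finally have "bil g (Poly_Mapping.single p c * t * Poly_Mapping.single p' c')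
        = scal c * (scal c' * (if t = inl x then g (X * x * X') (Y * Y') else g (X * X') (Y * x * Y')))"
      by (simp add: bil_scal bil_tensor[OF g])
    then show ?thesis
      using g x by (simp add: A.pr_mult bilinear_mod_def)
  qed
  show ?thesis
  proof (induction s rule: poly_mapping_induct)
    case (single p c)
    show ?case
      by (induction s' rule: poly_mapping_induct) (simp_all add: * distrib_left bil_add A.pr_add)
  qed (simp_all add: distrib_right bil_add A.pr_add)
qed

text \<open>\<open>bil g\<close> is linear but not multiplicative, so its kernel need not be an
  ideal. The set of all t whose two-sided multiples are all sent to 0 is one, and it contains the
  generators.\<close>

lemma bil_eq:
  assumes g: "bilinear_mod g" and "pr2 t = pr2 t'"
  shows "pr (bil g t) = pr (bil g t')"
proof -
  have "genideal type_ring rels2 \<subseteq> {t. \<forall>s s'. pr (bil g (s * t * s')) = 0}"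
  proof (rule gen_subset)
    show "rels2 \<subseteq> {t. \<forall>s s'. pr (bil g (s * t * s')) = 0}"
    proof
      fix t assume "t \<in> rels2"
      then obtain x where "x \<in> rel_ideal l q" "t = inl x \<or> t = inr x"
        by (auto simp: rels2_def)
      then show "t \<in> {t. \<forall>s s'. pr (bil g (s * t * s')) = 0}"
        using bil_kernel[OF g, of x t] by (simp add: A.pr_eq_0_iff rel_ideal_def)
    qed
  next
    fix a t assume "t \<in> {t. \<forall>s s'. pr (bil g (s * t * s')) = 0}"
    then have t: "pr (bil g (s * t * s')) = 0" for s s'
      by simp
    show "a * t \<in> {t. \<forall>s s'. pr (bil g (s * t * s')) = 0}"
      using t[of "_ * a"] by (simp add: mult.assoc)
    show "t * a \<in> {t. \<forall>s s'. pr (bil g (s * t * s')) = 0}"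
      using t[of _ "a * _"] by (simp add: mult.assoc)
  qed (auto simp: distrib_left distrib_right bil_add A.pr_add A.pr_0 bil_0)
  moreover have "t - t' \<in> genideal type_ring rels2"
    using assms by (simp add: A2.pr_eq_iff)
  ultimately have "pr (bil g (1 * (t - t') * 1)) = 0"
    by blast
  then show ?thesis
    by (simp add: bil_diff A.pr_diff)
qed

lemma bilin_ext_cls2:
  assumes g: "bilinear_mod g" and f: "\<And>x y. f (cls l q x) (cls l q y) = cls l q (g x y)"
  shows "bilin_ext l q f (cls2 l q t) = cls l q (bil g t)"
proof -
  have *: "(\<Oplus>\<^bsub>Uqsl2 l q\<^esub>p\<in>Poly_Mapping.keys t. scale l q (Poly_Mapping.lookup t p)
       (f (cls l q (Poly_Mapping.single (fst p) 1)) (cls l q (Poly_Mapping.single (snd p) 1)))) = cls l q (bil g t)" for t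
    by (simp add: f scale_cls cls_finsum bil_def fr.lin_def)
  show ?thesis
    unfolding bilin_ext_def *
    by (rule the_elem_cls2) (simp only: cls_eq_iff, rule bil_eq[OF g])
qed

definition sw :: "falg2 \<Rightarrow> falg2" where "sw = Poly_Mapping.map_key prod.swap"

lemma sw_lin: "sw = fr.lin (\<lambda>(u, v). Poly_Mapping.single (v, u) 1)"
proof
  fix t
  show "sw t = fr.lin (\<lambda>(u, v). Poly_Mapping.single (v, u) 1) t"
  proof (induction t rule: poly_mapping_induct)
    case (single p c)
    obtain u v where p: "p = prod.swap (u, v)"
      by (cases p) auto
    have "inj (prod.swap :: generator list \<times> generator list \<Rightarrow> _)"
      by simp
    then show ?case
      unfolding sw_def p by (subst map_key_single) (simp_all add: scal_single)
  next
    case (add x y)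
    have "inj (prod.swap :: generator list \<times> generator list \<Rightarrow> _)"
      by simp
    then show ?case
      using add by (simp add: sw_def map_key_plus fr.lin_add)
  qed
qed

lemma sw_add: "sw (x + y) = sw x + sw y" and sw_mult: "sw (x * y) = sw x * sw y" and sw_scal: "sw (scal c) = scal c"
  and sw_sum: "sw (\<Sum>i\<in>A. f i) = (\<Sum>i\<in>A. sw (f i))"
  unfolding sw_lin
     apply (rule fr.lin_add)
    apply (rule fr.lin_mult, auto simp: mult_single)[1]
   apply (simp add: scal_def[of c] zero_prod_def mult_single)
  apply (rule fr.lin_sum)
  done

lemma sw_inl: "sw (inl x) = inr x"
proof (induction x rule: poly_mapping_induct)
  case (single u a)
  then show ?case
    by (simp add: inl_single inr_single sw_lin scal_single)
qed (simp add: inl_add inr_add sw_add)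

lemma sw_inr: "sw (inr x) = inl x"
proof (induction x rule: poly_mapping_induct)
  case (single u a)
  then show ?case
    by (simp add: inl_single inr_single sw_lin scal_single)
qed (simp add: inl_add inr_add sw_add)

lemma flip_cls2: "flip l q (cls2 l q t) = cls2 l q (sw t)"
proof -
  have "pr2 (sw y) = pr2 (sw t)" if "pr2 y = pr2 t" for y
  proof -
    have "pr2 (sw (y - t)) = 0"
    proof (rule gen_subset_kernel[where f = "\<lambda>t. pr2 (sw t)"])
      show "y - t \<in> genideal type_ring rels2"
        using that by (simp add: A2.pr_eq_iff)
      show "pr2 (sw s) = 0" if s: "s \<in> rels2" for s
      proof -
        consider x where "x \<in> rel_ideal l q" "s = inl x" | x where "x \<in> rel_ideal l q" "s = inr x"
          using s unfolding rels2_def by blast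
        then show ?thesis
          by cases (simp_all add: sw_inl sw_inr pr2_inl_rel pr2_inr_rel)
      qed
    qed (simp_all add: sw_add sw_mult A2.pr_add A2.pr_mult)
    then show ?thesis
      using sw_add[of "y - t" t] by (simp add: A2.pr_add)
  qed
  note * = this
  show ?thesis
    unfolding flip_def sw_def[symmetric] by (rule the_elem_cls2) (simp only: cls2_eq_iff, rule *)
qed

section \<open>The Higman map\<close>

lemma ant_legR:
  "ant (legR a b j) = U.Kp (- (int b + int j)) * ((- (pr fE * U.Kp (- 1))) ^ (l - 1 - b) * (- (U.Kp 1 * pr fF)) ^ (l - 1 - a))"
  by (simp only: legR_def ant_mult ant_power ant_gens U.Kp_pow mult.assoc of_nat_add mult_minus_left mult_1)

lemma pr_legL: "pr (legL a b j) = pr fF ^ a * (U.Kp (int a + 1) * (pr fE ^ b * U.Kp (int j)))"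
  using U.Kp_of_nat[of "a + 1"]
  by (simp only: legL_def A.pr_mult A.pr_power U.Kp_of_nat mult.assoc of_nat_add of_nat_1)

text \<open>The signs have total exponent 2 (l - 1) and cancel. The powers of q from the binomials
  and from the antipode combine, modulo l, to the exponent in \<open>Tau\<close>.\<close>

lemma higman_term:
  assumes "a < l" "b < l"
  shows "U.smul (bt a * bt b) (ant (legR a b j) * x * pr (legL a b j) * U.Kp (- 1))
    = U.smul (q powi (2 * int a - 2 * (int b * int b) - 4 * int b))
     (U.Kp (- int b - int j) * (pr fE ^ (l - 1 - b) * (U.Kp (int b - int a) * (pr fF ^ (l - 1 - a) * (x *
       (pr fF ^ a * (U.Kp (int a + 1) * (pr fE ^ b * U.Kp (int j - 1)))))))))"
proof -
  define n m where "n = l - 1 - b" and "m = l - 1 - a"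
  have nm: "int n = int l - 1 - int b" "int m = int l - 1 - int a"
    using assms by (auto simp: n_def m_def)
  have "(- (pr fE * U.Kp (- 1))) ^ n * (- (U.Kp 1 * pr fF)) ^ m
      = U.smul ((- 1) ^ n * (- 1) ^ m) ((pr fE * U.Kp (- 1)) ^ n * (U.Kp 1 * pr fF) ^ m)"
    by (simp only: U.minus_power U.smul_mult U.mult_smul U.scale_scale) (simp only: mult.commute)
  also have "\<dots> = U.smul ((- 1) ^ n * (- 1) ^ m * (q powi (- (int n * (int n - 1))) * q powi (int m * (int m - 1))))
      (pr fE ^ n * (U.Kp (int b - int a) * pr fF ^ m))"
    by (simp add: U.EK_pow U.KF_pow mult.assoc U.Kp_cancel nm)
  finally have "ant (legR a b j) = U.smul ((- 1) ^ n * (- 1) ^ m * (q powi (- (int n * (int n - 1))) * q powi (int m * (int m - 1))))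
      (U.Kp (- int b - int j) * (pr fE ^ n * (U.Kp (int b - int a) * pr fF ^ m)))"
    unfolding ant_legR n_def[symmetric] m_def[symmetric] by simp
  moreover have "pr (legL a b j) * U.Kp (- 1) = pr fF ^ a * (U.Kp (int a + 1) * (pr fE ^ b * U.Kp (int j - 1)))"
    unfolding pr_legL mult.assoc U.Kp_add[symmetric] by simp
  moreover have "bt a * bt b * ((- 1) ^ n * (- 1) ^ m * (q powi (- (int n * (int n - 1))) * q powi (int m * (int m - 1))))
      = q powi (2 * int a - 2 * (int b * int b) - 4 * int b)"
  proof -
    have "(- 1 :: complex) ^ a * (- 1) ^ b * ((- 1) ^ n * (- 1) ^ m) = (- 1) ^ (a + m + (b + n))"
      by (simp add: power_add)
    also have "a + m + (b + n) = 2 * (l - 1)"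
      using assms by (simp add: n_def m_def)
    finally have sign: "(- 1 :: complex) ^ a * (- 1) ^ b * ((- 1) ^ n * (- 1) ^ m) = 1"
      by (simp add: power_mult)
    have "bt a * bt b * ((- 1) ^ n * (- 1) ^ m * (q powi (- (int n * (int n - 1))) * q powi (int m * (int m - 1))))
      = ((- 1) ^ a * (- 1) ^ b * ((- 1) ^ n * (- 1) ^ m)) *
        (q powi (- (int a * (int a + 1))) * q powi (- (int b * (int b + 1))) * q powi (- (int n * (int n - 1))) * q powi (int m * (int m - 1)))"
      by (simp add: bt_def mult_ac)
    also have "\<dots> = q powi (- (int a * (int a + 1)) + - (int b * (int b + 1)) + - (int n * (int n - 1)) + int m * (int m - 1))"
      unfolding sign by (simp add: power_int_add[symmetric] del: power_int_of_nat)
    also have "\<dots> = q powi (2 * int a - 2 * (int b * int b) - 4 * int b)"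
      unfolding nm by (simp only: q_powi_eq_iff) (simp add: algebra_simps)
    finally show ?thesis .
  qed
  ultimately show ?thesis
    by (simp add: n_def m_def mult.assoc)
qed

text \<open>There are two models of the quotient, the cosets \<open>cls\<close> of the definitions
  and the ring type reached by \<open>pr\<close>. The result is stated through a representative y
  that links the two; the Radford and Drinfeld maps are treated alike.\<close>

lemma higman_cls: "\<exists>y. higman_map l q (cls l q x) = cls l q y \<and> pr y = U.smul zeta (U.Tau (pr x))"
proof -
  define g where "g a b = antialg_lift (antipode_gen l) b * x * a * fK ^ (l - 1)" for a b
  have bg: "bilinear_mod g"
  proof -
    have "pr (antialg_lift (antipode_gen l) y) = 0" if "pr y = 0" for y
      using ant_eq[of y 0] that ant_add[of 0 0] by (simp add: ant_def A.pr_0)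
    moreover have "z * (scal c * a) = scal c * (z * a)" for c :: complex and z a :: falg
      using fr.mult_smul[of z c a] by (simp add: fr.smul_def)
    ultimately show ?thesis
      unfolding bilinear_mod_def g_def
      by (auto simp: antialg_lift_add antialg_lift_mult antialg_lift_scal distrib_left distrib_right A.pr_mult mult.assoc)
  qed
  have f: "antipode l q (cls l q b) \<otimes>\<^bsub>Uqsl2 l q\<^esub> cls l q x \<otimes>\<^bsub>Uqsl2 l q\<^esub> cls l q a
       \<otimes>\<^bsub>Uqsl2 l q\<^esub> inv\<^bsub>Uqsl2 l q\<^esub> balancing l q = cls l q (g a b)" for a b
    by (simp add: antipode_cls balancing_def cls_inv_K cls_mult g_def)
  have "higman_map l q (cls l q x) = cls l q (bil g (alg_lift (coproduct_gen l) Lam))"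
    unfolding higman_map_def Lambda_eq coproduct_cls
    by (rule bilin_ext_cls2[OF bg]) (rule f)
  moreover have "pr (bil g (alg_lift (coproduct_gen l) Lam)) = U.smul zeta (U.Tau (pr x))"
  proof -
    have "pr2 (alg_lift (coproduct_gen l) Lam) = pr2 (\<Sum>a<l. \<Sum>b<l. \<Sum>j<l. scal (zeta * (bt a * bt b)) * (inl (legL a b j) * inr (legR a b j)))"
      using cop_Lam by (simp add: cop_def A2.pr_sum A2.pr_mult T1.smul_def)
    then have "pr (bil g (alg_lift (coproduct_gen l) Lam))
        = pr (bil g (\<Sum>a<l. \<Sum>b<l. \<Sum>j<l. scal (zeta * (bt a * bt b)) * (inl (legL a b j) * inr (legR a b j))))"
      by (rule bil_eq[OF bg])
    also have "\<dots> = (\<Sum>a<l. \<Sum>b<l. \<Sum>j<l. U.smul (zeta * (bt a * bt b)) (ant (legR a b j) * pr x * pr (legL a b j) * U.Kp (- 1)))"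
      by (simp add: bil_sum bil_scal bil_tensor[OF bg] A.pr_sum A.pr_mult U.smul_def g_def ant_def A.pr_power U.Kp_m1)
    also have "\<dots> = U.smul zeta (\<Sum>a<l. \<Sum>b<l. \<Sum>j<l. U.smul (bt a * bt b) (ant (legR a b j) * pr x * pr (legL a b j) * U.Kp (- 1)))"
      by (simp add: U.scale_sum_right)
    also have "\<dots> = U.smul zeta (U.Tau (pr x))"
      unfolding U.Tau_def by (intro arg_cong[where f = "U.smul zeta"] sum.cong refl higman_term) auto
    finally show ?thesis .
  qed
  ultimately show ?thesis
    by blast
qed

end

section \<open>The modules and their q-characters\<close>

text \<open>The operator sending v_n to c n times v_(n+s), or to 0 when n + s leaves the range.
  Operators of this shape are closed under products, and a trace sees only the shift s = 0.\<close>

definition band :: "nat \<Rightarrow> int \<Rightarrow> (nat \<Rightarrow> complex) \<Rightarrow> complex mat" where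
  "band r s c = mat r r (\<lambda>(i, n). if int i = int n + s then c n else 0)"

lemma band_cong: "(\<And>n. n < r \<Longrightarrow> 0 \<le> int n + s \<Longrightarrow> int n + s < int r \<Longrightarrow> c n = c' n) \<Longrightarrow> band r s c = band r s c'"
  by (rule eq_matI) (auto simp: band_def)

lemma band_mult:
  "band r s c * band r t d = band r (s + t) (\<lambda>n. if 0 \<le> int n + t \<and> int n + t < int r then c (nat (int n + t)) * d n else 0)"
proof (rule eq_matI)
  fix i n
  assume "i < dim_row (band r (s + t) (\<lambda>n. if 0 \<le> int n + t \<and> int n + t < int r then c (nat (int n + t)) * d n else 0))"
    "n < dim_col (band r (s + t) (\<lambda>n. if 0 \<le> int n + t \<and> int n + t < int r then c (nat (int n + t)) * d n else 0))"
  then have i: "i < r" "n < r"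
    by (simp_all add: band_def)
  have "(band r s c * band r t d) $$ (i, n) = (\<Sum>k<r. (if int i = int k + s then c k else 0) * (if int k = int n + t then d n else 0))"
    using i by (simp add: band_def scalar_prod_def atLeast0LessThan)
  also have "\<dots> = (\<Sum>k\<in>{k. k < r \<and> int k = int n + t}. if int i = int k + s then c k * d n else 0)"
    by (rule sum.mono_neutral_cong_right) auto
  also have "\<dots> = (if int i = int n + (s + t) then if 0 \<le> int n + t \<and> int n + t < int r then c (nat (int n + t)) * d n else 0 else 0)"
  proof (cases "0 \<le> int n + t \<and> int n + t < int r")
    case True
    then have *: "{k. k < r \<and> int k = int n + t} = {nat (int n + t)}"
      by auto
    show ?thesis
      unfolding * using True by auto
  next
    case False
    then have *: "{k. k < r \<and> int k = int n + t} = {}"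
      by auto
    show ?thesis
      unfolding * using False by auto
  qed
  finally show "(band r s c * band r t d) $$ (i, n) = band r (s + t) (\<lambda>n. if 0 \<le> int n + t \<and> int n + t < int r then c (nat (int n + t)) * d n else 0) $$ (i, n)"
    using i by (simp add: band_def)
qed (simp_all add: band_def)

lemma mat_trace_band: "mat_trace (band r s c) = (if s = 0 then \<Sum>n<r. c n else 0)"
  by (simp add: mat_trace_def band_def)

lemma V_gen_carrier [simp]: "V_gen q r g \<in> carrier_mat r r"
  by (cases g) simp_all

lemma V_word_carrier [simp]: "V_word q r w \<in> carrier_mat r r"
  by (induction w) (auto simp: V_word_def intro: mult_carrier_mat[OF V_gen_carrier])

lemma V_word_dims [simp]: "dim_row (V_word q r w) = r" "dim_col (V_word q r w) = r"
  using carrier_matD[OF V_word_carrier[of q r w]] by simp_all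

lemma V_free_dims [simp]: "dim_row (V_free q r x) = r" "dim_col (V_free q r x) = r"
  by (simp_all add: V_free_def)

lemma V_word_append: "V_word q r (u @ v) = V_word q r u * V_word q r v"
proof (induction u)
  case Nil
  have "V_word q r [] = 1\<^sub>m r"
    by (simp add: V_word_def)
  then show ?case
    by (simp add: left_mult_one_mat[OF V_word_carrier])
next
  case (Cons g u)
  have "V_word q r (g # w) = V_gen q r g * V_word q r w" for w
    by (simp add: V_word_def)
  then show ?case
    using Cons by (simp add: assoc_mult_mat[OF V_gen_carrier V_word_carrier V_word_carrier])
qed

lemma V_free_carrier [simp]: "V_free q r x \<in> carrier_mat r r"
  by (simp add: V_free_def)

lemma V_free_entry: "i < r \<Longrightarrow> n < r \<Longrightarrow> V_free q r x $$ (i, n) = cs.lin (\<lambda>w. V_word q r w $$ (i, n)) x"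
  by (simp add: V_free_def cs.lin_def)

lemma V_free_single: "V_free q r (Poly_Mapping.single w c) = c \<cdot>\<^sub>m V_word q r w"
  by (intro eq_matI) (auto simp: V_free_entry)

lemma V_free_add: "V_free q r (x + y) = V_free q r x + V_free q r y"
  by (intro eq_matI) (auto simp: V_free_entry cs.lin_add)

lemma V_free_diff: "V_free q r (x - y) = V_free q r x - V_free q r y"
  by (intro eq_matI) (auto simp: V_free_entry cs.lin_diff)

lemma smult_smult_mat': "a \<cdot>\<^sub>m (b \<cdot>\<^sub>m A) = (a * b) \<cdot>\<^sub>m (A :: complex mat)"
  by (rule eq_matI) auto

lemma one_smult_mat: "1 \<cdot>\<^sub>m A = (A :: complex mat)"
  by (rule eq_matI) auto

lemma V_free_mult: "V_free q r (x * y) = V_free q r x * V_free q r y"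
proof (induction x rule: poly_mapping_induct)
  case (single u a)
  show ?case
  proof (induction y rule: poly_mapping_induct)
    case (single v b)
    show ?case
      using V_word_carrier[of q r u] V_word_carrier[of q r v]
      by (simp add: mult_single V_free_single plus_list_def V_word_append smult_smult_mat'
        mult_smult_assoc_mat[OF V_word_carrier smult_carrier_mat[OF V_word_carrier]]
        mult_smult_distrib[OF V_word_carrier V_word_carrier])
  next
    case (add y z)
    then show ?case
      by (simp add: distrib_left V_free_add mult_add_distrib_mat[OF V_free_carrier V_free_carrier V_free_carrier])
  qed
next
  case (add x z)
  then show ?case
    by (simp add: distrib_right V_free_add add_mult_distrib_mat[OF V_free_carrier V_free_carrier V_free_carrier])
qed

lemma V_free_gen: "V_free q r (gen g) = V_gen q r g"
  by (simp add: gen_def V_free_single V_word_def right_mult_one_mat[OF V_gen_carrier] one_smult_mat)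

lemma V_free_scal: "V_free q r (scal c) = c \<cdot>\<^sub>m 1\<^sub>m r"
  by (simp add: scal_def V_free_single V_word_def zero_list_def)

lemma V_free_scal_mult: "V_free q r (scal c * x) = c \<cdot>\<^sub>m V_free q r x"
  by (simp add: V_free_mult V_free_scal mult_smult_assoc_mat[OF one_carrier_mat V_free_carrier]
      left_mult_one_mat[OF V_free_carrier])

lemma V_free_1: "V_free q r 1 = 1\<^sub>m r"
  using V_free_scal[where c = 1 and q = q and r = r] by (simp add: one_smult_mat)

lemma one_band: "1\<^sub>m r = band r 0 (\<lambda>_. 1)"
  by (rule eq_matI) (auto simp: band_def)

context uq_concrete
begin

abbreviation mu :: "nat \<Rightarrow> nat \<Rightarrow> int" where "mu r n \<equiv> int r - 1 - 2 * int n"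

lemma V_E: "V_free q r (fE ^ m) = band r (- int m) (\<lambda>n. wt r n m)"
proof (induction m)
  case (Suc m)
  have E: "V_free q r fE = band r (- 1) (\<lambda>n. qi (int n) * qi (int r - int n))"
    unfolding V_free_gen by (rule eq_matI) (auto simp: band_def qint_eq of_nat_diff)
  have "V_free q r (fE ^ Suc m) = band r (- 1) (\<lambda>n. qi (int n) * qi (int r - int n)) * band r (- int m) (\<lambda>n. wt r n m)"
    by (simp add: V_free_mult E Suc)
  also have "\<dots> = band r (- 1 + - int m) (\<lambda>n. wt r n (Suc m))"
    unfolding band_mult by (rule band_cong) (auto simp: wt_def of_nat_diff nat_diff_distrib' algebra_simps)
  finally show ?case
    by simp
qed (simp add: V_free_1 one_band wt_def)

lemma V_F: "V_free q r (fF ^ m) = band r (int m) (\<lambda>_. 1)"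
proof (induction m)
  case (Suc m)
  have F: "V_free q r fF = band r 1 (\<lambda>_. 1)"
    unfolding V_free_gen by (rule eq_matI) (auto simp: band_def)
  have "V_free q r (fF ^ Suc m) = band r 1 (\<lambda>_. 1) * band r (int m) (\<lambda>_. 1)"
    by (simp add: V_free_mult F Suc)
  also have "\<dots> = band r (1 + int m) (\<lambda>_. 1)"
    unfolding band_mult by (rule band_cong) auto
  finally show ?case
    by simp
qed (simp add: V_free_1 one_band)

lemma V_K: "V_free q r (fK ^ m) = band r 0 (\<lambda>n. q powi (int m * mu r n))"
proof (induction m)
  case (Suc m)
  have K: "V_free q r fK = band r 0 (\<lambda>n. q powi (mu r n))"
    unfolding V_free_gen by (rule eq_matI) (auto simp: band_def)
  have "V_free q r (fK ^ Suc m) = band r 0 (\<lambda>n. q powi (mu r n)) * band r 0 (\<lambda>n. q powi (int m * mu r n))"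
    by (simp add: V_free_mult K Suc)
  also have "\<dots> = band r (0 + 0) (\<lambda>n. q powi (int (Suc m) * mu r n))"
    unfolding band_mult by (rule band_cong) (auto simp: power_int_add[symmetric] algebra_simps)
  finally show ?case
    by simp
qed (simp add: V_free_1 one_band)

lemma V_FKEK:
  "V_free q r (fF ^ a * fK ^ y * fE ^ b * fK ^ z) =
    band r (int a - int b) (\<lambda>n. wt r n b * q powi (int z * mu r n + int y * (mu r n + 2 * int b)))"
proof -
  have "V_free q r (fF ^ a * fK ^ y * fE ^ b * fK ^ z)
    = band r (int a + 0 + - int b + 0) (\<lambda>n. wt r n b * q powi (int z * mu r n + int y * (mu r n + 2 * int b)))"
    unfolding V_free_mult V_E V_F V_K band_mult
  proof (rule band_cong)
    fix n assume n: "n < r" "0 \<le> int n + (int a + 0 + - int b + 0)" "int n + (int a + 0 + - int b + 0) < int r"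
    show "(if 0 \<le> int n + 0 \<and> int n + 0 < int r
          then (if 0 \<le> int (nat (int n + 0)) + - int b \<and> int (nat (int n + 0)) + - int b < int r
                then (if 0 \<le> int (nat (int (nat (int n + 0)) + - int b)) + 0 \<and> int (nat (int (nat (int n + 0)) + - int b)) + 0 < int r
                      then 1 * q powi (int y * mu r (nat (int (nat (int n + 0)) + - int b))) else 0) *
                     wt r (nat (int n + 0)) b
                else 0) *
               q powi (int z * mu r n)
          else 0) =
         wt r n b * q powi (int z * mu r n + int y * (mu r n + 2 * int b))"
    proof (cases "b \<le> n")
      case True
      then show ?thesis
        using n by (simp add: of_nat_diff mult.assoc power_int_add[symmetric]) (simp add: algebra_simps)
    next
      case False
      \<comment> \<open>Here E^b kills v_n, and the stated coefficient vanishes with it, through the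
        factor i = n.\<close>
      then have "wt r n b = 0"
        unfolding wt_def by (intro prod_zero bexI[of _ n]) auto
      then show ?thesis
        by simp
    qed
  qed
  then show ?thesis
    by simp
qed

text \<open>The bound r \<le> l makes the l-th powers of E and F vanish. The commutator relation is
  \<open>qi_commutator\<close> with t = r.\<close>

lemma V_relations:
  assumes "r \<le> l" and "x \<in> relations l q"
  shows "V_free q r x = 0\<^sub>m r r"
proof -
  have E: "V_free q r fE = band r (- 1) (\<lambda>n. qi (int n) * qi (int r - int n))"
    and F: "V_free q r fF = band r 1 (\<lambda>_. 1)" and K: "V_free q r fK = band r 0 (\<lambda>n. q powi (mu r n))"
    using V_E[of r 1] V_F[of r 1] V_K[of r 1] by (simp_all add: wt_def)
  have z: "band r s c = 0\<^sub>m r r" if "\<And>n. n < r \<Longrightarrow> 0 \<le> int n + s \<Longrightarrow> int n + s < int r \<Longrightarrow> c n = 0" for s c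
    using that by (intro eq_matI) (auto simp: band_def)
  have sc: "c \<cdot>\<^sub>m band r s f = band r s (\<lambda>n. c * f n)" for c s f
    by (rule eq_matI) (auto simp: band_def)
  have diff: "band r s f - band r s f' = band r s (\<lambda>n. f n - f' n)" for s f f'
    by (rule eq_matI) (auto simp: band_def)
  have sh: "q powi (m + 2) = q powi 2 * q powi m" "q powi (m - 2) = q powi (- 2) * q powi m" for m
    by (simp_all add: power_int_add power_int_diff power_int_minus field_simps)
  have s3: "V_free q r (scal c * x * y) = c \<cdot>\<^sub>m (V_free q r x * V_free q r y)" for c x y
    by (simp only: mult.assoc V_free_scal_mult) (simp only: V_free_mult)
  consider "x = fE ^ l" | "x = fF ^ l" | "x = fK ^ l - 1" | "x = fK * fE - scal (q powi 2) * fE * fK"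
    | "x = fK * fF - scal (q powi (-2)) * fF * fK" | "x = fE * fF - fF * fE - scal (1 / (q - inverse q)) * (fK - fK ^ (l - 1))"
    using assms(2) unfolding relations_def by blast
  then show ?thesis
  proof cases
    case 1
    have "wt r n l = 0" if "n < r" for n
      unfolding wt_def using that assms by (intro prod_zero bexI[of _ n]) auto
    then show ?thesis
      unfolding 1 V_E by (intro z) auto
  next
    case 2
    then show ?thesis
      unfolding 2 V_F using assms by (intro z) auto
  next
    case 3
    show ?thesis
      unfolding 3 V_free_diff V_K V_free_1 one_band diff by (intro z) (simp add: q_powi_l)
  next
    case 4
    have "V_free q r (fK * fE) = band r (- 1) (\<lambda>n. q powi (mu r n + 2) * (qi (int n) * qi (int r - int n)))"
      unfolding V_free_mult E K band_mult by (simp, rule band_cong) (auto simp: nat_diff_distrib' algebra_simps)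
    moreover have "V_free q r fE * V_free q r fK = band r (- 1) (\<lambda>n. q powi mu r n * (qi (int n) * qi (int r - int n)))"
      unfolding E K band_mult by (simp, rule band_cong) auto
    ultimately show ?thesis
      unfolding 4 V_free_diff s3 by (simp only: sc diff) (rule z, simp only: sh mult.assoc diff_self)
  next
    case 5
    have "V_free q r (fK * fF) = band r 1 (\<lambda>n. q powi (mu r n - 2))"
      unfolding V_free_mult F K band_mult by (simp, rule band_cong) (auto simp: nat_add_distrib algebra_simps)
    moreover have "V_free q r fF * V_free q r fK = band r 1 (\<lambda>n. q powi mu r n)"
      unfolding F K band_mult by (simp, rule band_cong) auto
    ultimately show ?thesis
      unfolding 5 V_free_diff s3 by (simp only: sc diff) (rule z, simp only: sh diff_self)
  next
    case 6
    \<comment> \<open>At n = r - 1 the vector F v_n is 0, and so is the coefficient [r - n - 1]; the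
      formula for E F thus has no exceptional last entry.\<close>
    have top: "qi (int r - (1 + int n)) = 0" if "n < r" "\<not> 1 + int n < int r" for n
    proof -
      have "int r - (1 + int n) = 0"
        using that by linarith
      then show ?thesis
        by (simp only: qi_0)
    qed
    have EF: "V_free q r (fE * fF) = band r 0 (\<lambda>n. qi (int n + 1) * qi (int r - int n - 1))"
      unfolding V_free_mult E F band_mult
      by (simp, rule band_cong) (auto simp: nat_add_distrib algebra_simps top)
    have FE: "V_free q r (fF * fE) = band r 0 (\<lambda>n. qi (int n) * qi (int r - int n))"
      unfolding V_free_mult E F band_mult
      by (simp, rule band_cong) (auto simp: not_less_eq_eq)
    have "(qi (int n + 1) * qi (int r - int n - 1) - qi (int n) * qi (int r - int n))
        - 1 / (q - inverse q) * (q powi (mu r n) - q powi (int (l - 1) * mu r n)) = 0" for n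
      using qi_commutator[of "int n" "int r"] unfolding q_powi_pred by (simp add: qi_def diff_diff_eq)
    then show ?thesis
      unfolding 6 V_free_diff V_free_scal_mult EF FE K V_K diff sc by (intro z) simp
  qed
qed

lemma V_ideal:
  assumes "r \<le> l" and "x \<in> rel_ideal l q"
  shows "V_free q r x = 0\<^sub>m r r"
proof -
  have "genideal type_ring (relations l q) \<subseteq> {x. V_free q r x = 0\<^sub>m r r}"
  proof (rule gen_subset)
    show "0 \<in> {x. V_free q r x = 0\<^sub>m r r}"
      using V_free_diff[of q r 0 0] by (simp add: minus_r_inv_mat[OF V_free_carrier])
  qed (use assms V_relations in \<open>auto simp: V_free_add V_free_mult left_mult_zero_mat[OF V_free_carrier] right_mult_zero_mat[OF V_free_carrier]\<close>)
  then show ?thesis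
    using assms by (auto simp: rel_ideal_def)
qed

definition chr :: "nat \<Rightarrow> falg \<Rightarrow> complex" where "chr r x = mat_trace (V_free q r (fK ^ (l - 1) * x))"

lemma qCh_cls: "r \<le> l \<Longrightarrow> qCh l q r (cls l q x) = chr r x"
proof -
  assume r: "r \<le> l"
  have "V_rep q r (cls l q y) = V_free q r y" for y
    unfolding V_rep_def
  proof (rule the_elem_cls)
    fix z assume "pr z = pr y"
    then have "V_free q r (z - y) = 0\<^sub>m r r"
      using r by (intro V_ideal) (simp_all add: A.pr_eq_iff rel_ideal_def)
    then have "V_free q r (z - y) + V_free q r y = V_free q r y"
      by (simp add: left_add_zero_mat[OF V_free_carrier])
    then show "V_free q r z = V_free q r y"
      by (simp flip: V_free_add)
  qed
  then show ?thesis
    by (simp add: qCh_def cls_inv_K cls_mult chr_def)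
qed

lemma mat_trace_add: "A \<in> carrier_mat r r \<Longrightarrow> B \<in> carrier_mat r r \<Longrightarrow> mat_trace (A + B) = mat_trace A + mat_trace B"
  by (auto simp: mat_trace_def sum.distrib)

lemma chr_add: "chr r (x + y) = chr r x + chr r y"
  by (simp add: chr_def distrib_left V_free_add mat_trace_add[OF V_free_carrier V_free_carrier])

lemma chr_scal: "chr r (scal c * x) = c * chr r x"
proof -
  have "fK ^ (l - 1) * (scal c * x) = scal c * (fK ^ (l - 1) * x)"
    using fr.mult_smul[of "fK ^ (l - 1)" c x] by (simp add: fr.smul_def)
  then have "chr r (scal c * x) = mat_trace (c \<cdot>\<^sub>m V_free q r (fK ^ (l - 1) * x))"
    by (simp only: chr_def V_free_scal_mult)
  also have "\<dots> = c * chr r x"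
    using V_free_carrier[of q r "fK ^ (l - 1) * x"] by (simp add: chr_def mat_trace_def sum_distrib_left)
  finally show ?thesis .
qed

lemma chr_ideal: "r \<le> l \<Longrightarrow> pr x = 0 \<Longrightarrow> chr r x = 0"
  by (simp add: chr_def V_free_mult V_ideal A.pr_eq_0_iff rel_ideal_def right_mult_zero_mat[OF V_free_carrier] mat_trace_def)

lemma chr_FKEK:
  "chr r (fF ^ a * fK ^ y * fE ^ b * fK ^ z) =
    (if a = b then \<Sum>n<r. wt r n a * q powi ((int z - 1) * mu r n + int y * (mu r n + 2 * int a)) else 0)"
proof -
  have "chr r (fF ^ a * fK ^ y * fE ^ b * fK ^ z)
      = mat_trace (band r (0 + (int a - int b)) (\<lambda>n. if 0 \<le> int n + (int a - int b) \<and> int n + (int a - int b) < int r then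
        q powi (int (l - 1) * mu r (nat (int n + (int a - int b)))) * (wt r n b * q powi (int z * mu r n + int y * (mu r n + 2 * int b))) else 0))"
    unfolding chr_def V_free_mult[of q r "fK ^ (l - 1)"] V_FKEK V_K band_mult ..
  also have "\<dots> = (if a = b then \<Sum>n<r. q powi (- mu r n) * (wt r n a * q powi (int z * mu r n + int y * (mu r n + 2 * int a))) else 0)"
    unfolding mat_trace_band q_powi_pred by simp
  also have "\<dots> = (if a = b then \<Sum>n<r. wt r n a * q powi ((int z - 1) * mu r n + int y * (mu r n + 2 * int a)) else 0)"
  proof -
    have *: "q powi (- mu r n) * (w * q powi (int z * mu r n + int y * (mu r n + 2 * int a))) = w * q powi ((int z - 1) * mu r n + int y * (mu r n + 2 * int a))" for n w
    proof -
      have "q powi (- mu r n) * q powi (int z * mu r n + int y * (mu r n + 2 * int a)) = q powi (- mu r n + (int z * mu r n + int y * (mu r n + 2 * int a)))"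
        by (rule power_int_add[symmetric]) simp
      also have "- mu r n + (int z * mu r n + int y * (mu r n + 2 * int a)) = (int z - 1) * mu r n + int y * (mu r n + 2 * int a)"
        by (simp add: algebra_simps)
      finally show ?thesis
        by (simp add: mult.left_commute)
    qed
    show ?thesis
      by (simp only: *)
  qed
  finally show ?thesis .
qed

end

section \<open>The Radford and Drinfeld maps on q-characters\<close>

context uq_concrete
begin

definition pair :: "nat \<Rightarrow> falg \<Rightarrow> falg \<Rightarrow> falg" where "pair r a b = scal (chr r a) * b"

lemma bilinear_pair: "r \<le> l \<Longrightarrow> bilinear_mod (pair r)"
proof -
  assume r: "r \<le> l"
  have "scal a * (scal b * x) = scal b * (scal a * x)" for a b :: complex and x :: falg
    using fr.scale_left_commute[of a b x] by (simp only: fr.smul_def)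
  then show ?thesis
    unfolding bilinear_mod_def pair_def
    by (intro conjI allI impI)
      (simp_all only: chr_add scal_add chr_scal scal_mult distrib_left distrib_right A.pr_mult chr_ideal[OF r] fr.sc_0
        mult.assoc A.pr_0 mult_zero_left mult_zero_right)
qed

lemma apply_left_cls2:
  assumes "r \<le> l"
  shows "apply_left l q (qCh l q r) (cls2 l q t) = cls l q (bil (pair r) t)"
  unfolding apply_left_def
  by (rule bilin_ext_cls2[OF bilinear_pair[OF assms]]) (simp add: qCh_cls[OF assms] scale_cls pair_def)

text \<open>The trace sees only a = b. Then the sign of \<open>bt a\<close> squares to 1, and its
  power of q cancels against the one from moving K^(a+1) past E^a.\<close>

lemma chr_legL:
  "bt a * bt b * chr r (legL a b j) = (if a = b then \<Sum>n<r. wt r n a * q powi ((int j + int a) * mu r n) else 0)"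
proof (cases "a = b")
  case True
  have "bt a * bt a = ((- 1) ^ a * (- 1) ^ a) * (q powi (- (int a * (int a + 1))) * q powi (- (int a * (int a + 1))))"
    by (simp only: bt_def mult_ac)
  also have "(- 1 :: complex) ^ a * (- 1) ^ a = 1"
    by (simp flip: power_mult_distrib)
  finally have "bt a * bt a * (w * q powi ((int j - 1) * mu r n + int (a + 1) * (mu r n + 2 * int a)))
      = w * q powi ((int j + int a) * mu r n)" for n w
    by (simp add: mult.left_commute[of _ w] power_int_add[symmetric] algebra_simps)
  then show ?thesis
    unfolding legL_def chr_FKEK True by (simp only: if_True sum_distrib_left simp_thms)
qed (simp only: legL_def chr_FKEK if_False mult_zero_right)

text \<open>The sum over the powers of K is a Fourier sum at the weight of v_n, shifted by a; it
  gives l times the projection onto the opposite weight.\<close>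

lemma sum_legR:
  "(\<Sum>j<l. U.smul (q powi ((int j + int a) * mu r n)) (pr (legR a a j)))
    = U.smul (of_nat l) (pr fF ^ (l - 1 - a) * (pr fE ^ (l - 1 - a) * U.e (2 * int n + 1 - int r)))"
proof -
  define G where "G m = U.smul (q powi (m * mu r n)) (U.Kp m)" for m
  have "q powi ((m + int l) * mu r n) = q powi (m * mu r n)" for m
    by (simp only: q_powi_eq_iff) (simp add: algebra_simps)
  then have "(\<Sum>j<l. G (1 * int j + int a)) = (\<Sum>j<l. G (int j))"
    by (intro sum_periodic) (simp_all add: G_def)
  also have "\<dots> = U.smul (of_nat l) (U.e (2 * int n + 1 - int r))"
  proof -
    have eq: "- mu r n = 2 * int n + 1 - int r"
      by simp
    show ?thesis
      unfolding G_def using U.sum_Kp_e[of "mu r n", unfolded eq] by (simp only: mult.commute)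
  qed
  finally have "pr fF ^ (l - 1 - a) * (pr fE ^ (l - 1 - a) * (\<Sum>j<l. G (1 * int j + int a)))
      = U.smul (of_nat l) (pr fF ^ (l - 1 - a) * (pr fE ^ (l - 1 - a) * U.e (2 * int n + 1 - int r)))"
    by simp
  moreover have "pr (legR a a j) = pr fF ^ (l - 1 - a) * (pr fE ^ (l - 1 - a) * U.Kp (int j + int a))" for j
    using U.Kp_of_nat[of "a + j"] by (simp only: legR_def A.pr_mult A.pr_power mult.assoc of_nat_add add.commute)
  ultimately show ?thesis
    by (simp add: G_def sum_distrib_left)
qed

text \<open>The factor \<open>zeta\<close> is the normalisation of the integral, and l comes from
  the Fourier sum in \<open>sum_legR\<close>.\<close>

lemma radford_cls:
  assumes r: "r \<le> l"
  shows "\<exists>y. radford_map l q (qCh l q r) = cls l q y \<and> pr y = U.smul (zeta * of_nat l) (U.Rad r)"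
proof (intro exI conjI)
  let ?y = "bil (pair r) (alg_lift (coproduct_gen l) Lam)"
  show "radford_map l q (qCh l q r) = cls l q ?y"
    by (simp add: radford_map_def Lambda_eq coproduct_cls apply_left_cls2[OF r])
  define c where "c a j n = wt r n a * q powi ((int j + int a) * mu r n)" for a j n
  have "pr2 (alg_lift (coproduct_gen l) Lam) = pr2 (\<Sum>a<l. \<Sum>b<l. \<Sum>j<l. scal (zeta * (bt a * bt b)) * (inl (legL a b j) * inr (legR a b j)))"
    using cop_Lam by (simp add: cop_def A2.pr_sum A2.pr_mult T1.smul_def)
  then have "pr ?y = pr (bil (pair r) (\<Sum>a<l. \<Sum>b<l. \<Sum>j<l. scal (zeta * (bt a * bt b)) * (inl (legL a b j) * inr (legR a b j))))"
    by (rule bil_eq[OF bilinear_pair[OF r]])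
  also have "\<dots> = (\<Sum>a<l. \<Sum>b<l. \<Sum>j<l. U.smul (zeta * (bt a * bt b * chr r (legL a b j))) (pr (legR a b j)))"
    by (simp add: bil_sum bil_scal bil_tensor[OF bilinear_pair[OF r]] A.pr_sum A.pr_mult U.smul_def pair_def scal_mult mult.assoc)
  also have "\<dots> = (\<Sum>a<l. \<Sum>b<l. if a = b then \<Sum>j<l. U.smul (zeta * (\<Sum>n<r. c a j n)) (pr (legR a a j)) else 0)"
    unfolding chr_legL c_def by (intro sum.cong refl) simp
  also have "\<dots> = (\<Sum>a<l. \<Sum>j<l. \<Sum>n<r. U.smul (zeta * c a j n) (pr (legR a a j)))"
    by (simp add: sum_distrib_left U.scale_sum_left)
  also have "\<dots> = (\<Sum>a<l. \<Sum>n<r. U.smul (zeta * wt r n a) (\<Sum>j<l. U.smul (q powi ((int j + int a) * mu r n)) (pr (legR a a j))))"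
    by (rule sum.cong[OF refl], subst sum.swap) (simp add: c_def U.scale_sum_right mult.assoc)
  also have "\<dots> = U.smul (zeta * of_nat l) (U.Rad r)"
    unfolding sum_legR U.Rad_def by (subst sum.swap) (simp add: U.scale_sum_right mult_ac)
  finally show "pr ?y = U.smul (zeta * of_nat l) (U.Rad r)" .
qed

text \<open>As 2 (h + 1) = l + 1, the congruence 2 i = v modulo l has the single solution (h + 1) v;
  the sum is reindexed to start from it.\<close>

lemma sum_indicator:
  fixes G :: "int \<Rightarrow> 'b::comm_monoid_add"
  assumes per: "\<And>n. G (n + int l) = G n"
  shows "(\<Sum>i<l. if int l dvd v - 2 * int i then G (int i) else 0) = G (int (h + 1) * v)"
proof -
  define f where "f n = (if int l dvd v - 2 * n then G n else 0)" for n
  have "int l dvd v - 2 * (n + int l) \<longleftrightarrow> int l dvd v - 2 * n" for n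
  proof -
    have "v - 2 * (n + int l) = (v - 2 * n) + int l * (- 2)"
      by simp
    then show ?thesis
      by (simp only: dvd_add_left_iff[OF dvd_triv_left])
  qed
  then have fper: "f (n + int l) = f n" for n
    by (simp add: f_def per)
  have "(\<Sum>i<l. f (int i)) = (\<Sum>i<l. f (1 * int i + int (h + 1) * v))"
    by (rule sum_periodic[symmetric]) (simp_all add: fper)
  also have "\<dots> = (\<Sum>i<l. if i = 0 then G (int (h + 1) * v) else 0)"
  proof (intro sum.cong refl)
    fix i assume i: "i \<in> {..<l}"
    have "v - 2 * (1 * int i + int (h + 1) * v) = - (2 * int i) + int l * (- v)"
      by (subst l_odd) (simp add: algebra_simps)
    moreover have "int l dvd - (2 * int i) + int l * (- v) \<longleftrightarrow> int l dvd int i"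
      by (simp only: dvd_add_left_iff[OF dvd_triv_left] dvd_minus_iff l_dvd_double)
    moreover have "int l dvd int i \<longleftrightarrow> i = 0"
      using i by (auto dest: nat_dvd_not_less)
    ultimately have "int l dvd v - 2 * (1 * int i + int (h + 1) * v) \<longleftrightarrow> i = 0"
      by (simp only:)
    then show "f (1 * int i + int (h + 1) * v) = (if i = 0 then G (int (h + 1) * v) else 0)"
      by (simp only: f_def) simp
  qed
  finally show ?thesis
    by (simp add: f_def)
qed

definition cR :: "nat \<Rightarrow> nat \<Rightarrow> nat \<Rightarrow> complex" where
  "cR m i j = (q - inverse q) ^ m / qfact q m
     * q powi (int (m * (m - 1) div 2) + 2 * int m * (int i - int j) - 2 * int i * int j)"

definition Rf :: falg2 where
  "Rf = scal (1 / of_nat l) * (\<Sum>m<l. \<Sum>i<l. \<Sum>j<l. scal (cR m i j) * ((fE ^ m * fK ^ i) \<otimes>\<^sub>f (fF ^ m * fK ^ j)))"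

lemma R_matrix_eq: "R_matrix l q = cls2 l q Rf"
  by (simp add: R_matrix_def Rf_def cR_def)

lemma Rf_sum: "Rf = (\<Sum>m<l. \<Sum>i<l. \<Sum>j<l. scal (cR m i j / of_nat l) * (inl (fE ^ m * fK ^ i) * inr (fF ^ m * fK ^ j)))"
  by (simp add: Rf_def sum_distrib_left pure_tensor_eq mult.assoc[symmetric] scal_mult[symmetric])

lemma sw_Rf: "sw Rf = (\<Sum>m<l. \<Sum>i<l. \<Sum>j<l. scal (cR m i j / of_nat l) * (inr (fE ^ m * fK ^ i) * inl (fF ^ m * fK ^ j)))"
  unfolding Rf_sum by (simp add: sw_sum sw_mult sw_scal sw_inl sw_inr)

lemma swR_R:
  "sw Rf * Rf = (\<Sum>m<l. \<Sum>i<l. \<Sum>j<l. \<Sum>m'<l. \<Sum>i'<l. \<Sum>j'<l. scal (cR m i j * cR m' i' j' / (of_nat l)\<^sup>2) *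
    (inl (fF ^ m * fK ^ j * fE ^ m' * fK ^ i') * inr (fE ^ m * fK ^ i * fF ^ m' * fK ^ j')))"
proof -
  have c: "inr s * (inl t * w) = inl t * (inr s * w)" for s t w
    by (simp add: mult.assoc[symmetric] inr_inl)
  have "(scal a * (inr x * inl y)) * (scal b * (inl z * inr w)) = scal (a * b) * (inl (y * z) * inr (x * w))" for a b :: complex and x y z w
  proof -
    have "(inr x * inl y) * (scal b * (inl z * inr w)) = scal b * (inr x * (inl y * (inl z * inr w)))"
      using fr.mult_smul[of "inr x * inl y" b "inl z * inr w"] by (simp add: fr.smul_def mult.assoc)
    then show ?thesis
      by (simp add: mult.assoc scal_mult inl_mult inr_mult c)
  qed
  note * = this
  show ?thesis
    unfolding sw_Rf sum_distrib_right
    unfolding Rf_sum sum_distrib_left *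
    by (simp add: power2_eq_square mult.assoc)
qed

lemma sum4_factor:
  fixes f :: "nat \<Rightarrow> complex" and B :: "nat \<Rightarrow> nat \<Rightarrow> falg fam"
  shows "(\<Sum>i<l. \<Sum>j<l. \<Sum>i'<l. \<Sum>j'<l. U.smul (f j' * (g i j * k j' i')) (B i j'))
    = (\<Sum>i<l. \<Sum>j'<l. U.smul (f j' * ((\<Sum>j<l. g i j) * (\<Sum>i'<l. k j' i'))) (B i j'))"
proof (rule sum.cong[OF refl])
  fix i
  have "(\<Sum>j<l. \<Sum>i'<l. \<Sum>j'<l. U.smul (f j' * (g i j * k j' i')) (B i j'))
      = (\<Sum>j<l. \<Sum>j'<l. \<Sum>i'<l. U.smul (f j' * (g i j * k j' i')) (B i j'))"
    by (rule sum.cong[OF refl], rule sum.swap)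
  also have "\<dots> = (\<Sum>j'<l. \<Sum>j<l. \<Sum>i'<l. U.smul (f j' * (g i j * k j' i')) (B i j'))"
    by (rule sum.swap)
  also have "\<dots> = (\<Sum>j'<l. U.smul (f j' * ((\<Sum>j<l. g i j) * (\<Sum>i'<l. k j' i'))) (B i j'))"
    unfolding sum_product unfolding sum_distrib_left U.scale_sum_left ..
  finally show "(\<Sum>j<l. \<Sum>i'<l. \<Sum>j'<l. U.smul (f j' * (g i j * k j' i')) (B i j'))
    = (\<Sum>j'<l. U.smul (f j' * ((\<Sum>j<l. g i j) * (\<Sum>i'<l. k j' i'))) (B i j'))" .
qed

definition aR :: "nat \<Rightarrow> complex" where
  "aR m = (q - inverse q) ^ m / qfact q m * q powi int (m * (m - 1) div 2)"

lemma cR_eq: "cR m i j = aR m * q powi (2 * int m * (int i - int j) - 2 * int i * int j)"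
proof -
  have "int (m * (m - 1) div 2) + 2 * int m * (int i - int j) - 2 * int i * int j
    = int (m * (m - 1) div 2) + (2 * int m * (int i - int j) - 2 * int i * int j)"
    by simp
  then show ?thesis
    by (simp only: cR_def aR_def power_int_add q_nz simp_thms mult.assoc)
qed

text \<open>R_21 and R each contribute \<open>aR m\<close>. Their product supplies the d^m that is
  part of \<open>X m\<close>, and the squared factorial that turns \<open>wt\<close> into Gaussian
  binomials.\<close>

lemma aR_square: "aR m * aR m = d ^ m / (qfact q m)\<^sup>2 * q powi (int m * (int m - 1))"
proof -
  have "even (m * (m - 1))"
    by (cases "even m") auto
  then have "2 * (m * (m - 1) div 2) = m * (m - 1)"
    by (rule even_two_times_div_two)
  moreover have "int (m * (m - 1)) = int m * (int m - 1)"
    by (cases m) (simp_all add: algebra_simps)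
  ultimately have e: "int (m * (m - 1) div 2) + int (m * (m - 1) div 2) = int m * (int m - 1)"
    by (metis mult_2 of_nat_add)
  have "aR m * aR m = ((q - inverse q) ^ m * (q - inverse q) ^ m) / (qfact q m * qfact q m) * (q powi int (m * (m - 1) div 2) * q powi int (m * (m - 1) div 2))"
  proof -
    have "(A / Q * P) * (A / Q * P) = (A * A) / (Q * Q) * (P * P)" for A Q P :: complex
      by simp
    then show ?thesis
      unfolding aR_def by this
  qed
  also have "q powi int (m * (m - 1) div 2) * q powi int (m * (m - 1) div 2) = q powi (int m * (int m - 1))"
    by (simp only: power_int_add[symmetric] q_nz simp_thms e)
  also have "(q - inverse q) ^ m * (q - inverse q) ^ m = d ^ m"
    by (simp add: d_def power2_eq_square power_mult_distrib)
  finally show ?thesis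
    by (simp only: power2_eq_square)
qed

text \<open>The second half of the weight, read backwards, is a descending product starting at r - n
  + m - 1.\<close>

lemma wt_qb:
  assumes "m < l"
  shows "wt r n m / (qfact q m)\<^sup>2 = qb (int n) m * qb (int r - int n + int m - 1) m"
proof -
  have "(\<Prod>i<m. qi (int r - int n + int i)) = (\<Prod>i<m. qi (int r - int n + int (m - Suc i)))"
    by (rule prod.nat_diff_reindex[symmetric])
  also have "\<dots> = (\<Prod>i<m. qi (int r - int n + int m - 1 - int i))"
    by (intro prod.cong refl arg_cong[where f = qi]) (auto simp: of_nat_diff)
  finally show ?thesis
    by (simp add: wt_def qb_def prod.distrib power2_eq_square)
qed

text \<open>Fixed are the order m and the weight v of a basis vector. The sums over j and i' are
  character sums, which force 2 i = v and 2 j' = v + 2 m modulo l. What remains is one term, with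
  K-exponent i + j' = v + m.\<close>

lemma drinfeld_block:
  "(\<Sum>i<l. \<Sum>j<l. \<Sum>i'<l. \<Sum>j'<l. U.smul (cR m i j * cR m i' j' / (of_nat l)\<^sup>2 *
      (w * q powi ((int i' - 1) * v + int j * (v + 2 * int m))))
      (pr (fE ^ m * fK ^ i * fF ^ m * fK ^ j')))
    = U.smul (aR m * aR m * w * q powi (- (int m * (v + 2 * int m)) - v)) (pr fE ^ m * (pr fF ^ m * U.Kp (v + int m)))"
proof -
  define f where "f j' = aR m * aR m * w / (of_nat l)\<^sup>2 * q powi (- 2 * int m * int j' - v)" for j' :: nat
  define g where "g i j = q powi ((v - 2 * int i) * int j)" for i j :: nat
  define k where "k j' i' = q powi ((2 * int m + v - 2 * int j') * int i')" for j' i' :: nat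
  define B where "B n = pr fE ^ m * (pr fF ^ m * U.Kp n)" for n
  have "U.smul (cR m i j * cR m i' j' / (of_nat l)\<^sup>2 * (w * q powi ((int i' - 1) * v + int j * (v + 2 * int m)))) (pr (fE ^ m * fK ^ i * fF ^ m * fK ^ j'))
    = U.smul (f j' * (g i j * k j' i')) (B (int i + int j'))" for i j i' j'
  proof -
    have "pr (fE ^ m * fK ^ i * fF ^ m * fK ^ j') = pr fE ^ m * (U.Kp (int i) * (pr fF ^ m * U.Kp (int j')))"
      by (simp only: A.pr_mult A.pr_power U.Kp_of_nat mult.assoc)
    also have "\<dots> = U.smul (q powi (- 2 * int i * int m)) (B (int i + int j'))"
      by (simp only: U.Kp_F' U.Kp_add[symmetric] U.mult_smul B_def)
    finally have 1: "pr (fE ^ m * fK ^ i * fF ^ m * fK ^ j') = U.smul (q powi (- 2 * int i * int m)) (B (int i + int j'))" .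
    have "q powi (2 * int m * (int i - int j) - 2 * int i * int j) * q powi (2 * int m * (int i' - int j') - 2 * int i' * int j')
        * q powi ((int i' - 1) * v + int j * (v + 2 * int m)) * q powi (- 2 * int i * int m)
      = q powi (- 2 * int m * int j' - v) * (g i j * k j' i')"
      unfolding g_def k_def by (simp only: power_int_add[symmetric] q_nz simp_thms) (simp add: algebra_simps)
    then have "cR m i j * cR m i' j' / (of_nat l)\<^sup>2 * (w * q powi ((int i' - 1) * v + int j * (v + 2 * int m))) * q powi (- 2 * int i * int m)
      = f j' * (g i j * k j' i')"
      unfolding cR_eq f_def by (simp add: mult_ac)
    then show ?thesis
      unfolding 1 by (simp only: U.scale_scale)
  qed
  then have "(\<Sum>i<l. \<Sum>j<l. \<Sum>i'<l. \<Sum>j'<l. U.smul (cR m i j * cR m i' j' / (of_nat l)\<^sup>2 *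
      (w * q powi ((int i' - 1) * v + int j * (v + 2 * int m))))
      (pr (fE ^ m * fK ^ i * fF ^ m * fK ^ j')))
    = (\<Sum>i<l. \<Sum>j'<l. U.smul (f j' * ((\<Sum>j<l. g i j) * (\<Sum>i'<l. k j' i'))) (B (int i + int j')))"
    by (simp only: sum4_factor)
  also have "\<dots> = (\<Sum>i<l. if int l dvd v - 2 * int i then
      (\<Sum>j'<l. if int l dvd 2 * int m + v - 2 * int j' then U.smul (aR m * aR m * w * q powi (- 2 * int m * int j' - v)) (B (int i + int j')) else 0) else 0)"
    unfolding g_def k_def sum_q_powi f_def by (intro sum.cong refl) (auto simp: power2_eq_square intro!: sum.cong)
  also have "\<dots> = (\<Sum>j'<l. if int l dvd 2 * int m + v - 2 * int j' then U.smul (aR m * aR m * w * q powi (- 2 * int m * int j' - v)) (B (int (h + 1) * v + int j')) else 0)"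
  proof (rule sum_indicator)
    have *: "B (n + int l + j) = B (n + j)" for n j
      using U.Kp_add_l[of "n + j"] by (simp add: B_def algebra_simps)
    show "(\<Sum>j'<l. if int l dvd 2 * int m + v - 2 * int j' then U.smul (aR m * aR m * w * q powi (- 2 * int m * int j' - v)) (B (n + int l + int j')) else 0)
      = (\<Sum>j'<l. if int l dvd 2 * int m + v - 2 * int j' then U.smul (aR m * aR m * w * q powi (- 2 * int m * int j' - v)) (B (n + int j')) else 0)" for n
      by (simp only: *)
  qed
  also have "\<dots> = U.smul (aR m * aR m * w * q powi (- 2 * int m * (int (h + 1) * (2 * int m + v)) - v)) (B (int (h + 1) * v + int (h + 1) * (2 * int m + v)))"
  proof (rule sum_indicator)
    fix n
    have "B (int (h + 1) * v + (n + int l)) = B (int (h + 1) * v + n)"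
      using U.Kp_add_l[of "int (h + 1) * v + n"] by (simp add: B_def add.assoc)
    moreover have "q powi (- 2 * int m * (n + int l) - v) = q powi (- 2 * int m * n - v)"
      by (simp only: q_powi_eq_iff) (simp add: algebra_simps)
    ultimately show "U.smul (aR m * aR m * w * q powi (- 2 * int m * (n + int l) - v)) (B (int (h + 1) * v + (n + int l)))
      = U.smul (aR m * aR m * w * q powi (- 2 * int m * n - v)) (B (int (h + 1) * v + n))"
      by (simp only:)
  qed
  \<comment> \<open>Multiplication by 2 (h + 1) = l + 1 is the identity modulo l; the exponent of K
    is simplified below for the same reason.\<close>
  also have "q powi (- 2 * int m * (int (h + 1) * (2 * int m + v)) - v) = q powi (- (int m * (v + 2 * int m)) - v)"
  proof -
    have "- 2 * int m * (int (h + 1) * (2 * int m + v)) - v - (- (int m * (v + 2 * int m)) - v) = int l * (- (int m * (v + 2 * int m)))"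
      by (subst l_odd) (simp add: algebra_simps)
    then show ?thesis
      by (simp only: q_powi_eq_iff dvd_triv_left)
  qed
  also have "B (int (h + 1) * v + int (h + 1) * (2 * int m + v)) = B (v + int m)"
  proof -
    have "int (h + 1) * v + int (h + 1) * (2 * int m + v) = (v + int m) + int l * (v + int m)"
      by (subst l_odd) (simp add: algebra_simps)
    then have "(int (h + 1) * v + int (h + 1) * (2 * int m + v)) mod int l = (v + int m) mod int l"
      by (simp only: mod_mult_self2)
    then show ?thesis
      unfolding B_def by (metis U.Kp_mod)
  qed
  finally show ?thesis
    by (simp only: B_def)
qed

text \<open>The trace forces the orders m and m' of the two R-matrices to agree. After the sum over
  basis vectors is moved outwards, each block is evaluated by \<open>drinfeld_block\<close>, and
  \<open>wt_qb\<close> identifies its coefficient as \<open>g\<close>.\<close>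

lemma drinfeld_cls:
  assumes r: "r \<le> l"
  shows "\<exists>y. drinfeld_map l q (qCh l q r) = cls l q y \<and> pr y = U.Del r"
proof (intro exI conjI)
  let ?y = "bil (pair r) (sw Rf * Rf)"
  show "drinfeld_map l q (qCh l q r) = cls l q ?y"
    by (simp add: drinfeld_map_def R_matrix_eq flip_cls2 cls2_mult apply_left_cls2[OF r])
  define c where "c m n i j i' j' = cR m i j * cR m i' j' / (of_nat l)\<^sup>2 * (wt r n m * q powi ((int i' - 1) * mu r n + int j * (mu r n + 2 * int m)))"
    for m n i j i' j' :: nat
  have "pr ?y = (\<Sum>m<l. \<Sum>i<l. \<Sum>j<l. \<Sum>m'<l. \<Sum>i'<l. \<Sum>j'<l.
      U.smul (cR m i j * cR m' i' j' / (of_nat l)\<^sup>2 * chr r (fF ^ m * fK ^ j * fE ^ m' * fK ^ i')) (pr (fE ^ m * fK ^ i * fF ^ m' * fK ^ j')))"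
    unfolding swR_R by (simp only: bil_sum bil_scal bil_tensor[OF bilinear_pair[OF r]] A.pr_sum A.pr_mult U.smul_def pair_def scal_mult mult.assoc)
  also have "\<dots> = (\<Sum>m<l. \<Sum>i<l. \<Sum>j<l. \<Sum>i'<l. \<Sum>j'<l. \<Sum>n<r. U.smul (c m n i j i' j') (pr (fE ^ m * fK ^ i * fF ^ m * fK ^ j')))"
  proof (rule sum.cong[OF refl], rule sum.cong[OF refl], rule sum.cong[OF refl])
    fix m i j assume m: "m \<in> {..<l}"
    have "(\<Sum>i'<l. \<Sum>j'<l. U.smul (cR m i j * cR m' i' j' / (of_nat l)\<^sup>2 * chr r (fF ^ m * fK ^ j * fE ^ m' * fK ^ i')) (pr (fE ^ m * fK ^ i * fF ^ m' * fK ^ j')))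
      = (if m = m' then \<Sum>i'<l. \<Sum>j'<l. \<Sum>n<r. U.smul (c m n i j i' j') (pr (fE ^ m * fK ^ i * fF ^ m * fK ^ j')) else 0)" for m'
      unfolding chr_FKEK by (simp add: c_def sum_distrib_left sum_divide_distrib U.scale_sum_left)
    then show "(\<Sum>m'<l. \<Sum>i'<l. \<Sum>j'<l. U.smul (cR m i j * cR m' i' j' / (of_nat l)\<^sup>2 * chr r (fF ^ m * fK ^ j * fE ^ m' * fK ^ i')) (pr (fE ^ m * fK ^ i * fF ^ m' * fK ^ j')))
      = (\<Sum>i'<l. \<Sum>j'<l. \<Sum>n<r. U.smul (c m n i j i' j') (pr (fE ^ m * fK ^ i * fF ^ m * fK ^ j')))"
      using m by simp
  qed
  also have "\<dots> = (\<Sum>m<l. \<Sum>n<r. \<Sum>i<l. \<Sum>j<l. \<Sum>i'<l. \<Sum>j'<l. U.smul (c m n i j i' j') (pr (fE ^ m * fK ^ i * fF ^ m * fK ^ j')))"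
    by (rule sum.cong[OF refl]) (simp only: sum.swap[of _ "{..<r}"])
  also have "\<dots> = (\<Sum>m<l. \<Sum>n<r. U.smul (U.g r n m) (U.X m (int r - 1 - 2 * int n + int m)))"
  proof (intro sum.cong refl)
    fix m n assume m: "m \<in> {..<l}"
    have "(\<Sum>i<l. \<Sum>j<l. \<Sum>i'<l. \<Sum>j'<l. U.smul (c m n i j i' j') (pr (fE ^ m * fK ^ i * fF ^ m * fK ^ j')))
      = U.smul (aR m * aR m * wt r n m * q powi (- (int m * (mu r n + 2 * int m)) - mu r n)) (pr fE ^ m * (pr fF ^ m * U.Kp (mu r n + int m)))"
      unfolding c_def by (rule drinfeld_block)
    also have "aR m * aR m * wt r n m * q powi (- (int m * (mu r n + 2 * int m)) - mu r n) = U.g r n m * d ^ m"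
    proof -
      have "q powi (int m * (int m - 1)) * q powi (- (int m * (mu r n + 2 * int m)) - mu r n)
        = q powi (- (int m * int m) - int m - (1 + int m) * mu r n)"
        by (simp only: power_int_add[symmetric] q_nz simp_thms) (simp add: algebra_simps)
      moreover have "aR m * aR m * wt r n m * q powi (- (int m * (mu r n + 2 * int m)) - mu r n)
        = d ^ m * (wt r n m / (qfact q m)\<^sup>2) * (q powi (int m * (int m - 1)) * q powi (- (int m * (mu r n + 2 * int m)) - mu r n))"
        unfolding aR_square by simp
      ultimately show ?thesis
        using m by (simp only: wt_qb lessThan_iff U.g_def mult_ac)
    qed
    finally show "(\<Sum>i<l. \<Sum>j<l. \<Sum>i'<l. \<Sum>j'<l. U.smul (c m n i j i' j') (pr (fE ^ m * fK ^ i * fF ^ m * fK ^ j')))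
      = U.smul (U.g r n m) (U.X m (int r - 1 - 2 * int n + int m))"
      by (simp only: U.X_def U.scale_scale)
  qed
  also have "\<dots> = U.Del r"
    unfolding U.Del_def by (rule sum.swap)
  finally show "pr ?y = U.Del r" .
qed

end

section \<open>A module on which the Casimir element is not semisimple\<close>

type_synonym pvec = "bool \<Rightarrow> nat \<Rightarrow> complex"

context uq_concrete
begin

definition Cf :: falg where "Cf = scal d * (fE * fF) + scal (inverse q) * fK + scal q * fK ^ (l - 1)"

lemma pr_ev_Cf: "pr (fr.ev Cf f) = U.ev U.Cas f"
proof (induction f)
  case (pCons a f)
  have "pr Cf = U.Cas"
    by (simp add: Cf_def U.Cas_def A.pr_add A.pr_mult A.pr_power U.smul_def U.Kp_1 U.Kp_m1)
  then show ?case
    using pCons by (simp add: fr.ev_pCons U.ev_pCons A.pr_add A.pr_mult)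
qed (simp add: A.pr_0)

end

locale proj_module = uq_concrete l h q for l h :: nat and q :: complex +
  fixes s :: nat
  assumes s_pos: "1 \<le> s" and s_less: "s < l"
begin

text \<open>The two copies have highest weights s - 1 and - s - 1. In \<open>pE\<close>, E has the
  usual coefficients [i][t - i], with t = s and t = - s.\<close>

definition pwt :: "bool \<Rightarrow> nat \<Rightarrow> int" where
  "pwt b i = (if b then - int s - 1 - 2 * int i else int s - 1 - 2 * int i)"

definition pE :: "bool \<Rightarrow> nat \<Rightarrow> complex" where
  "pE b i = (if b then qi (int i) * qi (- int s - int i) else qi (int i) * qi (int s - int i))"

text \<open>
  The projective cover of \<open>V\<^sub>s\<close> is an extension of two Verma-type modules with bases indexed by
  \<open>i < l\<close>; the flag distinguishes them, and E maps the first one partly into the second.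
\<close>

primrec pact :: "generator \<Rightarrow> pvec \<Rightarrow> pvec" where
  "pact gK v = (\<lambda>b i. q powi pwt b i * v b i)"
| "pact gF v = (\<lambda>b i. if 0 < i \<and> i < l then v b (i - 1) else 0)"
| "pact gE v = (\<lambda>b i. pE b (i + 1) * v b (i + 1)
      + (if b \<and> l - s \<le> i + 1 \<and> i < l then v False (i + 1 - (l - s)) else 0))"

definition act :: "falg \<Rightarrow> pvec \<Rightarrow> pvec" where
  "act x v = (\<lambda>b i. cs.lin (\<lambda>w. foldr pact w v b i) x)"

lemma pact_linear: "pact g (\<lambda>b i. a * v b i + c * v' b i) = (\<lambda>b i. a * pact g v b i + c * pact g v' b i)"
  by (cases g) (auto simp: fun_eq_iff algebra_simps)

lemma fold_linear: "foldr pact w (\<lambda>b i. a * v b i + c * v' b i) = (\<lambda>b i. a * foldr pact w v b i + c * foldr pact w v' b i)"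
  by (induction w) (simp_all add: pact_linear)

lemma act_single: "act (Poly_Mapping.single w c) v = (\<lambda>b i. c * foldr pact w v b i)"
  by (simp add: act_def)

lemma act_add: "act (x + y) v = (\<lambda>b i. act x v b i + act y v b i)"
  by (simp add: act_def cs.lin_add)

lemma act_diff: "act (x - y) v = (\<lambda>b i. act x v b i - act y v b i)"
  by (simp add: act_def cs.lin_diff)

lemma act_sum: "act (\<Sum>k\<in>A. f k) v = (\<lambda>b i. \<Sum>k\<in>A. act (f k) v b i)"
  by (simp add: act_def cs.lin_sum)

lemma act_linear: "act x (\<lambda>b i. a * v b i + c * v' b i) = (\<lambda>b i. a * act x v b i + c * act x v' b i)"
proof (induction x rule: poly_mapping_induct)
  case (single w k)
  show ?case
    by (simp add: act_single fold_linear algebra_simps)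
next
  case (add x y)
  then show ?case
    by (simp add: act_add fun_eq_iff algebra_simps)
qed

lemma act_scale: "act x (\<lambda>b i. a * v b i) = (\<lambda>b i. a * act x v b i)"
  using act_linear[of x a v 0] by simp

lemma act_zero: "act x (\<lambda>b i. 0) = (\<lambda>b i. 0)"
  using act_linear[of x 0 _ 0] by simp

lemma act_mult: "act (x * y) v = act x (act y v)"
proof (induction x rule: poly_mapping_induct)
  case (single u a)
  show ?case
  proof (induction y rule: poly_mapping_induct)
    case (single w c)
    have "foldr pact u (\<lambda>b i. c * foldr pact w v b i) = (\<lambda>b i. c * foldr pact u (foldr pact w v) b i)"
      using fold_linear[of u c "foldr pact w v" 0] by simp
    then show ?case
      by (simp add: mult_single act_single plus_list_def mult.assoc)
  next
    case (add y z)
    then show ?case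
      using act_linear[of "Poly_Mapping.single u a" 1 "act y v" 1 "act z v"] by (simp add: distrib_left act_add)
  qed
next
  case (add x z)
  then show ?case
    by (simp add: distrib_right act_add)
qed

lemma act_gen: "act (gen g) v = pact g v"
  by (simp add: gen_def act_single)

lemma act_scal: "act (scal c) v = (\<lambda>b i. c * v b i)"
  by (simp add: scal_def act_single zero_list_def)

lemma act_1: "act 1 v = v"
  using act_scal[of 1] by simp

lemma act_scal_mult: "act (scal c * x) v = (\<lambda>b i. c * act x v b i)"
  by (simp add: act_mult act_scal)

text \<open>Coordinates are functions on all natural numbers; the module itself consists of those
  supported below l.\<close>

definition trunc :: "pvec set" where "trunc = {v. \<forall>b i. l \<le> i \<longrightarrow> v b i = 0}"

lemma act_trunc: "v \<in> trunc \<Longrightarrow> act x v \<in> trunc"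
proof -
  assume v: "v \<in> trunc"
  have "pact g v \<in> trunc" if "v \<in> trunc" for g v
    using that by (cases g) (auto simp: trunc_def)
  then have "foldr pact w v \<in> trunc" for w
    using v by (induction w) auto
  then show ?thesis
    by (auto simp: trunc_def act_def cs.lin_def)
qed

lemma act_K: "act (fK ^ n) v = (\<lambda>b i. q powi (int n * pwt b i) * v b i)"
proof (induction n)
  case (Suc n)
  then show ?case
    by (simp add: act_mult act_gen fun_eq_iff power_int_add distrib_right mult.assoc)
qed (simp add: act_1)

lemma act_F_zero: "i < n \<Longrightarrow> act (fF ^ n) v b i = 0"
proof (induction n arbitrary: i)
  case (Suc n)
  then show ?case
    using Suc.IH[of "i - 1"] by (auto simp: act_mult act_gen)
qed simp

text \<open>A chain of applications of E breaks at index s in the first copy and at l - s in the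
  second, where \<open>pE\<close> vanishes, while the extra arrow joins the copies. The conditions
  record which coordinates are out of reach after n steps; for n = l they cover all i.\<close>

lemma act_E_zero:
  assumes v: "v \<in> trunc"
  shows "(l \<le> i + n \<or> i < s \<and> s \<le> i + n \<longrightarrow> act (fE ^ n) v False i = 0)
    \<and> (2 * l \<le> i + n + s \<or> i < l - s \<and> l \<le> i + n \<longrightarrow> act (fE ^ n) v True i = 0)"
proof (induction n arbitrary: i)
  case 0
  then show ?case
    using v s_less by (auto simp: act_1 trunc_def)
next
  case (Suc n)
  have E: "act (fE ^ Suc n) v = pact gE (act (fE ^ n) v)"
    by (simp add: act_mult act_gen)
  have ps: "pE False s = 0"
    by (simp add: pE_def)
  have pt: "pE True (l - s) = 0"
  proof -
    have "qi (- int s - int (l - s)) = 0"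
      using s_less by (subst qi_eq_0_iff) (simp add: of_nat_diff)
    then show ?thesis
      by (simp add: pE_def)
  qed
  show ?case
  proof (intro conjI impI)
    assume a: "l \<le> i + Suc n \<or> i < s \<and> s \<le> i + Suc n"
    show "act (fE ^ Suc n) v False i = 0"
    proof (cases "i + 1 = s \<and> \<not> l \<le> i + Suc n")
      case True
      then have "pE False (i + 1) = 0"
        using ps by simp
      then show ?thesis
        unfolding E pact.simps by simp
    next
      case False
      then have "l \<le> (i + 1) + n \<or> i + 1 < s \<and> s \<le> (i + 1) + n"
        using a by arith
      then have "act (fE ^ n) v False (i + 1) = 0"
        using Suc.IH[of "i + 1"] by (simp only:)
      then show ?thesis
        unfolding E pact.simps by simp
    qed
  next
    assume a: "2 * l \<le> i + Suc n + s \<or> i < l - s \<and> l \<le> i + Suc n"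
    have 1: "pE True (i + 1) * act (fE ^ n) v True (i + 1) = 0"
    proof (cases "i + 1 = l - s")
      case False
      then have "2 * l \<le> (i + 1) + n + s \<or> i + 1 < l - s \<and> l \<le> (i + 1) + n"
        using a by arith
      then have "act (fE ^ n) v True (i + 1) = 0"
        using Suc.IH[of "i + 1"] by (simp only:)
      then show ?thesis
        by simp
    next
      case True
      then show ?thesis
        by (simp only: pt mult_zero_left)
    qed
    have 2: "act (fE ^ n) v False (i + 1 - (l - s)) = 0" if "l - s \<le> i + 1"
    proof -
      have "l \<le> i + 1 - (l - s) + n \<or> i + 1 - (l - s) < s \<and> s \<le> i + 1 - (l - s) + n"
        using a that s_pos s_less by arith
      then show ?thesis
        using Suc.IH[of "i + 1 - (l - s)"] by (simp only:)
    qed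
    show "act (fE ^ Suc n) v True i = 0"
      using 1 2 unfolding E pact.simps by simp
  qed
qed

lemma act_relations:
  assumes v: "v \<in> trunc" and x: "x \<in> relations l q"
  shows "act x v = (\<lambda>b i. 0)"
proof -
  consider "x = fE ^ l" | "x = fF ^ l" | "x = fK ^ l - 1" | "x = fK * fE - scal (q powi 2) * fE * fK"
    | "x = fK * fF - scal (q powi (-2)) * fF * fK" | "x = fE * fF - fF * fE - scal (1 / (q - inverse q)) * (fK - fK ^ (l - 1))"
    using x unfolding relations_def by blast
  then show ?thesis
  proof cases
    case 1
    have "act (fE ^ l) v b i = 0" for b i
      using act_E_zero[OF v, of i l] s_less by (cases b) auto
    then show ?thesis
      by (simp add: 1 fun_eq_iff)
  next
    case 2
    have "act (fF ^ l) v b i = 0" for b i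
      using act_F_zero[of i l v b] act_trunc[OF v, of "fF ^ l"] by (cases "i < l") (auto simp: trunc_def)
    then show ?thesis
      by (simp add: 2 fun_eq_iff)
  next
    case 3
    then show ?thesis
      by (simp add: act_diff act_K act_1 q_powi_l)
  next
    case 4
    have sh: "q powi 2 * q powi (m - 2) = q powi m" for m
      by (simp add: power_int_diff)
    have w1: "pwt b (i + 1) = pwt b i - 2" for b i
      by (simp add: pwt_def)
    have w2: "q powi pwt False (i + 1 - (l - s)) = q powi (pwt True i - 2)" if "l - s \<le> i + 1" for i
    proof -
      \<comment> \<open>The extra arrow raises the weight by 2 only up to a multiple of l.\<close>
      have "pwt False (i + 1 - (l - s)) - (pwt True i - 2) = int l * 2"
        using that s_less by (simp add: pwt_def of_nat_diff)
      then show ?thesis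
        by (simp only: q_powi_eq_iff dvd_triv_left)
    qed
    have "q powi pwt b i * pact gE v b i = q powi 2 * pact gE (\<lambda>b i. q powi pwt b i * v b i) b i" for b i
    proof -
      define z where "z = q powi (pwt b i - 2)"
      have w1': "q powi pwt b (i + 1) = z"
        by (simp only: w1 z_def)
      have "pact gE (\<lambda>b i. q powi pwt b i * v b i) b i = z * pact gE v b i"
      proof (cases "b \<and> l - s \<le> i + 1 \<and> i < l")
        case True
        then have "pwt True i = pwt b i" and w2': "q powi pwt False (i + 1 - (l - s)) = q powi (pwt True i - 2)"
          using w2[of i] by simp_all
        then have w2': "q powi pwt False (i + 1 - (l - s)) = z"
          by (simp only: z_def)
        show ?thesis
          unfolding pact.simps(3) if_P[OF True] w1' w2' by (simp only: distrib_left mult.left_commute)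
      next
        case False
        show ?thesis
          unfolding pact.simps(3) if_not_P[OF False] w1' by (simp only: distrib_left mult.left_commute mult_zero_right)
      qed
      then show ?thesis
        unfolding sh[of "pwt b i", symmetric] z_def by (simp only: mult.assoc)
    qed
    then show ?thesis
      unfolding 4 act_diff mult.assoc act_mult act_scal act_gen pact.simps(1) by (simp only: diff_self)
  next
    case 5
    have sh: "q powi (- 2) * q powi (m + 2) = q powi m" for m
      by (simp add: power_int_add power_int_minus)
    have w1: "pwt b (i - 1) = pwt b i + 2" if "0 < i" for b i
      using that by (simp add: pwt_def of_nat_diff)
    have "q powi pwt b i * pact gF v b i = q powi (- 2) * pact gF (\<lambda>b i. q powi pwt b i * v b i) b i" for b i
      using w1[of i b] sh[of "pwt b i"] by (auto simp only: pact.simps split: if_splits) (auto simp: mult.assoc[symmetric])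
    then show ?thesis
      unfolding 5 act_diff mult.assoc act_mult act_scal act_gen pact.simps(1) by (simp only: diff_self)
  next
    case 6
    have z: "v b i = 0" if "l \<le> i" for b i
      using v that by (auto simp: trunc_def)
    have comm: "pE b (i + 1) - pE b i = qi (pwt b i)" for b i
      using qi_commutator[of "int i" "if b then - int s else int s"]
      by (cases b) (simp_all add: pE_def pwt_def add.commute)
    have top: "pE b l = 0" for b
    proof -
      have "qi (int l) = 0"
        by (simp add: qi_eq_0_iff)
      then show ?thesis
        by (simp add: pE_def)
    qed
    have bot: "pE b 0 = 0" for b
      by (simp add: pE_def)
    have FE: "pact gE (pact gF v) b i - pact gF (pact gE v) b i = qi (pwt b i) * v b i" for b i
    proof (cases "i < l")
      case True
      have 1: "pE b (i + 1) * pact gF v b (i + 1) = pE b (i + 1) * v b i"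
        using True top[of b] by (cases "i + 1 = l") auto
      have 2: "(if 0 < i then pE b i * v b i else 0) = pE b i * v b i"
        using bot by (cases i) auto
      \<comment> \<open>The extra arrow commutes with F, so it contributes nothing to the
        commutator.\<close>
      have 3: "(if b \<and> l - s \<le> i + 1 then pact gF v False (i + 1 - (l - s)) else 0)
          = (if 0 < i \<and> b \<and> l - s \<le> i then v False (i - (l - s)) else 0)"
        using True s_less s_pos by (auto simp: Suc_diff_le)
      have "pact gE (pact gF v) b i = pE b (i + 1) * pact gF v b (i + 1) + (if b \<and> l - s \<le> i + 1 then pact gF v False (i + 1 - (l - s)) else 0)"
        using True by (subst pact.simps(3)) simp
      moreover have "pact gF (pact gE v) b i = (if 0 < i then pE b i * v b i else 0) + (if 0 < i \<and> b \<and> l - s \<le> i then v False (i - (l - s)) else 0)"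
        using True by (subst pact.simps(2)) auto
      ultimately show ?thesis
        unfolding 1 2 3 comm[symmetric] by (simp add: algebra_simps)
    next
      case False
      then show ?thesis
        using z[of i b] by simp
    qed
    have "1 / (q - inverse q) * (q powi pwt b i - q powi (int (l - 1) * pwt b i)) = qi (pwt b i)" for b i
      unfolding q_powi_pred by (simp add: qi_def)
    then have K: "act (scal (1 / (q - inverse q)) * (fK - fK ^ (l - 1))) v = (\<lambda>b i. qi (pwt b i) * v b i)"
      unfolding act_scal_mult act_diff act_K act_gen pact.simps left_diff_distrib[symmetric]
      by (simp only: mult.assoc[symmetric])
    show ?thesis
      unfolding 6 act_diff[of _ "scal _ * _"] K
      by (simp only: act_diff act_mult act_gen FE) simp
  qed
qed

lemma act_ideal:
  assumes "pr x = 0" and "v \<in> trunc"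
  shows "act x v = (\<lambda>b i. 0)"
proof -
  have "genideal type_ring (relations l q) \<subseteq> {x. \<forall>v\<in>trunc. act x v = (\<lambda>b i. 0)}"
  proof (rule gen_subset)
    show "0 \<in> {x. \<forall>v\<in>trunc. act x v = (\<lambda>b i. 0)}"
      using act_diff[of 0 0] by simp
    fix a x assume "x \<in> {x. \<forall>v\<in>trunc. act x v = (\<lambda>b i. 0)}"
    then show "a * x \<in> {x. \<forall>v\<in>trunc. act x v = (\<lambda>b i. 0)}" "x * a \<in> {x. \<forall>v\<in>trunc. act x v = (\<lambda>b i. 0)}"
      using act_trunc by (auto simp: act_mult act_zero)
  qed (auto simp: act_relations act_add)
  then show ?thesis
    using assms by (auto simp: A.pr_eq_0_iff)
qed

text \<open>\<open>va\<close> is the highest weight vector of the first copy. \<open>vb\<close> is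
  the vector of the second copy with the same weight modulo l, which E F reaches from
  \<open>va\<close> through the extra arrow. On their span C is a Jordan block with eigenvalue
  c_s.\<close>

definition va :: pvec where "va = (\<lambda>b i. if \<not> b \<and> i = 0 then 1 else 0)"

definition vb :: pvec where "vb = (\<lambda>b i. if b \<and> i = l - s then 1 else 0)"

lemma va_trunc: "va \<in> trunc"
  by (auto simp: va_def trunc_def)

lemma act_Cf: "act Cf v = (\<lambda>b i. d * pact gE (pact gF v) b i + (inverse q * q powi pwt b i + q * q powi (- pwt b i)) * v b i)"
  unfolding Cf_def act_add act_mult act_K act_scal act_gen q_powi_pred
  by (simp only: pact.simps(1) distrib_right mult.assoc add.assoc)

lemma Cf_scalar: "inverse q * q powi m + q * q powi (- m) = cc (m - 1)"
  by (simp add: cc_def power_int_diff power_int_minus field_simps)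

lemma Cf_va: "act Cf va = (\<lambda>b i. cc (int s) * va b i + d * vb b i)"
proof (intro ext)
  fix b i
  have F: "pact gF va = (\<lambda>b i. if \<not> b \<and> i = 1 then 1 else 0)"
    using l_ge by (auto simp: va_def fun_eq_iff)
  have p1: "pE False 1 = qi 1 * qi (int s - 1)"
    by (simp add: pE_def)
  have E: "pact gE (pact gF va) b i = pE False 1 * va b i + vb b i"
  proof (cases b)
    case True
    have "(l - s \<le> i + 1 \<and> i < l \<and> i + 1 - (l - s) = 1) \<longleftrightarrow> i = l - s"
      using s_pos s_less by auto
    then show ?thesis
      unfolding F using True by (auto simp: va_def vb_def)
  next
    case False
    then show ?thesis
      unfolding F by (auto simp: va_def vb_def)
  qed
  have "d * pE False 1 + cc (pwt False 0 - 1) = cc (int s)"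
    unfolding p1 d_qi_qi using cc_minus[of "int s - 2"] by (simp add: pwt_def algebra_simps)
  then have "(d * pE False 1 + cc (pwt b i - 1)) * va b i = cc (int s) * va b i"
    by (simp add: va_def)
  then show "act Cf va b i = cc (int s) * va b i + d * vb b i"
    unfolding act_Cf E Cf_scalar by (simp add: algebra_simps)
qed

lemma Cf_vb: "act Cf vb = (\<lambda>b i. cc (int s) * vb b i)"
proof (intro ext)
  fix b i
  have F: "pact gF vb = (\<lambda>b i. if b \<and> i = l - s + 1 \<and> i < l then 1 else 0)"
    using s_less by (auto simp: vb_def fun_eq_iff)
  define k where "k = l - s"
  have k: "int k = int l - int s"
    using s_less by (simp add: k_def)
  have top: "pE True (k + 1) = 0" if "\<not> k + 1 < l"
  proof -
    have "k + 1 = l"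
      using that s_pos s_less by (simp add: k_def)
    then show ?thesis
      by (simp add: pE_def qi_eq_0_iff)
  qed
  have E: "pact gE (pact gF vb) b i = pE True (k + 1) * vb b i"
    unfolding F using top by (auto simp: vb_def k_def)
  have "d * pE True (k + 1) + cc (pwt True k - 1) = cc (int s)"
  proof -
    have "d * pE True (k + 1) = cc (int (k + 1) + (- int s - int (k + 1))) - cc (int (k + 1) - (- int s - int (k + 1)))"
      unfolding pE_def using d_qi_qi by simp
    also have "int (k + 1) - (- int s - int (k + 1)) = (2 - int s) + int l + int l"
      using k by simp
    also have "cc ((2 - int s) + int l + int l) = cc (2 - int s)"
      by (simp only: cc_add_l)
    also have "int (k + 1) + (- int s - int (k + 1)) = - int s"
      by simp
    finally have 1: "d * pE True (k + 1) = cc (int s) - cc (2 - int s)"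
      by (simp only: cc_minus)
    have "pwt True k - 1 + int l + int l = - (2 - int s)"
      using k by (simp add: pwt_def)
    then have "cc (pwt True k - 1) = cc (2 - int s)"
      by (metis cc_add_l cc_minus)
    then show ?thesis
      using 1 by simp
  qed
  then have "(d * pE True (k + 1) + cc (pwt b i - 1)) * vb b i = cc (int s) * vb b i"
    by (simp add: vb_def k_def)
  then show "act Cf vb b i = cc (int s) * vb b i"
    unfolding act_Cf E Cf_scalar by (simp add: algebra_simps)
qed

text \<open>A polynomial f of a Jordan block has f' off the diagonal; d is the off-diagonal entry of
  C.\<close>

lemma act_ev:
  "act (fr.ev Cf f) va = (\<lambda>b i. poly f (cc (int s)) * va b i + (d * poly (pderiv f) (cc (int s))) * vb b i)"
proof (induction f)
  case 0
  show ?case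
    using act_diff[of 0 0] by simp
next
  case (pCons a f)
  have "act (Cf * fr.ev Cf f) va = (\<lambda>b i. poly f (cc (int s)) * (cc (int s) * va b i + d * vb b i)
      + (d * poly (pderiv f) (cc (int s))) * (cc (int s) * vb b i))"
    unfolding act_mult pCons act_linear Cf_va Cf_vb ..
  then show ?case
    by (simp add: fr.ev_pCons act_add act_scal pderiv_pCons fun_eq_iff algebra_simps)
qed

definition ef :: "int \<Rightarrow> falg" where
  "ef j = scal (1 / of_nat l) * (\<Sum>i<l. scal (q powi (- (j * int i))) * fK ^ i)"

lemma pr_ef: "pr (ef j) = U.e j"
  by (simp add: ef_def U.e_def A.pr_mult A.pr_sum A.pr_power U.smul_def U.Kp_of_nat)

lemma act_ef: "act (ef j) va = (\<lambda>b i. (if int l dvd int s - 1 - j then 1 else 0) * va b i)"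
proof -
  have "act (ef j) va b i = (1 / of_nat l) * ((\<Sum>k<l. q powi ((int s - 1 - j) * int k)) * va b i)" for b i
  proof -
    have "q powi (- (j * int k)) * (q powi (int k * pwt b i) * va b i) = q powi ((int s - 1 - j) * int k) * va b i" for k
    proof (cases "va b i = 0")
      case False
      then have "pwt b i = int s - 1"
        by (simp add: va_def pwt_def split: if_splits)
      then have "q powi (- (j * int k)) * q powi (int k * pwt b i) = q powi ((int s - 1 - j) * int k)"
        by (simp add: power_int_add[symmetric] mult.commute right_diff_distrib)
      then show ?thesis
        by (simp add: mult.assoc[symmetric])
    qed simp
    then show ?thesis
      unfolding ef_def act_mult act_sum act_scal act_K sum_distrib_right by (simp only:)
  qed
  then show ?thesis
    by (auto simp: sum_q_powi fun_eq_iff)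
qed

text \<open>Both sides are applied to \<open>va\<close> and compared in the coordinate of
  \<open>vb\<close>. Each idempotent fixes or kills \<open>va\<close>, so the cardinality counts
  those of the r-th term that fix it, and the polynomial factor contributes its derivative.\<close>

lemma deriv_separates:
  fixes m :: "'r \<Rightarrow> nat"
  assumes "U.ev U.Cas f = (\<Sum>r\<in>R. U.smul (c r) (U.ev U.Cas (p r) * (\<Sum>n<m r. U.e (j r n))))"
  shows "poly (pderiv f) (cc (int s))
    = (\<Sum>r\<in>R. c r * of_nat (card {n. n < m r \<and> int l dvd int s - 1 - j r n}) * poly (pderiv (p r)) (cc (int s)))"
proof -
  define y where "y = fr.ev Cf f - (\<Sum>r\<in>R. scal (c r) * (fr.ev Cf (p r) * (\<Sum>n<m r. ef (j r n))))"
  have "pr y = 0"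
    using assms by (simp add: y_def A.pr_diff A.pr_sum A.pr_mult pr_ev_Cf pr_ef U.smul_def)
  then have y: "act y va True (l - s) = 0"
    using act_ideal[OF _ va_trunc] by simp
  have t: "act (fr.ev Cf (p r) * (\<Sum>n<m r. ef (j r n))) va True (l - s)
      = of_nat (card {n. n < m r \<and> int l dvd int s - 1 - j r n}) * (d * poly (pderiv (p r)) (cc (int s)))" for r
  proof -
    have "(\<Sum>n<m r. if int l dvd int s - 1 - j r n then 1 else 0) = (of_nat (card {n. n < m r \<and> int l dvd int s - 1 - j r n}) :: complex)"
      using sum.inter_filter[of "{..<m r}" "\<lambda>_. 1 :: complex" "\<lambda>n. int l dvd int s - 1 - j r n"] by simp
    then have "act (\<Sum>n<m r. ef (j r n)) va = (\<lambda>b i. of_nat (card {n. n < m r \<and> int l dvd int s - 1 - j r n}) * va b i)"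
      unfolding act_sum act_ef by (simp only: sum_distrib_right[symmetric])
    then show ?thesis
      by (simp add: act_mult act_scale act_ev) (simp add: va_def vb_def)
  qed
  have f: "act (fr.ev Cf f) va True (l - s) = d * poly (pderiv f) (cc (int s))"
    by (simp add: act_ev) (simp add: va_def vb_def)
  have "d * poly (pderiv f) (cc (int s))
    = (\<Sum>r\<in>R. c r * (of_nat (card {n. n < m r \<and> int l dvd int s - 1 - j r n}) * (d * poly (pderiv (p r)) (cc (int s)))))"
    using y unfolding y_def act_diff act_sum act_scal_mult f t by (rule right_minus_eq[THEN iffD1])
  also have "\<dots> = d * (\<Sum>r\<in>R. c r * of_nat (card {n. n < m r \<and> int l dvd int s - 1 - j r n}) * poly (pderiv (p r)) (cc (int s)))"
    by (simp only: sum_distrib_left mult_ac)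
  finally show ?thesis
    by simp
qed

end

section \<open>The Higman ideal in terms of the Casimir element\<close>

lemma polynomial_interpolation:
  fixes g :: "'a::field \<Rightarrow> 'a"
  assumes "finite A"
  shows "\<exists>p. \<forall>x\<in>A. poly p x = g x"
  using assms
proof induction
  case (insert a A)
  then obtain p where p: "\<forall>x\<in>A. poly p x = g x"
    by blast
  define Q where "Q = (\<Prod>x\<in>A. [:- x, 1:])"
  have Q: "poly Q x = 0" if "x \<in> A" for x
    using that insert(1) by (auto simp: Q_def poly_prod)
  have "poly Q a \<noteq> 0"
    using insert by (auto simp: Q_def poly_prod)
  then have "\<forall>x\<in>insert a A. poly (p + smult ((g a - poly p a) / poly Q a) Q) x = g x"
    using p Q by auto
  then show ?case ..
qed auto

context odd_root
begin

lemma poly_cpol: "poly (cpol n) x = x - cc n"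
  by (simp add: cpol_def)

lemma Psis_prod:
  assumes "i < l"
  shows "Psis i = (\<Prod>k\<in>{..<l} - {i}. cpol (int k))"
proof -
  have "cpol (int i) * (\<Prod>k\<in>{..<l} - {i}. cpol (int k)) = cpol (int i) * Psis i"
    using assms by (subst prod.remove[symmetric]) (simp_all add: Psis_eq Psi_def)
  then show ?thesis
    by simp
qed

lemma pderiv_Psi_Psis: "pderiv Psi = (\<Sum>i<l. Psis i)"
  by (simp add: Psi_def pderiv_prod Psis_prod cpol_def pderiv_pCons)

lemma reflect_neq: "s \<le> l \<Longrightarrow> s \<noteq> l - s"
proof
  assume "s \<le> l" "s = l - s"
  then have "l = 2 * s"
    by simp
  then show False
    using odd_l by simp
qed

lemma cc_eq_cases:
  assumes "1 \<le> s" "s < l" "r \<le> l"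
  shows "cc (int r) = cc (int s) \<longleftrightarrow> r = s \<or> r = l - s"
proof
  assume "cc (int r) = cc (int s)"
  then have "int l dvd int r - int s \<or> int l dvd int r + int s"
    by (simp add: cc_eq_iff)
  then show "r = s \<or> r = l - s"
  proof
    assume "int l dvd int r - int s"
    moreover have "\<bar>int r - int s\<bar> < int l"
      using assms by linarith
    ultimately have "int r - int s = 0"
      using dvd_imp_le_int[of "int r - int s" "int l"] by fastforce
    then show ?thesis
      by simp
  next
    assume "int l dvd int r + int s"
    then have "l dvd r + s"
      by (simp only: of_nat_add[symmetric] of_nat_dvd_iff)
    then obtain k where k: "r + s = l * k"
      by (rule dvdE)
    have "k \<noteq> 0"
      using k assms by (intro notI) simp
    moreover have "\<not> 2 \<le> k"
      using k assms mult_le_mono2[of 2 k l] by linarith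
    ultimately have "k = 1"
      by simp
    then have "r + s = l"
      using k by simp
    then show ?thesis
      by auto
  qed
qed (use assms in \<open>auto simp: of_nat_diff\<close>)

text \<open>Removing the factor with index r leaves both factors with root c_s, namely those with
  indices s and l - s. So c_s remains a double root.\<close>

lemma pderiv_Psis_other:
  assumes "1 \<le> s" "s < l" "r \<le> l" "r \<noteq> s" "r \<noteq> l - s"
  shows "poly (pderiv (Psis r)) (cc (int s)) = 0"
proof -
  have ne: "cc (int s) - cc (int r) \<noteq> 0"
    using cc_eq_cases[OF assms(1-3)] assms(4,5) by (metis right_minus_eq)
  have "s \<noteq> l - s"
    by (rule reflect_neq) (use assms in simp)
  then have z: "poly (Psis s) (cc (int s)) = 0"
    using assms by (auto simp: Psis_prod poly_prod poly_cpol of_nat_diff intro!: bexI[of _ "l - s"])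
  have *: "poly (pderiv Psi) x = poly (Psis t) x + (x - cc (int t)) * poly (pderiv (Psis t)) x" for t x
    unfolding Psis_eq[of t, symmetric] by (simp add: pderiv_mult poly_cpol) (simp add: cpol_def pderiv_pCons)
  have "(cc (int s) - cc (int r)) * poly (Psis r) (cc (int s)) = poly Psi (cc (int s))"
    unfolding Psis_eq[of r, symmetric] by (simp add: poly_cpol)
  also have "\<dots> = 0"
    unfolding Psis_eq[of s, symmetric] by (simp add: poly_cpol)
  finally have "poly (Psis r) (cc (int s)) = 0"
    using ne by simp
  then show ?thesis
    using *[of "cc (int s)" s] *[of "cc (int s)" r] z ne by simp
qed

text \<open>After the factor s is removed, only the factor l - s has the root c_s, so the root is
  simple.\<close>

lemma pderiv_Psis_self:
  assumes "1 \<le> s" "s < l"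
  shows "poly (pderiv (Psis s)) (cc (int s)) \<noteq> 0"
proof -
  define Q where "Q = (\<Prod>k\<in>{..<l} - {s} - {l - s}. cpol (int k))"
  have "s \<noteq> l - s"
    by (rule reflect_neq) (use assms in simp)
  then have "Psis s = cpol (int (l - s)) * Q"
    unfolding Psis_prod[OF assms(2)] Q_def using assms by (intro prod.remove) auto
  then have "poly (pderiv (Psis s)) (cc (int s)) = poly Q (cc (int s))"
    using assms by (simp add: pderiv_mult poly_cpol of_nat_diff) (simp add: cpol_def pderiv_pCons)
  moreover have "cc (int s) - cc (int k) \<noteq> 0" if "k < l" "k \<noteq> s" "k \<noteq> l - s" for k
    using cc_eq_cases[of s k] assms that by (metis less_imp_le right_minus_eq)
  then have "poly Q (cc (int s)) \<noteq> 0"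
    by (auto simp: Q_def poly_prod poly_cpol)
  ultimately show ?thesis
    by simp
qed

end

context uq
begin

text \<open>(C - c_i) times \<open>Psis i\<close> at C is \<open>Psi\<close> at C, that is 0; next
  to \<open>Psis i\<close>, any f(C) therefore acts as its value at c_i.\<close>

lemma ev_Psis: "ev Cas (Psis i * f) = poly f (cc (int i)) \<cdot> ev Cas (Psis i)"
proof -
  have "poly (f - [:poly f (cc (int i)):]) (cc (int i)) = 0"
    by simp
  then obtain g where "f - [:poly f (cc (int i)):] = cpol (int i) * g"
    unfolding poly_eq_0_iff_dvd cpol_def by (rule dvdE)
  then have f: "f = cpol (int i) * g + [:poly f (cc (int i)):]"
    by (simp add: algebra_simps)
  have "Psis i * f = Psi * g + smult (poly f (cc (int i))) (Psis i)"
    by (subst f) (simp add: Psis_eq[of i, symmetric] distrib_left mult_ac)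
  then show ?thesis
    by (simp add: ev_add ev_mult ev_Psi ev_smult)
qed

text \<open>For 0 < r < l the element \<open>Rad r\<close> arises twice, from the indices r and l -
  r, with equal values of f. \<open>Rad l\<close> arises once, from the index 0, where its partner
  \<open>Rad 0\<close> is an empty sum.\<close>

lemma ev_pderiv_Psi:
  "ev Cas (pderiv Psi * f) = (\<Sum>r=1..l. (if r < l then 2 * (d ^ (l - 1) * poly f (cc (int r))) else d ^ (l - 1) * poly f (cc 0)) \<cdot> Rad r)"
proof -
  define a where "a r = d ^ (l - 1) * poly f (cc (int r))" for r :: nat
  have "ev Cas (pderiv Psi * f) = (\<Sum>i<l. a i \<cdot> (Rad i + Rad (l - i)))"
  proof -
    have "poly f (cc (int i)) \<cdot> ev Cas (Psis i) = a i \<cdot> (Rad i + Rad (l - i))" if "i < l" for i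
      using Rad_pair[of i] that by (simp add: a_def mult.commute flip: scale_scale)
    then show ?thesis
      by (simp add: pderiv_Psi_Psis sum_distrib_right ev_sum ev_Psis)
  qed
  also have "{..<l} = insert 0 {1..<l}"
    by auto
  also have "(\<Sum>i\<in>insert 0 {1..<l}. a i \<cdot> (Rad i + Rad (l - i)))
      = a 0 \<cdot> Rad l + ((\<Sum>i=1..<l. a i \<cdot> Rad i) + (\<Sum>i=1..<l. a i \<cdot> Rad (l - i)))"
    by (simp add: scale_right_distrib sum.distrib Rad_def)
  also have "(\<Sum>i=1..<l. a i \<cdot> Rad (l - i)) = (\<Sum>i=1..<l. a i \<cdot> Rad i)"
    by (rule sum.reindex_bij_witness[of _ "\<lambda>i. l - i" "\<lambda>i. l - i"]) (auto simp: a_def of_nat_diff)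
  also have "(\<Sum>i=1..<l. a i \<cdot> Rad i) + (\<Sum>i=1..<l. a i \<cdot> Rad i) = (\<Sum>i=1..<l. (if i < l then 2 * a i else a 0) \<cdot> Rad i)"
    by (simp add: sum.distrib[symmetric] scale_left_distrib[symmetric])
  also have "a 0 \<cdot> Rad l + \<dots> = (\<Sum>i\<in>insert l {1..<l}. (if i < l then 2 * a i else a 0) \<cdot> Rad i)"
    by simp
  also have "insert l {1..<l} = {1..l}"
    using l_ge by auto
  finally show ?thesis
    unfolding a_def by (simp only: of_nat_0)
qed

text \<open>A spanning family in which E and F never occur together, since a product of both is
  replaced by an expression in C and K. It suits \<open>Tau\<close>, which is linear over the
  polynomials in C and is sensitive to the weight.\<close>

definition triangular :: "'a set" where
  "triangular = {ev Cas f * (x ^ u * Kp p) | f x u p. x = E \<or> x = F}"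

lemma triangularI: "ev Cas f * (E ^ u * Kp p) \<in> span triangular" "ev Cas f * (F ^ u * Kp p) \<in> span triangular"
  by (auto simp: triangular_def intro!: span_base)

lemma one_span: "1 \<in> span triangular"
  using triangularI(1)[of 1 0 0] by simp

lemma mult_span:
  assumes "\<And>b. b \<in> triangular \<Longrightarrow> x * b \<in> span triangular" and "z \<in> span triangular"
  shows "x * z \<in> span triangular"
proof -
  have "subspace {z. x * z \<in> span triangular}"
    by (rule subspaceI) (auto simp: distrib_left intro: span_add span_scale span_zero)
  then show ?thesis
    using assms(2) span_induct[of z triangular "\<lambda>z. x * z \<in> span triangular"] assms(1) by blast
qed

lemma Kp_span: "z \<in> span triangular \<Longrightarrow> Kp n * z \<in> span triangular"
proof (rule mult_span)
  fix b assume "b \<in> triangular"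
  then obtain f x u p where b: "b = ev Cas f * (x ^ u * Kp p)" and x: "x = E \<or> x = F"
    by (auto simp: triangular_def)
  have *: "Kp n * (ev Cas f * y) = ev Cas f * (Kp n * y)" for y
    by (simp add: mult.assoc[symmetric] ev_Kp)
  show "Kp n * b \<in> span triangular"
    using x by (auto simp: b * Kp_E' Kp_F' Kp_add[symmetric] intro!: span_scale triangularI)
qed

text \<open>If the next letter of the word is of the other kind, the pair y x is rewritten through C
  and K, and the word gets shorter; otherwise the power grows. Stated once for both roles of E and
  F.\<close>

lemma Casimir_span:
  assumes "d \<cdot> (y * x) = Cas - a \<cdot> Kp 1 - b \<cdot> Kp (- 1)" and "x = E \<and> y = F \<or> x = F \<and> y = E"
    and z: "z \<in> span triangular"
  shows "y * z \<in> span triangular"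
  using _ z
proof (rule mult_span)
  fix b' assume "b' \<in> triangular"
  then obtain f t u p where b': "b' = ev Cas f * (t ^ u * Kp p)" and t: "t = E \<or> t = F"
    by (auto simp: triangular_def)
  have C: "ev Cas f * (Cas * w) = ev Cas ([:0, 1:] * f) * w" for w
    by (simp only: ev_mult ev_monom mult.assoc[symmetric] ev_commute[of Cas Cas f, OF refl])
  have yx: "y * x = (1 / d) \<cdot> (Cas - a \<cdot> Kp 1 - b \<cdot> Kp (- 1))"
    unfolding assms(1)[symmetric] by simp
  have ye: "y * (ev Cas f * w) = ev Cas f * (y * w)" for w
    using assms(2) ev_E[of 1 f] ev_F[of 1 f] by (auto simp: mult.assoc[symmetric])
  have base: "ev Cas g * (x ^ n * Kp k) \<in> span triangular" "ev Cas g * (y ^ n * Kp k) \<in> span triangular" for g n k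
    using assms(2) triangularI by auto
  have K: "Kp k * (x ^ n * w) \<in> range (\<lambda>c. c \<cdot> (x ^ n * (Kp k * w)))" for k n w
    using assms(2) Kp_E' Kp_F' by auto
  show "y * b' \<in> span triangular"
  proof (cases "t = y \<or> u = 0")
    case True
    then have "y * b' = ev Cas f * (y ^ Suc u * Kp p)"
      by (auto simp: b' ye mult.assoc)
    then show ?thesis
      by (simp only: base)
  next
    case False
    then obtain v where "b' = ev Cas f * (x * (x ^ v * Kp p))"
      using t assms(2) by (cases u) (auto simp: b' mult.assoc)
    then have "y * b' = ev Cas f * ((y * x) * (x ^ v * Kp p))"
      by (simp only: ye mult.assoc)
    moreover obtain c c' where "Kp 1 * (x ^ v * Kp p) = c \<cdot> (x ^ v * Kp (1 + p))"
      "Kp (- 1) * (x ^ v * Kp p) = c' \<cdot> (x ^ v * Kp (- 1 + p))"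
      using K[of 1 v "Kp p"] K[of "- 1" v "Kp p"] unfolding Kp_add by blast
    ultimately show ?thesis
      by (simp only: yx left_diff_distrib right_diff_distrib smul_mult mult_smul C) (intro span_scale span_diff base)
  qed
qed

lemma E_span: "z \<in> span triangular \<Longrightarrow> E * z \<in> span triangular"
  by (rule Casimir_span[OF dEF]) simp_all

lemma F_span: "z \<in> span triangular \<Longrightarrow> F * z \<in> span triangular"
  by (rule Casimir_span[OF dFE]) simp_all

lemma Tau_1': "Tau 1 = ((of_nat l)\<^sup>2 / d ^ (l - 1)) \<cdot> ev Cas (pderiv Psi)"
proof -
  have "Tau 1 = (1 / d ^ (l - 1)) \<cdot> (d ^ (l - 1) \<cdot> Tau 1)"
    by simp
  also have "\<dots> = ((of_nat l)\<^sup>2 / d ^ (l - 1)) \<cdot> ev Cas (pderiv Psi)"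
    unfolding Tau_1 by simp
  finally show ?thesis .
qed

lemma Tau_range:
  assumes "z \<in> span triangular"
  shows "\<exists>f. Tau z = ev Cas (pderiv Psi * f)"
proof -
  have sub: "subspace {z. \<exists>f. Tau z = ev Cas (pderiv Psi * f)}"
  proof (rule subspaceI)
    show "0 \<in> {z. \<exists>f. Tau z = ev Cas (pderiv Psi * f)}"
      by (auto intro!: exI[of _ 0])
  next
    fix x y assume "x \<in> {z. \<exists>f. Tau z = ev Cas (pderiv Psi * f)}" "y \<in> {z. \<exists>f. Tau z = ev Cas (pderiv Psi * f)}"
    then obtain f g where "Tau x = ev Cas (pderiv Psi * f)" "Tau y = ev Cas (pderiv Psi * g)"
      by auto
    then have "Tau (x + y) = ev Cas (pderiv Psi * (f + g))"
      by (simp add: Tau_add distrib_left ev_add)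
    then show "x + y \<in> {z. \<exists>f. Tau z = ev Cas (pderiv Psi * f)}"
      by auto
  next
    fix c x assume "x \<in> {z. \<exists>f. Tau z = ev Cas (pderiv Psi * f)}"
    then obtain f where "Tau x = ev Cas (pderiv Psi * f)"
      by auto
    then have "Tau (c \<cdot> x) = ev Cas (pderiv Psi * smult c f)"
      by (simp add: Tau_smul ev_smult)
    then show "c \<cdot> x \<in> {z. \<exists>f. Tau z = ev Cas (pderiv Psi * f)}"
      by blast
  qed
  have "\<exists>f. Tau b = ev Cas (pderiv Psi * f)" if "b \<in> triangular" for b
  proof -
    from that obtain f x u p where b: "b = ev Cas f * (x ^ u * Kp p)" and x: "x = E \<or> x = F"
      by (auto simp: triangular_def)
    show ?thesis
    proof (cases "u = 0 \<and> int l dvd p")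
      case True
      have "Kp p = 1"
        using Kp_mod[of p] True by (simp add: dvd_eq_mod_eq_0)
      then have "Tau b = ev Cas (pderiv Psi * smult ((of_nat l)\<^sup>2 / d ^ (l - 1)) f)"
        using True Tau_ev[of f 1] by (simp add: b Tau_1' ev_smult ev_mult[symmetric] mult.commute)
      then show ?thesis ..
    next
      case False
      have "Tau b = 0"
      proof (cases "u = 0")
        case True
        then show ?thesis
          using False by (simp add: b Tau_ev Tau_Kp)
      next
        case False
        then show ?thesis
          using x Tau_E[of u f p] Tau_F[of u f p] by (auto simp: b)
      qed
      then show ?thesis
        by (intro exI[of _ 0]) simp
    qed
  qed
  then show ?thesis
    using span_induct[of z triangular "\<lambda>z. \<exists>f. Tau z = ev Cas (pderiv Psi * f)"] sub assms by blast
qed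

end

section \<open>Cosets in the two spans and in the Higman ideal, and their comparison\<close>

context uq_concrete
begin

lemma pr_span: "pr x \<in> U.span U.triangular"
proof (induction x rule: poly_mapping_induct)
  case (single w c)
  show ?case
  proof (induction w)
    case Nil
    have "pr (Poly_Mapping.single [] c) = scq c"
      by (simp only: scal_def zero_list_def)
    also have "\<dots> = U.smul c 1"
      by (rule U.smul_1_eq[symmetric])
    finally have "pr (Poly_Mapping.single [] c) = U.smul c 1" .
    then show ?case
      by (simp add: U.span_scale U.one_span)
  next
    case (Cons g w)
    have "Poly_Mapping.single (g # w) c = gen g * Poly_Mapping.single w c"
      by (simp add: gen_def mult_single plus_list_def)
    moreover have "pr fK * z \<in> U.span U.triangular" if "z \<in> U.span U.triangular" for z
      using U.Kp_span[OF that, of 1] by (simp add: U.Kp_1)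
    ultimately show ?case
      using Cons by (cases g) (simp_all add: A.pr_mult U.E_span U.F_span)
  qed
next
  case (add x y)
  then show ?case
    by (simp add: A.pr_add U.span_add)
qed

lemma zeta_nz: "zeta \<noteq> 0"
  using l_ge by (simp add: zeta_def qfact_nz)

lemma higman_ideal_iff: "cls l q x \<in> higman_ideal l q \<longleftrightarrow> (\<exists>f. pr x = U.ev U.Cas (pderiv Psi * f))"
proof
  assume "cls l q x \<in> higman_ideal l q"
  then obtain z where z: "cls l q x = higman_map l q (cls l q z)"
    by (auto simp: higman_ideal_def cls_carrier)
  obtain f where f: "U.Tau (pr z) = U.ev U.Cas (pderiv Psi * f)"
    using U.Tau_range[OF pr_span] by blast
  have "pr x = U.smul zeta (U.Tau (pr z))"
    using z higman_cls[of z] by (auto simp: cls_eq_iff)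
  then have "pr x = U.ev U.Cas (pderiv Psi * smult zeta f)"
    by (simp add: f U.ev_smult)
  then show "\<exists>f. pr x = U.ev U.Cas (pderiv Psi * f)" ..
next
  assume "\<exists>f. pr x = U.ev U.Cas (pderiv Psi * f)"
  then obtain f where f: "pr x = U.ev U.Cas (pderiv Psi * f)" ..
  \<comment> \<open>k cancels the factor zeta l^2 / d^(l-1) with which the Higman map sends 1 to
    Psi'(C). The preimage can be taken to be a polynomial in C.\<close>
  define k where "k = d ^ (l - 1) / (zeta * (of_nat l)\<^sup>2)"
  define z where "z = fr.ev Cf (smult k f)"
  have x: "U.ev U.Cas f * U.ev U.Cas (pderiv Psi) = pr x"
    unfolding f U.ev_mult[symmetric] by (simp only: mult.commute)
  have "U.Tau (pr z) = U.ev U.Cas (smult k f) * U.Tau 1"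
    using U.Tau_ev[of "smult k f" 1] by (simp only: z_def pr_ev_Cf mult_1_right)
  then have "U.smul zeta (U.Tau (pr z)) = U.smul (zeta * k * ((of_nat l)\<^sup>2 / d ^ (l - 1))) (pr x)"
    by (simp only: U.Tau_1' U.ev_smult U.smul_mult U.mult_smul U.scale_scale x mult.assoc mult.commute mult.left_commute)
  also have "zeta * k * ((of_nat l)\<^sup>2 / d ^ (l - 1)) = 1"
    using zeta_nz l_ge by (simp add: k_def)
  finally have z: "U.smul zeta (U.Tau (pr z)) = pr x"
    by (simp only: U.scale_one)
  obtain y where "higman_map l q (cls l q z) = cls l q y" "pr y = U.smul zeta (U.Tau (pr z))"
    using higman_cls[of z] by blast
  then have "higman_map l q (cls l q z) = cls l q x"
    unfolding z by (simp only: cls_eq_iff)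
  from this[symmetric] show "cls l q x \<in> higman_ideal l q"
    unfolding higman_ideal_def cls_carrier by (rule image_eqI) (rule rangeI)
qed

text \<open>Moves a span of cosets into the ring type. The first conclusion allows spans to be
  compared on elements of the form \<open>cls l q x\<close>.\<close>

lemma lin_span_iff:
  assumes "finite J" and z: "\<And>r. r \<in> J \<Longrightarrow> \<exists>y. z r = cls l q y \<and> pr y = v r"
  shows "lin_span l q z J \<subseteq> range (cls l q)"
    and "cls l q x \<in> lin_span l q z J \<longleftrightarrow> (\<exists>c. pr x = (\<Sum>r\<in>J. U.smul (c r) (v r)))"
proof -
  obtain Y where Y: "\<And>r. r \<in> J \<Longrightarrow> z r = cls l q (Y r) \<and> pr (Y r) = v r"
    using z by metis
  interpret R: ring "Uqsl2 l q"
    unfolding Uqsl2_def rel_ideal_def by (rule coset_ring)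
  have s: "(\<Oplus>\<^bsub>Uqsl2 l q\<^esub>r\<in>J. scale l q (c r) (z r)) = cls l q (\<Sum>r\<in>J. scal (c r) * Y r)" for c
  proof -
    have "(\<Oplus>\<^bsub>Uqsl2 l q\<^esub>r\<in>J. scale l q (c r) (z r)) = (\<Oplus>\<^bsub>Uqsl2 l q\<^esub>r\<in>J. cls l q (scal (c r) * Y r))"
      by (rule R.finsum_cong') (auto simp: Y scale_cls cls_carrier)
    then show ?thesis
      by (simp only: cls_finsum[OF assms(1)])
  qed
  show "lin_span l q z J \<subseteq> range (cls l q)"
    by (auto simp: lin_span_def s)
  have "pr (\<Sum>r\<in>J. scal (c r) * Y r) = (\<Sum>r\<in>J. U.smul (c r) (v r))" for c
    by (simp add: A.pr_sum A.pr_mult U.smul_def Y)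
  then show "cls l q x \<in> lin_span l q z J \<longleftrightarrow> (\<exists>c. pr x = (\<Sum>r\<in>J. U.smul (c r) (v r)))"
    by (auto simp: lin_span_def s cls_eq_iff)
qed

lemma drinfeld_span_iff: "cls l q x \<in> drinfeld_span l q \<longleftrightarrow> (\<exists>f. pr x = U.ev U.Cas f)"
proof -
  have "cls l q x \<in> drinfeld_span l q \<longleftrightarrow> (\<exists>c. pr x = (\<Sum>r=1..l. U.smul (c r) (U.Del r)))"
    unfolding drinfeld_span_def using drinfeld_cls by (intro lin_span_iff(2)) auto
  also have "\<dots> \<longleftrightarrow> (\<exists>f. pr x = U.ev U.Cas f)"
  proof
    show "\<exists>c. pr x = (\<Sum>r=1..l. U.smul (c r) (U.Del r)) \<Longrightarrow> \<exists>f. pr x = U.ev U.Cas f"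
      unfolding U.sum_Del_ev by blast
    assume "\<exists>f. pr x = U.ev U.Cas f"
    then obtain f where "pr x = U.ev U.Cas f" ..
    then show "\<exists>c. pr x = (\<Sum>r=1..l. U.smul (c r) (U.Del r))"
      using U.Del_span[of f] by (simp only:)
  qed
  finally show ?thesis .
qed

lemma radford_span_iff: "cls l q x \<in> radford_span l q \<longleftrightarrow> (\<exists>b. pr x = (\<Sum>r=1..l. U.smul (b r) (U.Rad r)))"
proof -
  have "cls l q x \<in> radford_span l q \<longleftrightarrow> (\<exists>c. pr x = (\<Sum>r=1..l. U.smul (c r) (U.smul (zeta * of_nat l) (U.Rad r))))"
    unfolding radford_span_def using radford_cls by (intro lin_span_iff(2)) auto
  also have "\<dots> \<longleftrightarrow> (\<exists>b. pr x = (\<Sum>r=1..l. U.smul (b r) (U.Rad r)))"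
  proof
    assume "\<exists>b. pr x = (\<Sum>r=1..l. U.smul (b r) (U.Rad r))"
    then obtain b where "pr x = (\<Sum>r=1..l. U.smul (b r) (U.Rad r))" ..
    then have "pr x = (\<Sum>r=1..l. U.smul (b r / (zeta * of_nat l)) (U.smul (zeta * of_nat l) (U.Rad r)))"
      using zeta_nz l_ge by simp
    then show "\<exists>c. pr x = (\<Sum>r=1..l. U.smul (c r) (U.smul (zeta * of_nat l) (U.Rad r)))"
      by (rule exI[of _ "\<lambda>r. b r / (zeta * of_nat l)"])
  qed auto
  finally show ?thesis .
qed

text \<open>Only r = s survives in \<open>deriv_separates\<close>. For r = l - s no weight 2 n + 1 -
  r equals s - 1 modulo l; for r other than s and l - s the derivative at the double root is 0; for
  r = s exactly n = s - 1 has the weight of \<open>va\<close>.\<close>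

lemma radford_coefficient:
  assumes f: "U.ev U.Cas f = (\<Sum>r=1..l. U.smul (b r) (U.Rad r))" and s: "1 \<le> s" "s < l"
  shows "poly (pderiv f) (cc (int s)) = b s / d ^ (l - 1) * poly (pderiv (Psis s)) (cc (int s))"
proof -
  interpret proj_module l h q s
    using s by unfold_locales
  have "U.ev U.Cas f = (\<Sum>r=1..l. U.smul (b r / d ^ (l - 1)) (U.ev U.Cas (Psis r) * (\<Sum>n<r. U.e (2 * int n + 1 - int r))))"
    unfolding f by (rule sum.cong[OF refl]) (simp flip: U.Rad_eq)
  from deriv_separates[OF this]
  have "poly (pderiv f) (cc (int s)) = (\<Sum>r=1..l. b r / d ^ (l - 1)
      * of_nat (card {n. n < r \<and> int l dvd int s - 1 - (2 * int n + 1 - int r)}) * poly (pderiv (Psis r)) (cc (int s)))" .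
  also have "\<dots> = (\<Sum>r=1..l. if r = s then b s / d ^ (l - 1) * poly (pderiv (Psis s)) (cc (int s)) else 0)"
  proof (rule sum.cong[OF refl])
    fix r assume r: "r \<in> {1..l}"
    consider "r = s" | "r = l - s" "r \<noteq> s" | "r \<noteq> s" "r \<noteq> l - s"
      by blast
    then show "b r / d ^ (l - 1) * of_nat (card {n. n < r \<and> int l dvd int s - 1 - (2 * int n + 1 - int r)}) * poly (pderiv (Psis r)) (cc (int s))
      = (if r = s then b s / d ^ (l - 1) * poly (pderiv (Psis s)) (cc (int s)) else 0)"
    proof cases
      case 1
      have "int l dvd int s - 1 - (2 * int n + 1 - int s) \<longleftrightarrow> n = s - 1" if "n < s" for n
      proof -
        have "int s - 1 - (2 * int n + 1 - int s) = 2 * int (s - 1 - n)"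
          using that s by (simp add: of_nat_diff)
        then have "int l dvd int s - 1 - (2 * int n + 1 - int s) \<longleftrightarrow> l dvd s - 1 - n"
          by (simp only: l_dvd_double of_nat_dvd_iff)
        also have "\<dots> \<longleftrightarrow> s - 1 - n = 0"
          using s by (auto dest: dvd_imp_le)
        finally show ?thesis
          using that by auto
      qed
      then have "{n. n < s \<and> int l dvd int s - 1 - (2 * int n + 1 - int s)} = {s - 1}"
        using s by auto
      then show ?thesis
        unfolding 1 by simp
    next
      case 2
      have "\<not> int l dvd int s - 1 - (2 * int n + 1 - int r)" if "n < r" for n
      proof
        assume "int l dvd int s - 1 - (2 * int n + 1 - int r)"
        \<comment> \<open>The difference of weights is l - 2 (n + 1), and 0 < n + 1 < l.\<close>
        moreover have "int s - 1 - (2 * int n + 1 - int r) = - (2 * int (n + 1)) + int l * 1"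
          using 2 s by (simp add: of_nat_diff)
        ultimately have "int l dvd - (2 * int (n + 1)) + int l * 1"
          by (simp only:)
        then have "l dvd n + 1"
          by (simp only: dvd_add_left_iff[OF dvd_triv_left] dvd_minus_iff l_dvd_double of_nat_dvd_iff)
        then show False
          using that 2 s by (auto dest: dvd_imp_le)
      qed
      then have "{n. n < r \<and> int l dvd int s - 1 - (2 * int n + 1 - int r)} = {}"
        by blast
      then show ?thesis
        using 2 by (simp only: card.empty of_nat_0 if_False mult_zero_right mult_zero_left)
    next
      case 3
      then show ?thesis
        using r s by (simp add: pderiv_Psis_other)
    qed
  qed
  also have "\<dots> = b s / d ^ (l - 1) * poly (pderiv (Psis s)) (cc (int s))"
    using s by simp
  finally show ?thesis .
qed

text \<open>f' at c_s determines both \<open>b s\<close> and \<open>b (l - s)\<close> with the same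
  nonzero constant, so they agree. Hence the values required of g depend only on the root, and
  interpolation supplies g.\<close>

lemma higman_from_intersection:
  assumes f: "U.ev U.Cas f = (\<Sum>r=1..l. U.smul (b r) (U.Rad r))"
  shows "\<exists>g. U.ev U.Cas f = U.ev U.Cas (pderiv Psi * g)"
proof -
  have sym: "b (l - s) = b s" if "1 \<le> s" "s < l" for s
  proof -
    have "b (l - s) / d ^ (l - 1) * poly (pderiv (Psis s)) (cc (int s)) = b s / d ^ (l - 1) * poly (pderiv (Psis s)) (cc (int s))"
    proof -
      have "1 \<le> l - s" "l - s < l" "s \<le> l"
        using that by simp_all
      then show ?thesis
        using radford_coefficient[OF f, of s] radford_coefficient[OF f, of "l - s"] that
        by (simp only: of_nat_diff Psis_reflect cc_reflect)
    qed
    then show ?thesis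
      using pderiv_Psis_self[OF that] by simp
  qed
  \<comment> \<open>The value required of g at c_i. By \<open>ev_pderiv_Psi\<close> an index 0 < i <
    l collects two equal contributions, hence the half, and the coefficient at l belongs to the
    simple root c_0.\<close>
  define v where "v i = (if i = 0 then b l else b i / 2) / d ^ (l - 1)" for i
  have v: "v i = v j" if "i < l" "j < l" "cc (int i) = cc (int j)" for i j
  proof (cases "j = 0")
    case True
    then show ?thesis
      using that cc_eq_cases[of i j] by (cases "i = 0") auto
  next
    case False
    then show ?thesis
      using that cc_eq_cases[of j i] sym[of j] by (auto simp: v_def)
  qed
  \<comment> \<open>The choice selects some index with the given root; which one does not matter, by
    the preceding fact \<open>v\<close>.\<close>
  obtain g where g: "\<And>x. x \<in> (\<lambda>i. cc (int i)) ` {..<l} \<Longrightarrow> poly g x = v (SOME i. i < l \<and> cc (int i) = x)"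
    using polynomial_interpolation[of "(\<lambda>i. cc (int i)) ` {..<l}" "\<lambda>x. v (SOME i. i < l \<and> cc (int i) = x)"] by auto
  have gv: "poly g (cc (int i)) = v i" if "i < l" for i
  proof -
    define k where "k = (SOME j. j < l \<and> cc (int j) = cc (int i))"
    have k: "k < l \<and> cc (int k) = cc (int i)"
      unfolding k_def using that by (intro someI[of "\<lambda>j. j < l \<and> cc (int j) = cc (int i)" i] conjI refl)
    have "poly g (cc (int i)) = v k"
      unfolding k_def by (rule g) (use that in blast)
    also have "v k = v i"
      using k that by (intro v) auto
    finally show ?thesis .
  qed
  have "(if r < l then 2 * (d ^ (l - 1) * poly g (cc (int r))) else d ^ (l - 1) * poly g (cc 0)) = b r" if "r \<in> {1..l}" for r
    using that gv[of r] gv[of 0] by (auto simp: v_def)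
  then have "U.ev U.Cas (pderiv Psi * g) = U.ev U.Cas f"
    unfolding U.ev_pderiv_Psi f by (intro sum.cong refl) (simp only:)
  then show ?thesis
    by metis
qed

lemma P_span_eq_higman_ideal: "P_span l q = higman_ideal l q"
proof -
  have "higman_ideal l q \<subseteq> range (cls l q)"
  proof
    fix X assume "X \<in> higman_ideal l q"
    then obtain z where "X = higman_map l q (cls l q z)"
      by (auto simp: higman_ideal_def cls_carrier)
    then show "X \<in> range (cls l q)"
      using higman_cls[of z] by auto
  qed
  moreover have "P_span l q \<subseteq> range (cls l q)"
    unfolding P_span_def drinfeld_span_def using drinfeld_cls
    by (intro le_infI1 lin_span_iff(1)[where v = U.Del]) auto
  moreover have "cls l q x \<in> P_span l q \<longleftrightarrow> cls l q x \<in> higman_ideal l q" for x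
    unfolding P_span_def Int_iff drinfeld_span_iff radford_span_iff higman_ideal_iff
  proof (intro iffI conjI)
    assume "(\<exists>f. pr x = U.ev U.Cas f) \<and> (\<exists>b. pr x = (\<Sum>r=1..l. U.smul (b r) (U.Rad r)))"
    then obtain f b where f: "pr x = U.ev U.Cas f" and "pr x = (\<Sum>r=1..l. U.smul (b r) (U.Rad r))"
      by blast
    then have "U.ev U.Cas f = (\<Sum>r=1..l. U.smul (b r) (U.Rad r))"
      by (simp only:)
    then show "\<exists>g. pr x = U.ev U.Cas (pderiv Psi * g)"
      unfolding f by (rule higman_from_intersection)
  next
    assume "\<exists>g. pr x = U.ev U.Cas (pderiv Psi * g)"
    then obtain g where g: "pr x = U.ev U.Cas (pderiv Psi * g)" ..
    then show "\<exists>f. pr x = U.ev U.Cas f" ..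
    show "\<exists>b. pr x = (\<Sum>r=1..l. U.smul (b r) (U.Rad r))"
      unfolding g U.ev_pderiv_Psi by (rule exI) (rule refl)
  qed
  ultimately show ?thesis
    by blast
qed

end

theorem proposition6p2p5:
  fixes l h :: nat and q :: complex
  assumes "l = 2 * h + 1" and "l \<ge> 3" and "primitive_root l q"
  shows "P_span l q = higman_ideal l q"
proof -
  interpret uq_concrete l h q
    using assms by unfold_locales
  show ?thesis
    by (rule P_span_eq_higman_ideal)
qed

end
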